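(* Let $A$ be a quantum nilpotent $\mathbb{K}$-algebra in $N$ generators such that $\lambda_{i,j}=q^{m_{i,j}}$ for some $1\ne q\in\mathbb{K}^*$ and some skew-symmetric matrix $(m_{i,j})\in M_N(\mathbb{Z})$. Let $P\in\mathrm{C.Spec}_w(A)$ for some $w\in\mathcal{W}'$, and put $B=A/P$, $B'=A'/\psi(P)$, with $B'$ identified with a subalgebra of $\mathrm{Frac}(B)$. Let $t_i$ be the image of $T_i$ in $B'$, let $\Sigma\subseteq B'$ be the multiplicatively closed set generated by the $t_i$ with $i\in[\![1,N]\!]\setminus w$, and let $\Gamma=\Sigma_{N+1}\subseteq B$ be the Ore set defined in the context. Suppose $(\phi',V)$ is an irreducible representation of $B'$ such that for each $e\in\Sigma$ there exist $\xi=\xi_e\in\mathbb{K}^*$ and $\ell=\ell_e\in\mathbb{N}_{>1}$ with $\phi'(e)^{\ell}=\xi\,\mathrm{Id}_V$. Then: 1. For any $b\in B$ there exist $b'\in B'$ and $e\in\Sigma$ such that $b=b'e^{-1}\in B'\Sigma^{-1}$, and $\phi'$ induces an irreducible representation of $B$ on $V$ (of the same dimension), defined by the algebra homomorphism $$\phi:B\to\mathrm{End}_{\mathbb{K}}(V),\qquad b\mapsto\xi_e^{-1}\phi'(b')\phi'(e)^{\ell_e-1}.$$ 2. For each $g\in\Gamma$ there exist $\xi'\in\mathbb{K}^*$ and $\ell'\in\mathbb{N}_{>1}$ such that $\phi(g)^{\ell'}=\xi'\,\mathrm{Id}_V$.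
   Context: Notation: $\mathbb{K}$ is a field; $[\![a,b]\!]$ is the set of integers from $a$ to $b$. $\mathbb{K}_\Lambda[T_1,\dots,T_N]$ is the algebra generated by $T_1,\dots,T_N$ with defining relations $T_iT_j=\lambda_{i,j}T_jT_i$. Ore extensions: in $R[x;\sigma,\delta]$, $\sigma$ is a $\mathbb{K}$-algebra automorphism of $R$, $\delta$ is a $\mathbb{K}$-linear $\sigma$-derivation, $\delta(ab)=\sigma(a)\delta(b)+\delta(a)b$, and $xr=\sigma(r)x+\delta(r)$. Higher skew derivations: for $1\ne p\in\mathbb{K}^*$, $\delta$ extends to a higher $p$-skew $\sigma$-derivation $\{d_n\}_{n\ge0}$ on $R$ if the $d_n$ are $\mathbb{K}$-linear operators on $R$ with $d_0=\mathrm{id}$, $d_1=\delta$, $d_n(rs)=\sum_{i=0}^n\sigma^{n-i}d_i(r)\,d_{n-i}(s)$ and $d_n\circ\sigma=p^n\sigma\circ d_n$ for all $n$. It is locally nilpotent if for each $r\in R$ there is $n_r\ge0$ with $d_n(r)=0$ for all $n\ge n_r$, and iterative if $d_nd_m=\binom{n+m}{m}_p d_{n+m}$ for all $n,m$. Quantum nilpotent algebra: $A=\mathbb{K}[X_1][X_2;\sigma_2,\delta_2]\cdots[X_N;\sigma_N,\delta_N]$ with $A_{i}=\mathbb{K}\langle X_1,\dots,X_i\rangle$ such that: (1) $\sigma_i(X_l)=\lambda_{i,l}X_l$ for $l<i$, $\lambda_{i,l}\in\mathbb{K}^*$; (2) $\Lambda=(\lambda_{i,j})\in M_N(\mathbb{K}^*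 )$ is multiplicatively antisymmetric ($\lambda_{i,l}=\lambda_{l,i}^{-1}$, $\lambda_{i,i}=1$); (3) for $2\le i\le N$ there is $1\ne q_i\in\mathbb{K}^*$ with $\delta_i\circ\sigma_i=q_i\sigma_i\circ\delta_i$; (4) for $2\le i\le N$, $\delta_i$ extends to a (fixed) locally nilpotent, iterative higher $q_i$-skew $\sigma_i$-derivation $\{d_{i,n}\}_{n\ge0}$ on $A_{i-1}$, and $\sigma_l\circ d_{i,n}=\lambda_{l,i}^n d_{i,n}\circ\sigma_l$ on $A_{i-1}$ for all $n\ge0$, $i+1\le l\le N$. Such an $A$ is a Noetherian domain. Deleting derivations algorithm: put $X_i^{(N+1)}=X_i$, and let $A^{(j)}$ be the subalgebra of $\mathrm{Frac}(A)$ generated by $X_1^{(j)},\dots,X_N^{(j)}$. For $j=N,N-1,\dots,2$ write $x_i=X_i^{(j+1)}$, $y_i=X_i^{(j)}$. There is a $\mathbb{K}$-algebra isomorphism $A^{(j+1)}\to\mathbb{K}[X_1]\cdots[X_j;\sigma_j,\delta_j][X_{j+1};\sigma_{j+1}^{(j+1)}]\cdots[X_N;\sigma_N^{(j+1)}]$, $x_i\mapsto X_i$, with $\sigma_i^{(j+1)}(X_l)=\lambda_{i,l}X_l$ for $l<i$; via it $\sigma_j$ and $d_{j,n}$ are regarded as maps on $\mathbb{K}\langle x_1,\dots,x_{j-1}\rangle\cong A_{j-1}$. Then $y_l=x_l$ for $l\ge j$ and $y_l=\sum_{n\ge0}q_j^{n(n+1)/2}(q_j-1)^{-n}d_{j,n}\circ\sigma_j^{-n}(x_l)\,x_j^{-n}$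 (a finite sum) for $l<j$. The set $S_j=\{x_j^n\}_{n\ge0}=\{y_j^n\}_{n\ge0}$ is a two-sided Ore set of regular elements in $A^{(j)}$ and $A^{(j+1)}$, and $A^{(j)}S_j^{-1}=A^{(j+1)}S_j^{-1}$. Put $A'=A^{(2)}$, $T_i=X_i^{(2)}$; then $A'=\mathbb{K}_\Lambda[T_1,\dots,T_N]$. Canonical embedding: $\mathrm{C.Spec}(R)$ is the set of completely prime ideals of $R$ (ideals $P$ with $R/P$ a domain). There is a surjective homomorphism $g_j:A^{(j)}\to A^{(j+1)}/\langle x_j\rangle$, $y_i\mapsto x_i+\langle x_j\rangle$. The injective map $\psi_j:\mathrm{C.Spec}(A^{(j+1)})\to\mathrm{C.Spec}(A^{(j)})$ is $\psi_j(P)=PS_j^{-1}\cap A^{(j)}$ if $x_j\notin P$ and $\psi_j(P)=g_j^{-1}(P/\langle x_j\rangle)$ if $x_j\in P$; and $\psi=\psi_2\circ\cdots\circ\psi_N:\mathrm{C.Spec}(A)\to\mathrm{C.Spec}(A')$. Partition: for $w\subseteq[\![1,N]\!]$, $\mathrm{C.Spec}_w(A')=\{Q\in\mathrm{C.Spec}(A')\mid Q\cap\{T_1,\dots,T_N\}=\{T_i\mid i\in w\}\}$, $\mathrm{C.Spec}_w(A)=\psi^{-1}(\mathrm{C.Spec}_w(A'))$, and $\mathcal{W}'$ is the set of $w$ with $\mathrm{C.Spec}_w(A)\ne\emptyset$. Identification: put $P_{N+1}=P$, $P_j=\psi_j\circ\cdots\circ\psi_N(P)$, $B^{(j)}=A^{(j)}/P_j$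 (so $B^{(N+1)}=B$, $B^{(2)}=B'$). If $x_j\in P_{j+1}$, $g_j$ induces an isomorphism $B^{(j)}\cong B^{(j+1)}$, used to identify these algebras. If $x_j\notin P_{j+1}$, then $P_jS_j^{-1}=P_{j+1}S_j^{-1}=:\Theta$ in $\Omega:=A^{(j)}S_j^{-1}=A^{(j+1)}S_j^{-1}$, and both $B^{(j)}$ and $B^{(j+1)}$ embed naturally in $\Omega/\Theta$, which is the localisation of each of them at the powers of the image of $x_j$. Thus every $B^{(j)}$ is regarded as a subalgebra of $\mathrm{Frac}(B)$. Ore sets: $\Sigma_2=\Sigma$ and $\Sigma_{j+1}=B^{(j+1)}\cap\Sigma_j$ for $j\in[\![2,N]\!]$; $\Gamma=\Sigma_{N+1}$. $\Sigma$ and $\Gamma$ are two-sided Ore sets of regular elements in $B'$ and $B$ respectively, and $B\Gamma^{-1}=B'\Sigma^{-1}$ in $\mathrm{Frac}(B)$. *)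

theory Defs
  imports
    "HOL-Algebra.QuotRing"
    "HOL-Algebra.Algebraic_Closure_Type"
    "HOL-Library.Groups_Big_Fun"
begin

text \<open>
  All algebras \<open>A\<close>, \<open>A\<^sub>i\<close>, \<open>A\<^sup>(\<^sup>j\<^sup>)\<close> are subsets of one ambient division ring (a type of class
  \<^class>\<open>division_ring\<close>) which is the division ring of fractions of \<open>A\<close>.  Their quotients are
  formed with the library's \<^const>\<open>FactRing\<close>, whose elements are cosets.
\<close>

section \<open>Algebras over a field\<close>

locale k_algebra = vector_space scale
  for scale :: "'k::field \<Rightarrow> 'a::ring_1 \<Rightarrow> 'a" +
  assumes scale_mult_left: "scale c x * y = scale c (x * y)"
    and scale_mult_right: "x * scale c y = scale c (x * y)"

definition subalgebra :: "('k::field \<Rightarrow> 'a::ring_1 \<Rightarrow> 'a) \<Rightarrow> 'a set \<Rightarrow> bool" where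
  "subalgebra s R \<longleftrightarrow> module.subspace s R \<and> 1 \<in> R \<and> (\<forall>x\<in>R. \<forall>y\<in>R. x * y \<in> R)"

definition alg_span :: "('k::field \<Rightarrow> 'a::ring_1 \<Rightarrow> 'a) \<Rightarrow> 'a set \<Rightarrow> 'a set" where
  "alg_span s Y = subalgebra s hull Y"

abbreviation as_ring :: "'a::ring_1 set \<Rightarrow> 'a ring" where
  "as_ring R \<equiv> ring_of_type_algebra\<lparr>carrier := R\<rparr>"

definition klinear_on :: "('k::field \<Rightarrow> 'a::ring_1 \<Rightarrow> 'a) \<Rightarrow> 'a set \<Rightarrow> ('a \<Rightarrow> 'a) \<Rightarrow> bool" where
  "klinear_on s R f \<longleftrightarrow>
     (\<forall>x\<in>R. \<forall>y\<in>R. f (x + y) = f x + f y) \<and> (\<forall>c. \<forall>x\<in>R. f (s c x) = s c (f x))"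

definition alg_iso :: "('k::field \<Rightarrow> 'a::ring_1 \<Rightarrow> 'a) \<Rightarrow> 'a set \<Rightarrow> 'a set \<Rightarrow> ('a \<Rightarrow> 'a) \<Rightarrow> bool" where
  "alg_iso s R S h \<longleftrightarrow> h \<in> ring_iso (as_ring R) (as_ring S) \<and> klinear_on s R h"

text \<open>The library's \<^const>\<open>domain\<close> is commutative by definition.\<close>

definition nc_domain :: "('r, 'm) ring_scheme \<Rightarrow> bool" where
  "nc_domain R \<longleftrightarrow> ring R \<and> \<one>\<^bsub>R\<^esub> \<noteq> \<zero>\<^bsub>R\<^esub> \<and>
     (\<forall>a\<in>carrier R. \<forall>b\<in>carrier R. a \<otimes>\<^bsub>R\<^esub> b = \<zero>\<^bsub>R\<^esub> \<longrightarrow> a = \<zero>\<^bsub>R\<^esub> \<or> b = \<zero>\<^bsub>R\<^esub>)"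

definition CSpec :: "'a::ring_1 set \<Rightarrow> 'a set set" where
  "CSpec R = {P. ideal P (as_ring R) \<and> nc_domain (as_ring R Quot P)}"

text \<open>
  \<open>\<iota>\<close> exhibits the division ring \<open>'g\<close> as \<open>Frac R\<close>.  Every element is required to be a right
  fraction, which determines \<open>Frac R\<close> up to unique isomorphism over \<open>R\<close>.
\<close>

definition division_ring_of_fractions ::
    "('r, 'm) ring_scheme \<Rightarrow> ('r \<Rightarrow> 'g::division_ring) \<Rightarrow> bool" where
  "division_ring_of_fractions R \<iota> \<longleftrightarrow>
     \<iota> \<in> ring_hom R ring_of_type_algebra \<and> inj_on \<iota> (carrier R) \<and>
     (\<forall>x. \<exists>a\<in>carrier R. \<exists>b\<in>carrier R. b \<noteq> \<zero>\<^bsub>R\<^esub> \<and> x = \<iota> a * inverse (\<iota> b))"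

section \<open>Ore extensions and higher skew derivations\<close>

text \<open>\<open>S = R[x; \<sigma>, \<delta>]\<close>: the last two clauses say that \<open>S\<close> is a free left \<open>R\<close>-module on the powers
  of \<open>x\<close>.\<close>

definition ore_extension ::
    "('k::field \<Rightarrow> 'a::ring_1 \<Rightarrow> 'a) \<Rightarrow> 'a set \<Rightarrow> 'a \<Rightarrow> ('a \<Rightarrow> 'a) \<Rightarrow> ('a \<Rightarrow> 'a) \<Rightarrow> 'a set \<Rightarrow> bool" where
  "ore_extension s R x \<sigma> \<delta> S \<longleftrightarrow>
     subalgebra s R \<and> subalgebra s S \<and>
     alg_iso s R R \<sigma> \<and>
     \<delta> ` R \<subseteq> R \<and> klinear_on s R \<delta> \<and>
     (\<forall>a\<in>R. \<forall>b\<in>R. \<delta> (a * b) = \<sigma> a * \<delta> b + \<delta> a * b) \<and>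
     (\<forall>r\<in>R. x * r = \<sigma> r * x + \<delta> r) \<and>
     S = {\<Sum>i\<le>n. r i * x ^ i | (n::nat) r. \<forall>i\<le>n. r i \<in> R} \<and>
     (\<forall>(n::nat) r. (\<forall>i\<le>n. r i \<in> R) \<and> (\<Sum>i\<le>n. r i * x ^ i) = 0 \<longrightarrow> (\<forall>i\<le>n. r i = 0))"

text \<open>Gaussian binomial coefficients, via the q-Pascal rule because the quotient of q-factorials is
  not available when \<open>p\<close> is a root of unity.\<close>

fun qbinom :: "'k::comm_ring_1 \<Rightarrow> nat \<Rightarrow> nat \<Rightarrow> 'k" where
  "qbinom p n 0 = 1"
| "qbinom p 0 (Suc k) = 0"
| "qbinom p (Suc n) (Suc k) = qbinom p n k + p ^ Suc k * qbinom p n (Suc k)"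

definition higher_skew_derivation ::
    "('k::field \<Rightarrow> 'a::ring_1 \<Rightarrow> 'a) \<Rightarrow> 'a set \<Rightarrow> 'k \<Rightarrow> ('a \<Rightarrow> 'a) \<Rightarrow> ('a \<Rightarrow> 'a) \<Rightarrow>
     (nat \<Rightarrow> 'a \<Rightarrow> 'a) \<Rightarrow> bool" where
  "higher_skew_derivation s R p \<sigma> \<delta> d \<longleftrightarrow>
     (\<forall>n. d n ` R \<subseteq> R \<and> klinear_on s R (d n)) \<and>
     (\<forall>r\<in>R. d 0 r = r) \<and> (\<forall>r\<in>R. d 1 r = \<delta> r) \<and>
     (\<forall>n. \<forall>r\<in>R. \<forall>t\<in>R. d n (r * t) = (\<Sum>i\<le>n. (\<sigma> ^^ (n - i)) (d i r) * d (n - i) t)) \<and>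
     (\<forall>n. \<forall>r\<in>R. d n (\<sigma> r) = s (p ^ n) (\<sigma> (d n r)))"

definition locally_nilpotent :: "'a set \<Rightarrow> (nat \<Rightarrow> 'a \<Rightarrow> 'a::zero) \<Rightarrow> bool" where
  "locally_nilpotent R d \<longleftrightarrow> (\<forall>r\<in>R. \<exists>n\<^sub>r. \<forall>n\<ge>n\<^sub>r. d n r = 0)"

definition iterative ::
    "('k::field \<Rightarrow> 'a::ring_1 \<Rightarrow> 'a) \<Rightarrow> 'a set \<Rightarrow> 'k \<Rightarrow> (nat \<Rightarrow> 'a \<Rightarrow> 'a) \<Rightarrow> bool" where
  "iterative s R p d \<longleftrightarrow>
     (\<forall>n m. \<forall>r\<in>R. d n (d m r) = s (qbinom p (n + m) m) (d (n + m) r))"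

section \<open>Quantum nilpotent algebras\<close>

text \<open>The maps \<open>\<sigma>\<^sub>i\<close>, \<open>\<delta>\<^sub>i\<close>, \<open>d\<^sub>i\<^sub>,\<^sub>n\<close> are only meaningful on \<open>A\<^sub>i\<^sub>-\<^sub>1\<close>.\<close>

record ('k, 'a) qna_data =
  scl :: "'k \<Rightarrow> 'a \<Rightarrow> 'a"
  ngen :: nat
  gen :: "nat \<Rightarrow> 'a"
  aut :: "nat \<Rightarrow> 'a \<Rightarrow> 'a"
  der :: "nat \<Rightarrow> 'a \<Rightarrow> 'a"
  hder :: "nat \<Rightarrow> nat \<Rightarrow> 'a \<Rightarrow> 'a"
  lam :: "nat \<Rightarrow> nat \<Rightarrow> 'k"
  qpar :: "nat \<Rightarrow> 'k"

definition qna_sub :: "('k::field, 'a::ring_1) qna_data \<Rightarrow> nat \<Rightarrow> 'a set" where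
  "qna_sub D i = alg_span (scl D) (gen D ` {1..i})"

definition quantum_nilpotent_algebra :: "('k::field, 'a::ring_1) qna_data \<Rightarrow> bool" where
  "quantum_nilpotent_algebra D \<longleftrightarrow>
     k_algebra (scl D) \<and> 1 \<le> ngen D \<and>
     ore_extension (scl D) (qna_sub D 0) (gen D 1) (\<lambda>r. r) (\<lambda>_. 0) (qna_sub D 1) \<and>
     (\<forall>i\<in>{2..ngen D}.
        ore_extension (scl D) (qna_sub D (i - 1)) (gen D i) (aut D i) (der D i) (qna_sub D i)) \<and>
     (\<forall>i\<in>{2..ngen D}. \<forall>l\<in>{1..<i}. aut D i (gen D l) = scl D (lam D i l) (gen D l)) \<and>
     (\<forall>i\<in>{1..ngen D}. \<forall>l\<in>{1..ngen D}. lam D i l \<noteq> 0 \<and> lam D i l = inverse (lam D l i)) \<and>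
     (\<forall>i\<in>{1..ngen D}. lam D i i = 1) \<and>
     (\<forall>i\<in>{2..ngen D}. qpar D i \<noteq> 0 \<and> qpar D i \<noteq> 1 \<and>
        (\<forall>r\<in>qna_sub D (i - 1). der D i (aut D i r) = scl D (qpar D i) (aut D i (der D i r)))) \<and>
     (\<forall>i\<in>{2..ngen D}.
        higher_skew_derivation (scl D) (qna_sub D (i - 1)) (qpar D i) (aut D i) (der D i) (hder D i) \<and>
        locally_nilpotent (qna_sub D (i - 1)) (hder D i) \<and>
        iterative (scl D) (qna_sub D (i - 1)) (qpar D i) (hder D i) \<and>
        (\<forall>n. \<forall>l\<in>{i + 1..ngen D}. \<forall>r\<in>qna_sub D (i - 1).
           aut D l (hder D i n r) = scl D (lam D l i ^ n) (hder D i n (aut D l r))))"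

definition qna_alg :: "('k::field, 'a::ring_1) qna_data \<Rightarrow> 'a set" where
  "qna_alg D = qna_sub D (ngen D)"

section \<open>The deleting derivations algorithm\<close>

text \<open>
  In one step, \<open>x\<close> is the family \<open>X\<^sup>(\<^sup>j\<^sup>+\<^sup>1\<^sup>)\<close>.  The isomorphism from \<open>A\<^sub>j\<^sub>-\<^sub>1\<close> onto the subalgebra
  generated by \<open>x\<^sub>1, \<dots>, x\<^sub>j\<^sub>-\<^sub>1\<close> sending \<open>X\<^sub>i\<close> to \<open>x\<^sub>i\<close> is unique where it is used;
  \<open>\<sigma>\<^sub>j\<close> and \<open>d\<^sub>j\<^sub>,\<^sub>n\<close> are transported along it.
\<close>

definition dd_iso ::
    "('k::field, 'a::division_ring) qna_data \<Rightarrow> nat \<Rightarrow> (nat \<Rightarrow> 'a) \<Rightarrow> 'a \<Rightarrow> 'a" where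
  "dd_iso D j x =
     (SOME h. alg_iso (scl D) (qna_sub D (j - 1)) (alg_span (scl D) (x ` {1..<j})) h \<and>
              (\<forall>i\<in>{1..<j}. h (gen D i) = x i))"

definition dd_transport ::
    "('k::field, 'a::division_ring) qna_data \<Rightarrow> nat \<Rightarrow> (nat \<Rightarrow> 'a) \<Rightarrow> ('a \<Rightarrow> 'a) \<Rightarrow> 'a \<Rightarrow> 'a" where
  "dd_transport D j x f =
     (\<lambda>z. dd_iso D j x (f (inv_into (qna_sub D (j - 1)) (dd_iso D j x) z)))"

definition dd_step ::
    "('k::field, 'a::division_ring) qna_data \<Rightarrow> nat \<Rightarrow> (nat \<Rightarrow> 'a) \<Rightarrow> nat \<Rightarrow> 'a" where
  "dd_step D j x l =
     (if l < j then
        Sum_any (\<lambda>n::nat.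
          scl D (qpar D j ^ (n * (n + 1) div 2) * inverse (qpar D j - 1) ^ n)
            (dd_transport D j x
               (\<lambda>r. hder D j n ((inv_into (qna_sub D (j - 1)) (aut D j) ^^ n) r)) (x l) *
             inverse (x j) ^ n))
      else x l)"

text \<open>\<open>dd_gen D j i\<close> is \<open>X\<^sub>i\<^sup>(\<^sup>j\<^sup>)\<close>, for \<open>2 \<le> j \<le> N + 1\<close>.  Here and below, the recursion runs downwards
  in \<open>j\<close>.\<close>

function dd_gen :: "('k::field, 'a::division_ring) qna_data \<Rightarrow> nat \<Rightarrow> nat \<Rightarrow> 'a" where
  "dd_gen D j = (if ngen D < j then gen D else dd_step D j (dd_gen D (Suc j)))"
  by pat_completeness auto
termination
  by (relation "measure (\<lambda>(D, j). Suc (ngen D) - j)") auto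

declare dd_gen.simps [simp del]

definition dd_alg :: "('k::field, 'a::division_ring) qna_data \<Rightarrow> nat \<Rightarrow> 'a set" where
  "dd_alg D j = alg_span (scl D) (dd_gen D j ` {1..ngen D})"

section \<open>The canonical embedding\<close>

definition dd_ideal :: "('k::field, 'a::division_ring) qna_data \<Rightarrow> nat \<Rightarrow> 'a set" where
  "dd_ideal D j = Idl\<^bsub>as_ring (dd_alg D (Suc j))\<^esub> {dd_gen D (Suc j) j}"

text \<open>
  \<open>g\<^sub>j\<close> is the \<open>K\<close>-algebra homomorphism with \<open>y\<^sub>i \<mapsto> x\<^sub>i + \<langle>x\<^sub>j\<rangle>\<close>.  For a unital ring homomorphism,
  \<open>K\<close>-linearity amounts to the prescribed values on the scalars \<open>c \<cdot> 1\<close>.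
\<close>

definition dd_g :: "('k::field, 'a::division_ring) qna_data \<Rightarrow> nat \<Rightarrow> 'a \<Rightarrow> 'a set" where
  "dd_g D j =
     (SOME g. g \<in> ring_hom (as_ring (dd_alg D j)) (as_ring (dd_alg D (Suc j)) Quot dd_ideal D j) \<and>
        (\<forall>c. g (scl D c 1) = dd_ideal D j +>\<^bsub>as_ring (dd_alg D (Suc j))\<^esub> scl D c 1) \<and>
        (\<forall>i\<in>{1..ngen D}. g (dd_gen D j i) =
           dd_ideal D j +>\<^bsub>as_ring (dd_alg D (Suc j))\<^esub> dd_gen D (Suc j) i))"

definition dd_psi :: "('k::field, 'a::division_ring) qna_data \<Rightarrow> nat \<Rightarrow> 'a set \<Rightarrow> 'a set" where
  "dd_psi D j P =
     (if dd_gen D (Suc j) j \<notin> P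
      then {p * inverse (dd_gen D (Suc j) j) ^ n | p (n::nat). p \<in> P} \<inter> dd_alg D j
      else {a \<in> dd_alg D j.
              dd_g D j a \<in> (\<lambda>p. dd_ideal D j +>\<^bsub>as_ring (dd_alg D (Suc j))\<^esub> p) ` P})"

text \<open>\<open>dd_prime D P j\<close> is \<open>P\<^sub>j = \<psi>\<^sub>j (\<dots> \<psi>\<^sub>N (P))\<close>, so that \<open>dd_prime D P 2\<close> is \<open>\<psi>(P)\<close>.\<close>

function dd_prime :: "('k::field, 'a::division_ring) qna_data \<Rightarrow> 'a set \<Rightarrow> nat \<Rightarrow> 'a set" where
  "dd_prime D P j = (if ngen D < j then P else dd_psi D j (dd_prime D P (Suc j)))"
  by pat_completeness auto
termination
  by (relation "measure (\<lambda>(D, P, j). Suc (ngen D) - j)") auto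

declare dd_prime.simps [simp del]

definition CSpec'_part :: "('k::field, 'a::division_ring) qna_data \<Rightarrow> nat set \<Rightarrow> 'a set set" where
  "CSpec'_part D w =
     {Q \<in> CSpec (dd_alg D 2). Q \<inter> dd_gen D 2 ` {1..ngen D} = dd_gen D 2 ` w}"

definition CSpec_part :: "('k::field, 'a::division_ring) qna_data \<Rightarrow> nat set \<Rightarrow> 'a set set" where
  "CSpec_part D w = {P \<in> CSpec (qna_alg D). dd_prime D P 2 \<in> CSpec'_part D w}"

definition Wset :: "('k::field, 'a::division_ring) qna_data \<Rightarrow> nat set set" where
  "Wset D = {w. w \<subseteq> {1..ngen D} \<and> CSpec_part D w \<noteq> {}}"

section \<open>The quotients as subalgebras of the division ring of fractions of \<open>B\<close>\<close>

definition dd_quot ::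
    "('k::field, 'a::division_ring) qna_data \<Rightarrow> 'a set \<Rightarrow> nat \<Rightarrow> 'a set ring" where
  "dd_quot D P j = as_ring (dd_alg D j) Quot dd_prime D P j"

definition dd_class ::
    "('k::field, 'a::division_ring) qna_data \<Rightarrow> 'a set \<Rightarrow> nat \<Rightarrow> 'a \<Rightarrow> 'a set" where
  "dd_class D P j a = dd_prime D P j +>\<^bsub>as_ring (dd_alg D j)\<^esub> a"

text \<open>
  \<open>dd_emb D P \<iota> j\<close> is the embedding \<open>B\<^sup>(\<^sup>j\<^sup>) \<rightarrow> Frac B\<close>, where \<open>\<iota>\<close> is the given embedding of
  \<open>B = B\<^sup>(\<^sup>N\<^sup>+\<^sup>1\<^sup>)\<close>.  If \<open>x\<^sub>j \<in> P\<^sub>j\<^sub>+\<^sub>1\<close>, the class of \<open>a \<in> A\<^sup>(\<^sup>j\<^sup>)\<close> is identified with the class of any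
  representative \<open>b \<in> A\<^sup>(\<^sup>j\<^sup>+\<^sup>1\<^sup>)\<close> of \<open>g\<^sub>j(a)\<close>; otherwise, writing \<open>a = b x\<^sub>j\<^sup>-\<^sup>n\<close> with \<open>b \<in> A\<^sup>(\<^sup>j\<^sup>+\<^sup>1\<^sup>)\<close>, with the
  corresponding fraction of classes.
\<close>

function dd_emb ::
    "('k::field, 'a::division_ring) qna_data \<Rightarrow> 'a set \<Rightarrow> ('a set \<Rightarrow> 'b::division_ring) \<Rightarrow>
     nat \<Rightarrow> 'a set \<Rightarrow> 'b" where
  "dd_emb D P \<iota> j =
     (if ngen D < j then \<iota>
      else if dd_gen D (Suc j) j \<in> dd_prime D P (Suc j) then
        (\<lambda>C. THE v. \<exists>a\<in>C. \<exists>b\<in>dd_g D j a. v = dd_emb D P \<iota> (Suc j) (dd_class D P (Suc j) b))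
      else
        (\<lambda>C. THE v. \<exists>a\<in>C. \<exists>b\<in>dd_alg D (Suc j). \<exists>n::nat.
           a = b * inverse (dd_gen D (Suc j) j) ^ n \<and>
           v = dd_emb D P \<iota> (Suc j) (dd_class D P (Suc j) b) *
               inverse (dd_emb D P \<iota> (Suc j) (dd_class D P (Suc j) (dd_gen D (Suc j) j))) ^ n))"
  by pat_completeness auto
termination
  by (relation "measure (\<lambda>(D, P, \<iota>, j). Suc (ngen D) - j)") auto

declare dd_emb.simps [simp del]

definition dd_B ::
    "('k::field, 'a::division_ring) qna_data \<Rightarrow> 'a set \<Rightarrow> ('a set \<Rightarrow> 'b::division_ring) \<Rightarrow>
     nat \<Rightarrow> 'b set" where
  "dd_B D P \<iota> j = dd_emb D P \<iota> j ` carrier (dd_quot D P j)"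

definition dd_t ::
    "('k::field, 'a::division_ring) qna_data \<Rightarrow> 'a set \<Rightarrow> ('a set \<Rightarrow> 'b::division_ring) \<Rightarrow>
     nat \<Rightarrow> 'b" where
  "dd_t D P \<iota> i = dd_emb D P \<iota> 2 (dd_class D P 2 (dd_gen D 2 i))"

definition mult_closure :: "'b::monoid_mult set \<Rightarrow> 'b set" where
  "mult_closure Y = (\<lambda>S. 1 \<in> S \<and> (\<forall>x\<in>S. \<forall>y\<in>S. x * y \<in> S)) hull Y"

definition ore_Sigma ::
    "('k::field, 'a::division_ring) qna_data \<Rightarrow> nat set \<Rightarrow> 'a set \<Rightarrow>
     ('a set \<Rightarrow> 'b::division_ring) \<Rightarrow> 'b set" where
  "ore_Sigma D w P \<iota> = mult_closure (dd_t D P \<iota> ` ({1..ngen D} - w))"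

text \<open>\<open>ore_chain D w P \<iota> k\<close> is \<open>\<Sigma>\<^sub>k\<^sub>+\<^sub>2\<close>.\<close>

primrec ore_chain ::
    "('k::field, 'a::division_ring) qna_data \<Rightarrow> nat set \<Rightarrow> 'a set \<Rightarrow>
     ('a set \<Rightarrow> 'b::division_ring) \<Rightarrow> nat \<Rightarrow> 'b set" where
  "ore_chain D w P \<iota> 0 = ore_Sigma D w P \<iota>"
| "ore_chain D w P \<iota> (Suc k) = dd_B D P \<iota> (k + 3) \<inter> ore_chain D w P \<iota> k"

definition ore_Gamma ::
    "('k::field, 'a::division_ring) qna_data \<Rightarrow> nat set \<Rightarrow> 'a set \<Rightarrow>
     ('a set \<Rightarrow> 'b::division_ring) \<Rightarrow> 'b set" where
  "ore_Gamma D w P \<iota> = ore_chain D w P \<iota> (ngen D - 1)"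

section \<open>Representations\<close>

definition representation ::
    "('k::field \<Rightarrow> 'b::ring_1 \<Rightarrow> 'b) \<Rightarrow> ('k \<Rightarrow> 'v::ab_group_add \<Rightarrow> 'v) \<Rightarrow> 'b set \<Rightarrow>
     ('b \<Rightarrow> 'v \<Rightarrow> 'v) \<Rightarrow> bool" where
  "representation s sV R \<phi> \<longleftrightarrow>
     vector_space sV \<and>
     (\<forall>a\<in>R. Vector_Spaces.linear sV sV (\<phi> a)) \<and>
     \<phi> 1 = id \<and>
     (\<forall>a\<in>R. \<forall>b\<in>R. \<phi> (a * b) = \<phi> a \<circ> \<phi> b) \<and>
     (\<forall>a\<in>R. \<forall>b\<in>R. \<phi> (a + b) = (\<lambda>v. \<phi> a v + \<phi> b v)) \<and>
     (\<forall>c. \<forall>a\<in>R. \<phi> (s c a) = (\<lambda>v. sV c (\<phi> a v)))"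

definition irreducible_representation ::
    "('k::field \<Rightarrow> 'b::ring_1 \<Rightarrow> 'b) \<Rightarrow> ('k \<Rightarrow> 'v::ab_group_add \<Rightarrow> 'v) \<Rightarrow> 'b set \<Rightarrow>
     ('b \<Rightarrow> 'v \<Rightarrow> 'v) \<Rightarrow> bool" where
  "irreducible_representation s sV R \<phi> \<longleftrightarrow>
     representation s sV R \<phi> \<and> (\<exists>v::'v. v \<noteq> 0) \<and>
     (\<forall>W. module.subspace sV W \<and> (\<forall>a\<in>R. \<phi> a ` W \<subseteq> W) \<longrightarrow> W = {0} \<or> W = UNIV)"

end

theory Submission
  imports Defs
begin

text \<open>
  For one step of the algorithm, \<open>\<Theta>(a) = \<Sum>\<^sub>n q\<^sup>n\<^sup>(\<^sup>n\<^sup>+\<^sup>1\<^sup>)\<^sup>/\<^sup>2 (q - 1)\<^sup>-\<^sup>n d\<^sub>n(\<sigma>\<^sup>-\<^sup>n(a)) x\<^sup>-\<^sup>n\<close> is an injective algebra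
  homomorphism with \<open>x \<Theta>(a) = \<Theta>(\<sigma>(a)) x\<close>; the coefficients satisfy \<open>c\<^sub>n (q - 1) = c\<^sub>n\<^sub>-\<^sub>1 q\<^sup>n\<close>, with
  no division by \<open>q\<^sup>n - 1\<close>, so roots of unity need no separate treatment.  Its leading term gives freeness over the powers of \<open>x\<close>,
  hence the iterated Ore structure at the next stage and the existence of \<open>g\<^sub>j\<close>.
  In \<open>Frac(B)\<close> the image of \<open>x\<^sub>j\<close> is \<open>t\<^sub>j\<close> at every stage.  So \<open>B\<^sup>(\<^sup>j\<^sup>) = B\<^sup>(\<^sup>j\<^sup>+\<^sup>1\<^sup>)\<close> if \<open>t\<^sub>j = 0\<close>, and otherwise
  these two algebras agree after inverting \<open>t\<^sub>j \<in> \<Sigma>\<close>.  Therefore \<open>B \<subseteq> B'\<Sigma>\<^sup>-\<^sup>1\<close>, and since the \<open>t\<^sub>i\<close> skew-commute,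
  \<open>\<phi>'\<close> extends to \<open>B'\<Sigma>\<^sup>-\<^sup>1\<close>.  As \<open>\<phi>'(t\<^sub>j)\<close> is a root of a scalar, a \<open>B\<close>-invariant subspace is invariant under
  \<open>t\<^sub>j\<^sup>-\<^sup>1\<close>, and so under every \<open>B\<^sup>(\<^sup>j\<^sup>)\<close> down to \<open>B'\<close>.  The roots for \<open>\<Gamma>\<close> come from \<open>\<Gamma> \<subseteq> \<Sigma>\<close>.
\<close>

section \<open>Subalgebras and homomorphisms\<close>

text \<open>The maps \<open>dd_iso\<close>, \<open>dd_g\<close> and \<open>dd_emb\<close> are
  introduced by choice, so nothing is known about them until a witness is constructed and its values
  are shown to be forced. This is why the structure of every stage is proved here: an induction
  carries an injective homomorphism from the original subalgebra, the skew relations of the later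
  generators, and freeness over their powers. The coefficients of \<Theta> come from asking for
  \<open>x * \<Theta> a = \<Theta> (\<sigma> a) * x\<close>: comparing the terms in d_(n+1) asks for
  c_n [n+1]_p = c_(n+1) (1 - p^-(n+1)), where [n+1]_p is the q-integer. Multiplicativity is then a
  consequence, since x^-n can be moved across \<Theta>(b) as a whole. A second obstacle is an
  asymmetry: x_j skew-commutes with the generators of the new algebra but not in general with those
  of the old one, where a derivation intervenes. The two inclusions between the localisations
  therefore need different arguments, and normality of x_j is used only in the new algebra.\<close>

definition algebra_hom ::
    "('k::field \<Rightarrow> 'a::ring_1 \<Rightarrow> 'a) \<Rightarrow> ('k \<Rightarrow> 'b::ring_1 \<Rightarrow> 'b) \<Rightarrow> 'a set \<Rightarrow> ('a \<Rightarrow> 'b) \<Rightarrow> bool" where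
  "algebra_hom s s' R f \<longleftrightarrow>
     (\<forall>x\<in>R. \<forall>y\<in>R. f (x + y) = f x + f y) \<and> (\<forall>x\<in>R. \<forall>y\<in>R. f (x * y) = f x * f y) \<and>
     (\<forall>c. \<forall>x\<in>R. f (s c x) = s' c (f x)) \<and> f 1 = 1"

lemma algebra_homD:
  assumes "algebra_hom s s' R f"
  shows "x \<in> R \<Longrightarrow> y \<in> R \<Longrightarrow> f (x + y) = f x + f y"
    and "x \<in> R \<Longrightarrow> y \<in> R \<Longrightarrow> f (x * y) = f x * f y"
    and "x \<in> R \<Longrightarrow> f (s c x) = s' c (f x)"
    and "f 1 = 1"
  using assms by (auto simp: algebra_hom_def)

context k_algebra
begin

lemma subalgebraI:
  assumes "1 \<in> R" and "\<And>x y. x \<in> R \<Longrightarrow> y \<in> R \<Longrightarrow> x + y \<in> R"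
    and "\<And>c x. x \<in> R \<Longrightarrow> scale c x \<in> R" and "\<And>x y. x \<in> R \<Longrightarrow> y \<in> R \<Longrightarrow> x * y \<in> R"
  shows "subalgebra scale R"
proof -
  have "scale 0 1 \<in> R" using assms by blast
  then have "0 \<in> R" by simp
  then show ?thesis using assms by (auto simp: subalgebra_def subspace_def)
qed

lemma subalgebraD:
  assumes "subalgebra scale R"
  shows "subspace R" "1 \<in> R" "0 \<in> R"
    and "x \<in> R \<Longrightarrow> y \<in> R \<Longrightarrow> x + y \<in> R"
    and "x \<in> R \<Longrightarrow> y \<in> R \<Longrightarrow> x - y \<in> R"
    and "x \<in> R \<Longrightarrow> - x \<in> R"
    and "x \<in> R \<Longrightarrow> scale c x \<in> R"
    and "x \<in> R \<Longrightarrow> y \<in> R \<Longrightarrow> x * y \<in> R"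
  using assms by (auto simp: subalgebra_def subspace_0 subspace_add subspace_diff subspace_neg
      subspace_scale)

lemma subalgebra_power: "subalgebra scale R \<Longrightarrow> x \<in> R \<Longrightarrow> x ^ n \<in> R"
  by (induction n) (auto simp: subalgebraD)

lemma subalgebra_sum: "subalgebra scale R \<Longrightarrow> (\<And>i. i \<in> I \<Longrightarrow> f i \<in> R) \<Longrightarrow> sum f I \<in> R"
  by (auto intro: subspace_sum simp: subalgebraD)

lemma subalgebra_alg_span: "subalgebra scale (alg_span scale Y)"
  unfolding alg_span_def by (rule hull_in) (auto simp: subalgebra_def subspace_def)

lemma alg_span_base: "y \<in> Y \<Longrightarrow> y \<in> alg_span scale Y"
  by (simp add: alg_span_def hull_inc)

lemma alg_span_least: "Y \<subseteq> R \<Longrightarrow> subalgebra scale R \<Longrightarrow> alg_span scale Y \<subseteq> R"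
  unfolding alg_span_def by (rule hull_minimal)

lemma alg_span_mono: "Y \<subseteq> Z \<Longrightarrow> alg_span scale Y \<subseteq> alg_span scale Z"
  unfolding alg_span_def by (rule hull_mono)

lemma alg_span_induct [consumes 1, case_names gen one add scale mult]:
  assumes "a \<in> alg_span scale Y" and "\<And>y. y \<in> Y \<Longrightarrow> Q y" and "Q 1"
    and "\<And>a b. a \<in> alg_span scale Y \<Longrightarrow> b \<in> alg_span scale Y \<Longrightarrow> Q a \<Longrightarrow> Q b \<Longrightarrow> Q (a + b)"
    and "\<And>c a. a \<in> alg_span scale Y \<Longrightarrow> Q a \<Longrightarrow> Q (scale c a)"
    and "\<And>a b. a \<in> alg_span scale Y \<Longrightarrow> b \<in> alg_span scale Y \<Longrightarrow> Q a \<Longrightarrow> Q b \<Longrightarrow> Q (a * b)"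
  shows "Q a"
proof -
  note U = subalgebraD[OF subalgebra_alg_span[of Y]]
  have "subalgebra scale {a \<in> alg_span scale Y. Q a}"
    using assms U by (intro subalgebraI) auto
  then have "alg_span scale Y \<subseteq> {a \<in> alg_span scale Y. Q a}"
    using assms alg_span_base by (intro alg_span_least) auto
  then show ?thesis using assms by auto
qed

text \<open>Right multiplication by \<open>a\<close> preserves \<open>Z\<close> for every
  \<open>a\<close> in the span, by induction on \<open>a\<close>; applied to 1 this gives
  \<open>a\<close>. The point is that \<open>Z\<close> is not assumed closed under products, as for
  sets of fractions whose denominator is not normal.\<close>

lemma alg_span_right_closed:
  assumes "subspace Z" and "1 \<in> Z" and "\<And>z y. z \<in> Z \<Longrightarrow> y \<in> Y \<Longrightarrow> z * y \<in> Z"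
  shows "alg_span scale Y \<subseteq> Z"
proof
  fix a assume "a \<in> alg_span scale Y"
  then have "\<forall>z\<in>Z. z * a \<in> Z"
  proof (induction rule: alg_span_induct)
    case (mult a b) then show ?case by (simp flip: mult.assoc)
  qed (use assms in \<open>auto simp: distrib_left subspace_add scale_mult_right subspace_scale\<close>)
  then show "a \<in> Z" using \<open>1 \<in> Z\<close> by force
qed

lemma algebra_hom_zero:
  assumes "algebra_hom scale s' R f" and "subalgebra scale R"
  shows "f 0 = 0"
  using algebra_homD(1)[OF assms(1), of 0 0] subalgebraD(3)[OF assms(2)] by simp

lemma algebra_hom_uminus:
  assumes "algebra_hom scale s' R f" and "subalgebra scale R" and "x \<in> R"
  shows "f (- x) = - f x"
  using algebra_homD(1)[OF assms(1,3), of "- x"] subalgebraD(6)[OF assms(2,3)]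
    algebra_hom_zero[OF assms(1,2)]
  by (simp add: minus_unique)

lemma algebra_hom_diff:
  assumes "algebra_hom scale s' R f" and "subalgebra scale R" and "x \<in> R" and "y \<in> R"
  shows "f (x - y) = f x - f y"
  using algebra_homD(1)[OF assms(1,3), of "- y"] subalgebraD(6)[OF assms(2,4)]
    algebra_hom_uminus[OF assms(1,2,4)]
  by simp

lemma algebra_hom_sum:
  assumes "algebra_hom scale s' R f" and "subalgebra scale R" and "\<And>i. i \<in> I \<Longrightarrow> g i \<in> R"
  shows "f (sum g I) = (\<Sum>i\<in>I. f (g i))"
  using assms(3)
  by (induction I rule: infinite_finite_induct)
    (use assms in \<open>auto simp: algebra_hom_zero algebra_homD(1) subalgebra_sum\<close>)

lemma algebra_hom_power:
  "algebra_hom scale s' R f \<Longrightarrow> subalgebra scale R \<Longrightarrow> x \<in> R \<Longrightarrow> f (x ^ n) = f x ^ n"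
  by (induction n) (auto simp: algebra_homD subalgebra_power)

lemma algebra_hom_inj:
  assumes "algebra_hom scale s' R f" and "subalgebra scale R"
    and "\<And>x. x \<in> R \<Longrightarrow> f x = 0 \<Longrightarrow> x = 0"
  shows "inj_on f R"
proof (rule inj_onI)
  fix x y assume "x \<in> R" "y \<in> R" "f x = f y"
  then show "x = y"
    using assms(3)[of "x - y"] algebra_hom_diff[OF assms(1,2)] subalgebraD(5)[OF assms(2)] by simp
qed

lemma algebra_hom_subset: "algebra_hom scale s' R f \<Longrightarrow> R' \<subseteq> R \<Longrightarrow> algebra_hom scale s' R' f"
  unfolding algebra_hom_def by blast

lemma algebra_hom_eq_on_span:
  assumes "algebra_hom scale s' (alg_span scale Y) f" "algebra_hom scale s' (alg_span scale Y) g"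
    and "\<And>y. y \<in> Y \<Longrightarrow> f y = g y" and "a \<in> alg_span scale Y"
  shows "f a = g a"
  using assms(4)
  by (induction rule: alg_span_induct) (use assms in \<open>auto simp: algebra_homD\<close>)

lemma subalgebra_image:
  assumes f: "algebra_hom scale s' R f" and R: "subalgebra scale R" and s': "k_algebra s'"
  shows "subalgebra s' (f ` R)"
proof (rule k_algebra.subalgebraI[OF s'])
  show "1 \<in> f ` R" using algebra_homD(4)[OF f] subalgebraD(2)[OF R] by force
  show "x + y \<in> f ` R" if "x \<in> f ` R" "y \<in> f ` R" for x y
    using that algebra_homD(1)[OF f, symmetric] subalgebraD(4)[OF R] by force
  show "x * y \<in> f ` R" if "x \<in> f ` R" "y \<in> f ` R" for x y
    using that algebra_homD(2)[OF f, symmetric] subalgebraD(8)[OF R] by force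
  show "s' c x \<in> f ` R" if "x \<in> f ` R" for c x
    using that algebra_homD(3)[OF f, symmetric] subalgebraD(7)[OF R] by force
qed

lemma algebra_hom_image_span:
  assumes f: "algebra_hom scale s' (alg_span scale Y) f" and s': "k_algebra s'"
  shows "f ` alg_span scale Y = alg_span s' (f ` Y)"
proof
  interpret B: k_algebra s' by fact
  have "f a \<in> alg_span s' (f ` Y)" if "a \<in> alg_span scale Y" for a
    using that
    by (induction rule: alg_span_induct)
      (auto simp: algebra_homD[OF f] B.alg_span_base B.subalgebraD B.subalgebra_alg_span)
  then show "f ` alg_span scale Y \<subseteq> alg_span s' (f ` Y)" by blast
  show "alg_span s' (f ` Y) \<subseteq> f ` alg_span scale Y"
    by (rule B.alg_span_least) (use alg_span_base subalgebra_image[OF f subalgebra_alg_span s'] in auto)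
qed

end

lemma ring_as_ring:
  assumes "subalgebra s R" "k_algebra s"
  shows "ring (as_ring R)"
proof -
  interpret k_algebra s by fact
  note R = subalgebraD[OF assms(1)]
  show ?thesis
  proof (rule ringI)
    show "abelian_group (as_ring R)"
    proof (rule abelian_groupI)
      show "\<exists>y\<in>carrier (as_ring R). y \<oplus>\<^bsub>as_ring R\<^esub> x = \<zero>\<^bsub>as_ring R\<^esub>"
        if "x \<in> carrier (as_ring R)" for x
        using that R(6)[of x] by (intro bexI[of _ "- x"]) (auto simp: ring_of_type_algebra_def)
    qed (use R in \<open>auto simp: ring_of_type_algebra_def add.assoc add.commute\<close>)
    show "Group.monoid (as_ring R)"
      by (rule monoidI) (use R in \<open>auto simp: ring_of_type_algebra_def mult.assoc\<close>)
  qed (auto simp: ring_of_type_algebra_def distrib_left distrib_right)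
qed

lemma ring_of_type_algebra_simps [simp]:
  "carrier ring_of_type_algebra = UNIV"
  "x \<otimes>\<^bsub>ring_of_type_algebra\<^esub> y = x * y" "\<one>\<^bsub>ring_of_type_algebra\<^esub> = 1"
  "\<zero>\<^bsub>ring_of_type_algebra\<^esub> = 0" "x \<oplus>\<^bsub>ring_of_type_algebra\<^esub> y = x + y"
  by (auto simp: ring_of_type_algebra_def)

lemma coset_as_ring: "I +>\<^bsub>as_ring R\<^esub> a = (\<lambda>i. i + a) ` I"
  by (auto simp: a_r_coset_def r_coset_def ring_of_type_algebra_def)

lemma ideal_as_ringD:
  assumes "ideal I (as_ring R)"
  shows "I \<subseteq> R" "0 \<in> I"
    and "x \<in> I \<Longrightarrow> y \<in> I \<Longrightarrow> x + y \<in> I"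
    and "x \<in> R \<Longrightarrow> y \<in> I \<Longrightarrow> x * y \<in> I" and "x \<in> I \<Longrightarrow> y \<in> R \<Longrightarrow> x * y \<in> I"
  using additive_subgroup.a_subset[OF ideal.axioms(1)[OF assms]]
    additive_subgroup.zero_closed[OF ideal.axioms(1)[OF assms]]
    additive_subgroup.a_closed[OF ideal.axioms(1)[OF assms], of x y]
    ideal.I_l_closed[OF assms, of y x] ideal.I_r_closed[OF assms, of x y]
  by auto

lemma alg_iso_hom:
  assumes "alg_iso s R S f"
  shows "algebra_hom s s R f" "bij_betw f R S"
  using assms unfolding alg_iso_def algebra_hom_def klinear_on_def ring_iso_def ring_hom_def by auto

lemma alg_isoI:
  assumes "algebra_hom s s R f" "bij_betw f R S"
  shows "alg_iso s R S f"
  using assms bij_betwE[OF assms(2)]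
  unfolding alg_iso_def algebra_hom_def klinear_on_def ring_iso_def ring_hom_def by auto

section \<open>Powers of one element: independence and denominators\<close>

text \<open>The freeness clause of \<open>ore_extension\<close> on its own, so that it can be
  carried from stage to stage.\<close>

definition left_independent :: "'a::ring_1 set \<Rightarrow> 'a \<Rightarrow> bool" where
  "left_independent R x \<longleftrightarrow>
     (\<forall>(n::nat) r. (\<forall>i\<le>n. r i \<in> R) \<and> (\<Sum>i\<le>n. r i * x ^ i) = 0 \<longrightarrow> (\<forall>i\<le>n. r i = 0))"

lemma left_independentD:
  "left_independent R x \<Longrightarrow> (\<And>i. i \<le> n \<Longrightarrow> r i \<in> R) \<Longrightarrow> (\<Sum>i\<le>n. r i * x ^ i) = 0 \<Longrightarrow> i \<le> n \<Longrightarrow> r i = 0"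
  unfolding left_independent_def by blast

lemma left_independent_nonzero:
  assumes "left_independent R x" "1 \<in> R" "0 \<in> R"
  shows "x \<noteq> 0"
proof
  assume "x = 0"
  \<comment> \<open>The coefficients 0, 1 describe \<open>x\<close> itself; for x = 0 they would be
    a nontrivial relation.\<close>
  define r :: "nat \<Rightarrow> 'a" where "r i = (if i = 0 then 0 else 1)" for i
  have "r 1 = 0"
    by (rule left_independentD[OF assms(1), of 1]) (use assms \<open>x = 0\<close> in \<open>auto simp: r_def\<close>)
  then show False by (simp add: r_def)
qed

text \<open>U[x^-1] with denominators on the right, phrased without inverses, so that neither an Ore
  condition nor invertibility of \<open>x\<close> enters the definition.\<close>

definition fractions_by :: "'a::ring_1 \<Rightarrow> 'a set \<Rightarrow> 'a set" where
  "fractions_by x U = {z. \<exists>n::nat. z * x ^ n \<in> U}"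

context k_algebra
begin

lemma fractions_by_common:
  assumes "subalgebra scale U" "x \<in> U" "z * x ^ n \<in> U" "n \<le> m"
  shows "z * x ^ m \<in> U"
proof -
  have "z * x ^ m = (z * x ^ n) * x ^ (m - n)"
    using assms(4) by (simp add: mult.assoc flip: power_add)
  then show ?thesis using assms subalgebra_power subalgebraD(8) by metis
qed

lemma fractions_by_base: "U \<subseteq> fractions_by x U"
  unfolding fractions_by_def using power_0 mult_1_right by (metis (mono_tags) mem_Collect_eq subsetI)

lemma subspace_fractions_by:
  assumes U: "subalgebra scale U" and x: "x \<in> U"
  shows "subspace (fractions_by x U)"
proof (rule subspaceI)
  show "0 \<in> fractions_by x U" using subalgebraD(3)[OF U] by (auto simp: fractions_by_def)
next
  fix a b assume "a \<in> fractions_by x U" "b \<in> fractions_by x U"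
  then obtain n m where "a * x ^ n \<in> U" "b * x ^ m \<in> U" by (auto simp: fractions_by_def)
  then have "a * x ^ max n m \<in> U" "b * x ^ max n m \<in> U"
    using fractions_by_common[OF U x] by auto
  then show "a + b \<in> fractions_by x U"
    using subalgebraD(4)[OF U] by (auto simp: fractions_by_def distrib_right)
next
  fix c a assume "a \<in> fractions_by x U"
  then show "scale c a \<in> fractions_by x U"
    using subalgebraD(7)[OF U] by (auto simp: fractions_by_def scale_mult_left)
qed

end

lemma fractions_by_power:
  fixes x :: "'a::division_ring"
  assumes "z \<in> fractions_by x U" "x \<noteq> 0"
  shows "z * inverse x ^ n \<in> fractions_by x U"
proof -
  obtain m where "z * x ^ m \<in> U" using assms by (auto simp: fractions_by_def)
  moreover have "z * inverse x ^ n * x ^ (n + m) = z * x ^ m"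
  proof -
    have "inverse x ^ n * x ^ n = 1" using assms(2) by (simp add: power_inverse)
    then have "z * (inverse x ^ n * x ^ n) * x ^ m = z * x ^ m" by simp
    then show ?thesis by (simp only: mult.assoc power_add)
  qed
  ultimately have "z * inverse x ^ n * x ^ (n + m) \<in> U" by simp
  then show ?thesis unfolding fractions_by_def by blast
qed

section \<open>The deleting derivations homomorphism\<close>

lemma qbinom_eq_0: "n < k \<Longrightarrow> qbinom p n k = 0"
  by (induction p n k rule: qbinom.induct) auto

lemma qbinom_self: "qbinom p n n = 1"
  by (induction n) (auto simp: qbinom_eq_0)

text \<open>This coefficient is the q-integer 1 + p + ... + p^n; the factor \<open>p - 1\<close>
  turns it into a difference of powers of \<open>p\<close>.\<close>

lemma qbinom_Suc_self: "(p - 1) * qbinom p (Suc n) n = p ^ Suc n - 1"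
proof (induction n)
  case (Suc n)
  have "(p - 1) * qbinom p (Suc (Suc n)) (Suc n)
      = (p - 1) * qbinom p (Suc n) n + (p - 1) * p ^ Suc n"
    by (simp only: qbinom.simps qbinom_self distrib_left mult_1_right)
  then show ?case by (simp only: Suc) (simp add: algebra_simps)
qed simp

text \<open>One step with the indices removed. The maps \<open>\<sigma>\<close>,
  \<open>\<delta>\<close> and \<open>d\<close> stay on the original A_(j-1), and \<open>h\<close>
  carries their values to the current stage, where \<open>x\<close> is x_j. This avoids transporting
  each map separately.\<close>

locale deleting_derivation = k_algebra s for s :: "'k::field \<Rightarrow> 'a::division_ring \<Rightarrow> 'a" +
  fixes A :: "'a set" and \<sigma> \<delta> :: "'a \<Rightarrow> 'a" and d :: "nat \<Rightarrow> 'a \<Rightarrow> 'a" and p :: 'k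
    and h :: "'a \<Rightarrow> 'a" and x :: 'a
  assumes subalg: "subalgebra s A"
    and sigma: "alg_iso s A A \<sigma>"
    and p: "p \<noteq> 0" "p \<noteq> 1"
    and hsd: "higher_skew_derivation s A p \<sigma> \<delta> d"
    and loc_nilp: "locally_nilpotent A d"
    and iter: "iterative s A p d"
    and h_hom: "algebra_hom s s A h"
    and h_inj: "inj_on h A"
    and x_h: "a \<in> A \<Longrightarrow> x * h a = h (\<sigma> a) * x + h (\<delta> a)"
    and indep: "left_independent (h ` A) x"
begin

definition \<tau> :: "'a \<Rightarrow> 'a" where
  "\<tau> = inv_into A \<sigma>"

definition coef :: "nat \<Rightarrow> 'k" where
  "coef n = p ^ (n * (n + 1) div 2) * inverse (p - 1) ^ n"

definition dterm :: "nat \<Rightarrow> 'a \<Rightarrow> 'a" where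
  "dterm n a = s (coef n) (h (d n ((\<tau> ^^ n) a)) * inverse x ^ n)"

definition \<Theta> :: "'a \<Rightarrow> 'a" where
  "\<Theta> a = Sum_any (\<lambda>n. dterm n a)"

lemmas A_closed = subalgebraD[OF subalg]
lemmas sigma_hom = alg_iso_hom(1)[OF sigma] and sigma_bij = alg_iso_hom(2)[OF sigma]

lemma sigma_closed: "a \<in> A \<Longrightarrow> \<sigma> a \<in> A"
  using sigma_bij bij_betwE by blast

lemma tau:
  assumes "a \<in> A"
  shows "\<tau> a \<in> A" "\<sigma> (\<tau> a) = a" "\<tau> (\<sigma> a) = a"
  using assms sigma_bij unfolding \<tau>_def bij_betw_def
  by (auto simp: inv_into_into f_inv_into_f inv_into_f_f)

lemma tau_hom: "algebra_hom s s A \<tau>"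
proof -
  have eq: "\<tau> b = a" if "a \<in> A" "\<sigma> a = b" for a b
    using that tau(3) by auto
  show ?thesis
    unfolding algebra_hom_def
    using tau A_closed algebra_homD[OF sigma_hom] by (auto intro!: eq)
qed

lemma tau_pow_closed: "a \<in> A \<Longrightarrow> (\<tau> ^^ n) a \<in> A"
  by (induction n) (auto simp: tau)

lemma sigma_pow_closed: "a \<in> A \<Longrightarrow> (\<sigma> ^^ n) a \<in> A"
  by (induction n) (auto simp: sigma_closed)

lemma tau_pow_hom: "algebra_hom s s A (\<tau> ^^ n)"
proof (induction n)
  case 0 then show ?case by (auto simp: algebra_hom_def)
next
  case (Suc n)
  then show ?case
    using algebra_homD[OF tau_hom] tau_pow_closed unfolding algebra_hom_def by auto
qed

lemma tau_pow_sigma: "a \<in> A \<Longrightarrow> (\<tau> ^^ Suc n) (\<sigma> a) = (\<tau> ^^ n) a"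
  by (simp add: funpow_Suc_right tau del: funpow.simps)

lemma sigma_tau_pow: "a \<in> A \<Longrightarrow> (\<tau> ^^ n) (\<sigma> a) = \<sigma> ((\<tau> ^^ n) a)"
  by (induction n) (auto simp: tau tau_pow_closed)

lemma sigma_pow_tau_pow: "a \<in> A \<Longrightarrow> (\<sigma> ^^ m) ((\<tau> ^^ (i + m)) a) = (\<tau> ^^ i) a"
proof (induction m)
  case (Suc m)
  then have "(\<sigma> ^^ Suc m) ((\<tau> ^^ (i + Suc m)) a) = (\<sigma> ^^ m) (\<sigma> (\<tau> ((\<tau> ^^ (i + m)) a)))"
    by (simp add: funpow_swap1)
  then show ?case using Suc by (simp add: tau tau_pow_closed)
qed simp

lemma
  shows d_closed: "a \<in> A \<Longrightarrow> d n a \<in> A"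
    and d_add: "a \<in> A \<Longrightarrow> b \<in> A \<Longrightarrow> d n (a + b) = d n a + d n b"
    and d_scale: "a \<in> A \<Longrightarrow> d n (s c a) = s c (d n a)"
    and d_0: "a \<in> A \<Longrightarrow> d 0 a = a"
    and d_1: "a \<in> A \<Longrightarrow> d 1 a = \<delta> a"
    and d_mult: "a \<in> A \<Longrightarrow> b \<in> A \<Longrightarrow> d n (a * b) = (\<Sum>i\<le>n. (\<sigma> ^^ (n - i)) (d i a) * d (n - i) b)"
    and d_sigma: "a \<in> A \<Longrightarrow> d n (\<sigma> a) = s (p ^ n) (\<sigma> (d n a))"
  using hsd unfolding higher_skew_derivation_def klinear_on_def image_subset_iff by blast+

lemma d_iter: "a \<in> A \<Longrightarrow> d n (d m a) = s (qbinom p (n + m) m) (d (n + m) a)"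
  using iter unfolding iterative_def by auto

lemma d_tau:
  assumes "a \<in> A"
  shows "d n (\<tau> a) = s (inverse p ^ n) (\<tau> (d n a))"
proof -
  have "d n a = s (p ^ n) (\<sigma> (d n (\<tau> a)))"
    using d_sigma[of "\<tau> a"] tau[OF assms] by simp
  then have "\<tau> (d n a) = s (p ^ n) (d n (\<tau> a))"
    using algebra_homD(3)[OF tau_hom] tau d_closed sigma_closed assms by simp
  then show ?thesis using p by (simp flip: power_mult_distrib)
qed

lemma d_tau_pow_eq_0:
  assumes "a \<in> A" "d n a = 0"
  shows "d n ((\<tau> ^^ m) a) = 0"
  using assms
  by (induction m) (auto simp: d_tau tau_pow_closed algebra_hom_zero[OF tau_hom subalg])

lemma sigma_pow_d:
  "a \<in> A \<Longrightarrow> (\<sigma> ^^ m) (d i a) = s (inverse p ^ (i * m)) (d i ((\<sigma> ^^ m) a))"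
proof (induction m)
  case (Suc m)
  have "(\<sigma> ^^ Suc m) (d i a) = s (inverse p ^ (i * m)) (\<sigma> (d i ((\<sigma> ^^ m) a)))"
    using Suc by (simp add: algebra_homD(3)[OF sigma_hom] d_closed sigma_pow_closed)
  also have "\<sigma> (d i ((\<sigma> ^^ m) a)) = s (inverse p ^ i) (d i ((\<sigma> ^^ Suc m) a))"
    using Suc.prems p by (simp add: d_sigma sigma_pow_closed flip: power_mult_distrib)
  finally show ?case by (simp add: algebra_simps flip: power_add)
qed simp

section \<open>The coefficients of the series\<close>

lemma coef_0: "coef 0 = 1"
  by (simp add: coef_def)

lemma coef_Suc: "coef (Suc n) * (p - 1) = coef n * p ^ Suc n"
proof -
  have "Suc n * (Suc n + 1) div 2 = n * (n + 1) div 2 + Suc n"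
    by (simp add: algebra_simps)
  then show ?thesis using p by (simp add: coef_def power_add)
qed

text \<open>The triangular number of i + m exceeds the sum of those of i and m by
  \<open>i * m\<close>. The extra power of \<open>p\<close> cancels against the one from
  \<open>sigma_pow_d\<close> when products of series are compared.\<close>

lemma coef_add: "coef (i + m) = coef i * coef m * p ^ (i * m)"
proof -
  \<comment> \<open>The triangular numbers are compared after doubling, where the division by 2 is
    exact.\<close>
  have two: "2 * (n * (n + 1) div 2) = n * (n + 1)" for n :: nat by simp
  have "(i + m) * (i + m + 1) = i * (i + 1) + m * (m + 1) + 2 * (i * m)"
    by (simp add: algebra_simps)
  then have "(i + m) * (i + m + 1) div 2 = i * (i + 1) div 2 + m * (m + 1) div 2 + i * m"
    using two[of "i + m"] two[of i] two[of m] by linarith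
  then show ?thesis by (simp add: coef_def power_add)
qed

lemma x_nonzero: "x \<noteq> 0"
  using left_independent_nonzero[OF indep] A_closed(2,3) algebra_homD(4)[OF h_hom]
    algebra_hom_zero[OF h_hom subalg] by force

section \<open>The series as a linear map, and its commutation with x\<close>

lemma d_bound:
  assumes "a \<in> A"
  obtains M where "\<forall>n\<ge>M. d n a = 0"
  using assms loc_nilp unfolding locally_nilpotent_def by blast

lemma dterm_eq_0: "a \<in> A \<Longrightarrow> d n a = 0 \<Longrightarrow> dterm n a = 0"
  by (simp add: dterm_def d_tau_pow_eq_0 algebra_hom_zero[OF h_hom subalg])

lemma Theta_eq_sum:
  assumes "a \<in> A" "\<forall>n\<ge>M. d n a = 0"
  shows "\<Theta> a = (\<Sum>n<M. dterm n a)"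
  unfolding \<Theta>_def
proof (rule Sum_any.expand_superset)
  show "{n. dterm n a \<noteq> 0} \<subseteq> {..<M}"
    using assms dterm_eq_0 by (force simp: not_less[symmetric])
qed simp

lemma dterm_add: "a \<in> A \<Longrightarrow> b \<in> A \<Longrightarrow> dterm n (a + b) = dterm n a + dterm n b"
  by (simp add: dterm_def algebra_homD[OF tau_pow_hom] algebra_homD[OF h_hom] d_add d_closed
      tau_pow_closed distrib_right scale_right_distrib)

lemma dterm_scale: "a \<in> A \<Longrightarrow> dterm n (s c a) = s c (dterm n a)"
  by (simp add: dterm_def algebra_homD[OF tau_pow_hom] algebra_homD[OF h_hom] d_scale d_closed
      tau_pow_closed scale_mult_left mult.commute)

lemma Theta_add:
  assumes "a \<in> A" "b \<in> A"
  shows "\<Theta> (a + b) = \<Theta> a + \<Theta> b"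
proof -
  obtain M1 M2 where "\<forall>n\<ge>M1. d n a = 0" "\<forall>n\<ge>M2. d n b = 0"
    using d_bound assms by metis
  then have *: "\<forall>n\<ge>max M1 M2. d n a = 0" "\<forall>n\<ge>max M1 M2. d n b = 0" by auto
  then have "\<forall>n\<ge>max M1 M2. d n (a + b) = 0" using d_add assms by simp
  then have "\<Theta> (a + b) = (\<Sum>n<max M1 M2. dterm n (a + b))"
    using Theta_eq_sum assms A_closed(4) by blast
  then show ?thesis
    using Theta_eq_sum[OF assms(1) *(1)] Theta_eq_sum[OF assms(2) *(2)]
    by (simp add: dterm_add assms sum.distrib)
qed

lemma Theta_scale:
  assumes "a \<in> A"
  shows "\<Theta> (s c a) = s c (\<Theta> a)"
proof -
  obtain M where *: "\<forall>n\<ge>M. d n a = 0" using d_bound assms by metis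
  then have "\<forall>n\<ge>M. d n (s c a) = 0" using d_scale assms by simp
  then show ?thesis
    using Theta_eq_sum * assms A_closed by (simp add: dterm_scale scale_sum_right)
qed

lemma Theta_zero: "\<Theta> 0 = 0"
  using Theta_add[of 0 0] A_closed(3) by simp

text \<open>Summed over \<open>n\<close>, the right-hand side telescopes to \<open>\<Theta> (\<sigma> a) * x\<close>.\<close>

lemma x_dterm:
  assumes "a \<in> A"
  shows "x * dterm n a = (s (inverse p ^ n) (dterm n (\<sigma> a)) +
           s (1 - inverse p ^ Suc n) (dterm (Suc n) (\<sigma> a))) * x"
proof -
  define b where "b = (\<tau> ^^ n) a"
  have b: "b \<in> A" and b1: "(\<tau> ^^ n) (\<sigma> a) = \<sigma> b" and b2: "(\<tau> ^^ Suc n) (\<sigma> a) = b"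
    using assms tau_pow_closed sigma_tau_pow tau_pow_sigma unfolding b_def by blast+
  have x1: "x * inverse x ^ n = inverse x ^ n * x"
    using x_nonzero power_commuting_commutes[of "inverse x" x n] by simp
  have x2: "inverse x ^ n = inverse x ^ Suc n * x"
    using x_nonzero by (simp add: power_Suc2 mult.assoc del: power_Suc)
  have "x * dterm n a = s (coef n) (x * h (d n b) * inverse x ^ n)"
    by (simp add: dterm_def b_def scale_mult_right mult.assoc)
  also have "x * h (d n b) = h (\<sigma> (d n b)) * x + h (\<delta> (d n b))"
    by (simp add: x_h d_closed b)
  also have "\<sigma> (d n b) = s (inverse p ^ n) (d n (\<sigma> b))"
    using p by (simp add: d_sigma b flip: power_mult_distrib)
  also have "\<delta> (d n b) = s (qbinom p (Suc n) n) (d (Suc n) b)"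
    using d_iter[OF b, of 1 n] d_1[OF d_closed[OF b]] by simp
  finally have "x * dterm n a = s (coef n * inverse p ^ n) (h (d n (\<sigma> b)) * x * inverse x ^ n)
      + s (coef n * qbinom p (Suc n) n) (h (d (Suc n) b) * inverse x ^ n)"
    by (simp add: algebra_homD[OF h_hom] d_closed b sigma_closed scale_mult_left
        scale_right_distrib distrib_right)
  also have "h (d n (\<sigma> b)) * x * inverse x ^ n = h (d n (\<sigma> b)) * inverse x ^ n * x"
    by (simp only: mult.assoc x1)
  also have "s (coef n * inverse p ^ n) \<dots> = s (inverse p ^ n) (dterm n (\<sigma> a)) * x"
    by (simp add: dterm_def b1 scale_mult_left mult.commute)
  \<comment> \<open>The recurrence for \<open>coef\<close> absorbs the q-integer without dividing by
    it. The weight 1 - p^-(n+1) left over complements the weight p^-(n+1) of the next term.\<close>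
  also have "coef n * qbinom p (Suc n) n = coef (Suc n) * (1 - inverse p ^ Suc n)"
  proof -
    have "(coef n * p ^ Suc n) * qbinom p (Suc n) n = coef (Suc n) * (p ^ Suc n - 1)"
      by (simp only: coef_Suc[symmetric] mult.assoc qbinom_Suc_self)
    then show ?thesis using p by (simp add: field_simps del: power_Suc)
  qed
  also have "h (d (Suc n) b) * inverse x ^ n = h (d (Suc n) b) * inverse x ^ Suc n * x"
    by (subst x2) (simp only: mult.assoc)
  also have "s (coef (Suc n) * (1 - inverse p ^ Suc n)) \<dots>
      = s (1 - inverse p ^ Suc n) (dterm (Suc n) (\<sigma> a)) * x"
    unfolding dterm_def b2 by (simp add: scale_mult_left mult.commute del: power_Suc)
  finally show ?thesis by (simp add: distrib_right)
qed

lemma x_Theta: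
  assumes "a \<in> A"
  shows "x * \<Theta> a = \<Theta> (\<sigma> a) * x"
proof -
  obtain M where M: "\<forall>n\<ge>M. d n a = 0" using d_bound assms by metis
  then have M': "\<forall>n\<ge>M. d n (\<sigma> a) = 0"
    using d_sigma algebra_hom_zero[OF sigma_hom subalg] assms by simp
  let ?t = "\<lambda>n. dterm n (\<sigma> a)"
  \<comment> \<open>Each \<open>?t n\<close> below \<open>k\<close> collects total weight 1: p^-n
    from its own summand and 1 - p^-n from the previous one. Only the boundary term at
    \<open>k\<close> remains, and it vanishes for k = M.\<close>
  have "(\<Sum>n<k. s (inverse p ^ n) (?t n) + s (1 - inverse p ^ Suc n) (?t (Suc n)))
      = (\<Sum>n<k. ?t n) + s (1 - inverse p ^ k) (?t k)" for k
    by (induction k) (auto simp: scale_left_diff_distrib)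
  moreover have "?t M = 0" using M' dterm_eq_0 sigma_closed assms by blast
  ultimately have "(\<Sum>n<M. s (inverse p ^ n) (?t n) + s (1 - inverse p ^ Suc n) (?t (Suc n))) = \<Theta> (\<sigma> a)"
    using M' Theta_eq_sum[OF sigma_closed[OF assms]] by simp
  moreover have "x * \<Theta> a = (\<Sum>n<M. s (inverse p ^ n) (?t n) + s (1 - inverse p ^ Suc n) (?t (Suc n))) * x"
    using Theta_eq_sum[OF assms M] x_dterm[OF assms] by (simp add: sum_distrib_left sum_distrib_right)
  ultimately show ?thesis by simp
qed

text \<open>\<open>x_Theta\<close> read backwards. The twist by a power of \<tau> picked up here is
  the one built into \<open>dterm\<close>, and this is what makes \<Theta> multiplicative.\<close>

lemma inverse_x_Theta:
  assumes "a \<in> A"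
  shows "inverse x ^ n * \<Theta> a = \<Theta> ((\<tau> ^^ n) a) * inverse x ^ n"
proof (induction n)
  case (Suc n)
  have 1: "inverse x * \<Theta> b = \<Theta> (\<tau> b) * inverse x" if "b \<in> A" for b
  proof -
    have "inverse x * \<Theta> b * x = inverse x * (x * \<Theta> (\<tau> b))"
      using x_Theta[of "\<tau> b"] tau that by (simp add: mult.assoc)
    also have "\<dots> = \<Theta> (\<tau> b)" using x_nonzero by (simp flip: mult.assoc)
    finally show ?thesis using x_nonzero by (metis mult.assoc mult.right_neutral right_inverse)
  qed
  have "inverse x ^ Suc n * \<Theta> a = inverse x * \<Theta> ((\<tau> ^^ n) a) * inverse x ^ n"
    by (simp add: mult.assoc Suc)
  then show ?case using 1[OF tau_pow_closed[OF assms]] by (simp add: mult.assoc)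
qed simp

text \<open>Moving x^-i across the whole series \<Theta>(b), not across its individual coefficients,
  gives a double sum without derivation terms. Collected by i + m = k, it is the twisted Leibniz
  rule for \<open>d k\<close>.\<close>

lemma Theta_mult:
  assumes a: "a \<in> A" and b: "b \<in> A"
  shows "\<Theta> (a * b) = \<Theta> a * \<Theta> b"
proof -
  obtain M1 M2 M3 where "\<forall>n\<ge>M1. d n a = 0" "\<forall>n\<ge>M2. d n b = 0" and M3: "\<forall>n\<ge>M3. d n (a * b) = 0"
    using d_bound a b A_closed by metis
  define M where "M = max M1 M2"
  \<comment> \<open>Large enough for the triangle i + m < K to contain the square of possibly
    nonzero terms, and for the series of \<open>a * b\<close> to have ended.\<close>
  define K where "K = max (M + M) M3"
  have Ma: "\<forall>n\<ge>M. d n a = 0" and Mb: "\<forall>n\<ge>M. d n b = 0"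
    using \<open>\<forall>n\<ge>M1. d n a = 0\<close> \<open>\<forall>n\<ge>M2. d n b = 0\<close> by (auto simp: M_def)
  \<comment> \<open>The \<open>i\<close>-th term of the first series times the \<open>m\<close>-th
    of the second, after x^-i has been moved to the far right.\<close>
  define f where "f i m = s (coef i * coef m)
      (h (d i ((\<tau> ^^ i) a) * d m ((\<tau> ^^ (i + m)) b)) * inverse x ^ (i + m))" for i m
  have f0: "f i m = 0" if "i \<ge> M \<or> m \<ge> M" for i m
    using that Ma Mb d_tau_pow_eq_0 a b by (auto simp: f_def algebra_hom_zero[OF h_hom subalg])
  have "dterm n a * \<Theta> b = (\<Sum>m<M. f n m)" for n
  proof -
    have "dterm n a * \<Theta> b = s (coef n) (h (d n ((\<tau> ^^ n) a)) * \<Theta> ((\<tau> ^^ n) b) * inverse x ^ n)"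
      by (simp add: dterm_def scale_mult_left mult.assoc inverse_x_Theta b)
    also have "\<Theta> ((\<tau> ^^ n) b) = (\<Sum>m<M. dterm m ((\<tau> ^^ n) b))"
      using Mb d_tau_pow_eq_0 b by (intro Theta_eq_sum) (auto simp: tau_pow_closed)
    also have "s (coef n) (h (d n ((\<tau> ^^ n) a)) * \<dots> * inverse x ^ n) = (\<Sum>m<M. f n m)"
      unfolding sum_distrib_left sum_distrib_right scale_sum_right
    proof (rule sum.cong)
      fix m
      have "(\<tau> ^^ m) ((\<tau> ^^ n) b) = (\<tau> ^^ (n + m)) b" by (simp add: add.commute funpow_add)
      then show "s (coef n) (h (d n ((\<tau> ^^ n) a)) * dterm m ((\<tau> ^^ n) b) * inverse x ^ n) = f n m"
        by (simp add: f_def dterm_def scale_mult_left scale_mult_right algebra_homD[OF h_hom]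
            d_closed tau_pow_closed a b mult.assoc add.commute power_add power_commutes
            flip: power_add)
    qed simp
    finally show ?thesis .
  qed
  then have "\<Theta> a * \<Theta> b = (\<Sum>i<M. \<Sum>m<M. f i m)"
    using Theta_eq_sum[OF a Ma] by (simp add: sum_distrib_right)
  also have "\<dots> = (\<Sum>(i, m)\<in>{..<M} \<times> {..<M}. f i m)" by (simp add: sum.cartesian_product)
  also have "\<dots> = (\<Sum>(i, m)\<in>{(i, m). i + m < K}. f i m)"
  proof (rule sum.mono_neutral_left)
    have "{(i, m). i + m < K} \<subseteq> {..<K} \<times> {..<K}" by auto
    then show "finite {(i, m). i + m < K}" by (rule finite_subset) simp
    show "{..<M} \<times> {..<M} \<subseteq> {(i, m). i + m < K}" by (auto simp: K_def)
    show "\<forall>z\<in>{(i, m). i + m < K} - {..<M} \<times> {..<M}. (case z of (i, m) \<Rightarrow> f i m) = 0"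
      using f0 by (force simp: not_less[symmetric])
  qed
  also have "\<dots> = (\<Sum>k<K. \<Sum>i\<le>k. f i (k - i))" by (rule sum.triangle_reindex)
  also have "\<dots> = (\<Sum>k<K. dterm k (a * b))"
  proof (rule sum.cong)
    fix k
    \<comment> \<open>The Leibniz rule puts \<sigma>^(k-i) in front of d_i. Commuting it past d_i
      undoes part of the twist and leaves the power of \<open>p\<close> that \<open>coef_add\<close>
      accounts for.\<close>
    have "(\<sigma> ^^ (k - i)) (d i ((\<tau> ^^ k) a)) = s (inverse p ^ (i * (k - i))) (d i ((\<tau> ^^ i) a))"
      if "i \<le> k" for i
      using sigma_pow_d[OF tau_pow_closed[OF a], of "k - i" i k] sigma_pow_tau_pow[OF a, of "k - i" i] that
      by simp
    then have "dterm k (a * b) = (\<Sum>i\<le>k. s (coef k * inverse p ^ (i * (k - i)))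
        (h (d i ((\<tau> ^^ i) a) * d (k - i) ((\<tau> ^^ k) b)) * inverse x ^ k))"
      by (simp add: dterm_def algebra_homD[OF tau_pow_hom] a b d_mult tau_pow_closed scale_mult_left
          algebra_hom_sum[OF h_hom subalg] algebra_homD[OF h_hom] A_closed d_closed
          sum_distrib_right scale_sum_right)
    also have "\<dots> = (\<Sum>i\<le>k. f i (k - i))"
    proof (rule sum.cong)
      fix i assume "i \<in> {..k}"
      then have "coef k * inverse p ^ (i * (k - i)) = coef i * coef (k - i)"
        using coef_add[of i "k - i"] p by (simp add: field_simps)
      with \<open>i \<in> {..k}\<close> show "s (coef k * inverse p ^ (i * (k - i)))
        (h (d i ((\<tau> ^^ i) a) * d (k - i) ((\<tau> ^^ k) b)) * inverse x ^ k) = f i (k - i)"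
        by (simp add: f_def)
    qed simp
    finally show "(\<Sum>i\<le>k. f i (k - i)) = dterm k (a * b)" by simp
  qed simp
  also have "\<dots> = \<Theta> (a * b)"
    by (rule Theta_eq_sum[symmetric]) (use M3 a b A_closed in \<open>auto simp: K_def\<close>)
  finally show ?thesis by simp
qed

lemma Theta_in_fractions_by:
  assumes "subalgebra s U" "x \<in> U" "h ` A \<subseteq> U" "a \<in> A"
  shows "\<Theta> a \<in> fractions_by x U"
proof -
  obtain M where M: "\<forall>n\<ge>M. d n a = 0" using d_bound assms by metis
  have "h (d n ((\<tau> ^^ n) a)) \<in> fractions_by x U" for n
    using assms(3,4) fractions_by_base[of U x] d_closed tau_pow_closed by blast
  then have "dterm n a \<in> fractions_by x U" for n
    unfolding dterm_def
    by (intro subspace_scale[OF subspace_fractions_by[OF assms(1,2)]] fractions_by_power x_nonzero)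
  then show ?thesis
    unfolding Theta_eq_sum[OF \<open>a \<in> A\<close> M]
    by (intro subspace_sum subspace_fractions_by assms)
qed

text \<open>Solve \<Theta>(a) = h(a) + later terms for h(a), by induction on the nilpotency order:
  by iterativity d_n lowers the order by n, so the later terms are already known to be
  fractions.\<close>

lemma h_in_fractions_by:
  assumes U: "subalgebra s U" "x \<in> U" "\<Theta> ` A \<subseteq> U" and "a \<in> A"
  shows "h a \<in> fractions_by x U"
proof -
  note L = subspace_fractions_by[OF U(1,2)]
  have "a \<in> A \<Longrightarrow> \<forall>n\<ge>N. d n a = 0 \<Longrightarrow> h a \<in> fractions_by x U" for N a
  proof (induction N arbitrary: a rule: less_induct)
    case (less N)
    show ?case
    proof (cases N)
      case 0
      then have "a = 0" using less.prems d_0 by force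
      then show ?thesis using subspace_0[OF L] algebra_hom_zero[OF h_hom subalg] by simp
    next
      case (Suc N')
      have "dterm n a \<in> fractions_by x U" if "n \<in> {1..<N}" for n
      proof -
        have "d m (d n ((\<tau> ^^ n) a)) = 0" if "m \<ge> N - n" for m
          using that d_iter[OF tau_pow_closed[OF less.prems(1)]] less.prems d_tau_pow_eq_0[OF less.prems(1)]
          by simp
        then have "h (d n ((\<tau> ^^ n) a)) \<in> fractions_by x U"
          using less.IH[of "N - n"] that less.prems(1) d_closed tau_pow_closed by auto
        then show ?thesis
          unfolding dterm_def by (intro subspace_scale[OF L] fractions_by_power x_nonzero)
      qed
      then have "(\<Sum>n\<in>{1..<N}. dterm n a) \<in> fractions_by x U" by (intro subspace_sum L)
      moreover have "\<Theta> a = dterm 0 a + (\<Sum>n\<in>{1..<N}. dterm n a)"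
        using Theta_eq_sum[OF less.prems] sum.atLeast_Suc_lessThan[of 0 N "\<lambda>n. dterm n a"] Suc
        by (simp add: atLeast0LessThan)
      moreover have "dterm 0 a = h a"
        using less.prems(1) by (simp add: dterm_def coef_0 d_0)
      moreover have "\<Theta> a \<in> fractions_by x U"
        using U(3) less.prems(1) fractions_by_base by blast
      ultimately show ?thesis using subspace_diff[OF L] by (metis add_diff_cancel_right')
    qed
  qed
  then show ?thesis using d_bound \<open>a \<in> A\<close> by metis
qed

section \<open>Leading terms in x, and freeness over its powers\<close>

definition low :: "nat \<Rightarrow> 'a set" where
  "low N = {\<Sum>i<N. h (r i) * x ^ i | r. \<forall>i. r i \<in> A}"

lemma subspace_low: "subspace (low N)"
proof (rule subspaceI)
  show "0 \<in> low N"
    unfolding low_def using A_closed(3) algebra_hom_zero[OF h_hom subalg]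
    by (auto intro!: exI[of _ "\<lambda>_. 0"])
next
  fix y z assume "y \<in> low N" "z \<in> low N"
  then obtain r t where "\<forall>i. r i \<in> A" "\<forall>i. t i \<in> A" "y = (\<Sum>i<N. h (r i) * x ^ i)"
    "z = (\<Sum>i<N. h (t i) * x ^ i)" by (auto simp: low_def)
  then show "y + z \<in> low N"
    unfolding low_def using A_closed(4)
    by (auto intro!: exI[of _ "\<lambda>i. r i + t i"] simp: algebra_homD[OF h_hom] distrib_right sum.distrib)
next
  fix c y assume "y \<in> low N"
  then obtain r where "\<forall>i. r i \<in> A" "y = (\<Sum>i<N. h (r i) * x ^ i)" by (auto simp: low_def)
  then show "s c y \<in> low N"
    unfolding low_def using A_closed(7)
    by (auto intro!: exI[of _ "\<lambda>i. s c (r i)"] simp: algebra_homD[OF h_hom] scale_mult_left scale_sum_right)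
qed

lemma monomial_in_low:
  assumes "a \<in> A" "i < N"
  shows "h a * x ^ i \<in> low N"
proof -
  have "(\<Sum>k<N. h (if k = i then a else 0) * x ^ k) = (\<Sum>k<N. if k = i then h a * x ^ i else 0)"
    by (rule sum.cong) (auto simp: algebra_hom_zero[OF h_hom subalg])
  also have "\<dots> = h a * x ^ i" using assms by simp
  finally have "h a * x ^ i = (\<Sum>k<N. h (if k = i then a else 0) * x ^ k)" by simp
  then show ?thesis unfolding low_def using assms A_closed(3) by (auto intro!: exI)
qed

lemma leading_coefficient_zero:
  assumes "a \<in> A" "z \<in> low N" "h a * x ^ N + z = 0"
  shows "a = 0"
proof -
  obtain r where r: "\<forall>i. r i \<in> A" "z = (\<Sum>i<N. h (r i) * x ^ i)"
    using assms by (auto simp: low_def)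
  define t where "t = r(N := a)"
  have "(\<Sum>i<N. h (t i) * x ^ i) = z" unfolding r(2) by (rule sum.cong) (auto simp: t_def)
  then have "(\<Sum>i\<le>N. h (t i) * x ^ i) = 0"
    using assms(3) by (simp add: lessThan_Suc_atMost[symmetric] t_def add.commute)
  then have "h (t N) = 0"
    using left_independentD[OF indep, of N "\<lambda>i. h (t i)" N] r(1) assms(1) by (auto simp: t_def)
  then show ?thesis
    using inj_onD[OF h_inj, of a 0] A_closed(3) algebra_hom_zero[OF h_hom subalg] assms(1)
    by (simp add: t_def)
qed

text \<open>The factor x^(i+M) clears every denominator, as the series stops before
  \<open>M\<close>. The \<open>n\<close>-th term then carries x^(i+M-n), so only n = 0 reaches the
  top degree.\<close>

lemma Theta_leading:
  assumes "a \<in> A" "\<forall>n\<ge>M. d n a = 0"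
  shows "\<Theta> a * x ^ (i + M) - h a * x ^ (i + M) \<in> low (i + M)"
proof (cases M)
  case 0
  then have "a = 0" using assms d_0 by force
  then show ?thesis using Theta_zero algebra_hom_zero[OF h_hom subalg] subspace_0[OF subspace_low] by simp
next
  case (Suc M')
  have "\<Theta> a = h a + (\<Sum>n\<in>{1..<M}. dterm n a)"
    using Theta_eq_sum[OF assms] sum.atLeast_Suc_lessThan[of 0 M "\<lambda>n. dterm n a"] Suc assms(1)
    by (simp add: atLeast0LessThan dterm_def coef_0 d_0)
  then have "\<Theta> a * x ^ (i + M) - h a * x ^ (i + M) = (\<Sum>n\<in>{1..<M}. dterm n a * x ^ (i + M))"
    by (simp add: distrib_right sum_distrib_right)
  also have "\<dots> \<in> low (i + M)"
  proof (rule subspace_sum[OF subspace_low])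
    fix n assume n: "n \<in> {1..<M}"
    then have "x ^ (i + M) = x ^ n * x ^ (i + M - n)" by (simp flip: power_add)
    then have "dterm n a * x ^ (i + M) = s (coef n) (h (d n ((\<tau> ^^ n) a)) * (inverse x ^ n * x ^ n * x ^ (i + M - n)))"
      by (simp add: dterm_def scale_mult_left mult.assoc)
    also have "inverse x ^ n * x ^ n = 1" using x_nonzero by (simp add: power_inverse)
    finally show "dterm n a * x ^ (i + M) \<in> low (i + M)"
      using n monomial_in_low[of "d n ((\<tau> ^^ n) a)" "i + M - n" "i + M"] assms(1)
      by (simp add: subspace_scale[OF subspace_low] d_closed tau_pow_closed)
  qed
  finally show ?thesis .
qed

text \<open>Stated for all sufficiently large \<open>M\<close>, so that the thresholds of different
  coefficients can be raised to a common one.\<close>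

lemma Theta_sum_low:
  assumes "\<And>i. i < n \<Longrightarrow> r i \<in> A"
  shows "\<exists>M0. \<forall>M\<ge>M0. (\<Sum>i<n. \<Theta> (r i) * x ^ i) * x ^ M \<in> low (n + M)"
  using assms
proof (induction n)
  case 0 then show ?case using subspace_0[OF subspace_low] by auto
next
  case (Suc n)
  then obtain M0 where M0: "\<forall>M\<ge>M0. (\<Sum>i<n. \<Theta> (r i) * x ^ i) * x ^ M \<in> low (n + M)" by auto
  obtain M1 where M1: "\<forall>k\<ge>M1. d k (r n) = 0" using d_bound Suc.prems by (metis lessI)
  have sub: "low k \<subseteq> low (Suc k)" for k
  proof
    fix z assume "z \<in> low k"
    then obtain r where "\<forall>i. r i \<in> A" "z = (\<Sum>i<k. h (r i) * x ^ i)" by (auto simp: low_def)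
    moreover have "(\<Sum>i<k. h (r i) * x ^ i) \<in> low (Suc k)" if "\<forall>i. r i \<in> A" for r
      using that by (intro subspace_sum[OF subspace_low] monomial_in_low) auto
    ultimately show "z \<in> low (Suc k)" by auto
  qed
  have "(\<Sum>i<Suc n. \<Theta> (r i) * x ^ i) * x ^ M \<in> low (Suc n + M)" if "M \<ge> max M0 M1" for M
  proof -
    have "(\<Sum>i<n. \<Theta> (r i) * x ^ i) * x ^ M \<in> low (Suc n + M)" using M0 that sub by auto
    moreover have "\<Theta> (r n) * x ^ (n + M) - h (r n) * x ^ (n + M) \<in> low (Suc n + M)"
      using Theta_leading[of "r n" M n] Suc.prems M1 that sub by auto
    moreover have "h (r n) * x ^ (n + M) \<in> low (Suc n + M)"
      using monomial_in_low Suc.prems by simp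
    moreover have "(\<Sum>i<Suc n. \<Theta> (r i) * x ^ i) * x ^ M = (\<Sum>i<n. \<Theta> (r i) * x ^ i) * x ^ M +
        (\<Theta> (r n) * x ^ (n + M) - h (r n) * x ^ (n + M)) + h (r n) * x ^ (n + M)"
      by (simp add: distrib_right mult.assoc power_add)
    ultimately show ?thesis by (simp only: subspace_add[OF subspace_low])
  qed
  then show ?case by blast
qed

text \<open>After multiplication by a high power of \<open>x\<close> the relation has leading
  coefficient h(r_n), everything else being of lower degree; freeness over h(A) makes it
  vanish.\<close>

lemma Theta_top_zero:
  assumes r: "\<And>i. i \<le> n \<Longrightarrow> r i \<in> A" and "(\<Sum>i\<le>n. \<Theta> (r i) * x ^ i) = 0"
  shows "r n = 0"
proof -
  obtain M0 where M0: "\<forall>M\<ge>M0. (\<Sum>i<n. \<Theta> (r i) * x ^ i) * x ^ M \<in> low (n + M)"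
    using Theta_sum_low[of n r] r by auto
  obtain M1 where M1: "\<forall>k\<ge>M1. d k (r n) = 0" using d_bound r by (metis le_refl)
  define M where "M = max M0 M1"
  define z where "z = (\<Sum>i<n. \<Theta> (r i) * x ^ i) * x ^ M + (\<Theta> (r n) * x ^ (n + M) - h (r n) * x ^ (n + M))"
  have "z \<in> low (n + M)"
    unfolding z_def using M0 Theta_leading[of "r n" M n] r M1
    by (intro subspace_add[OF subspace_low]) (auto simp: M_def)
  moreover have "h (r n) * x ^ (n + M) + z = (\<Sum>i\<le>n. \<Theta> (r i) * x ^ i) * x ^ M"
    by (simp add: z_def lessThan_Suc_atMost[symmetric] distrib_right mult.assoc power_add)
  ultimately show ?thesis
    using leading_coefficient_zero[of "r n" z "n + M"] r assms(2) by simp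
qed

lemma Theta_independent:
  assumes "\<And>i. i \<le> n \<Longrightarrow> r i \<in> A" and "(\<Sum>i\<le>n. \<Theta> (r i) * x ^ i) = 0" and "i \<le> n"
  shows "r i = 0"
  using assms
proof (induction n arbitrary: i)
  case 0
  then show ?case using Theta_top_zero[of 0 r] by simp
next
  case (Suc n)
  have top: "r (Suc n) = 0" using Theta_top_zero[of "Suc n" r] Suc.prems by blast
  then have "(\<Sum>i\<le>n. \<Theta> (r i) * x ^ i) = 0" using Suc.prems(2) by (simp add: Theta_zero)
  then have "r i = 0" if "i \<le> n" for i using Suc.IH[OF _ _ that] Suc.prems(1) by force
  with top Suc.prems(3) show ?case by (metis le_Suc_eq)
qed

text \<open>Unitality is inferred from multiplicativity and nonvanishing, instead of computing
  d_n(1) for n > 0; this is why independence comes first.\<close>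

lemma Theta_hom: "algebra_hom s s A \<Theta>"
proof -
  have "\<Theta> 1 \<noteq> 0"
    using Theta_independent[of 0 "\<lambda>_. 1" 0] A_closed(2) by auto
  moreover have "\<Theta> 1 * \<Theta> 1 = \<Theta> 1"
    using Theta_mult[of 1 1] A_closed(2) by simp
  ultimately have "\<Theta> 1 = 1" by simp \<comment> \<open>a nonzero idempotent of a division ring\<close>
  then show ?thesis
    unfolding algebra_hom_def using Theta_add Theta_mult Theta_scale by auto
qed

lemma Theta_inj: "inj_on \<Theta> A"
proof (rule algebra_hom_inj[OF Theta_hom subalg])
  show "a = 0" if "a \<in> A" "\<Theta> a = 0" for a
    using Theta_independent[of 0 "\<lambda>_. a" 0] that by simp
qed

lemma Theta_left_independent: "left_independent (\<Theta> ` A) x"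
  unfolding left_independent_def
proof (intro allI impI)
  fix n r i assume r: "(\<forall>i\<le>n. r i \<in> \<Theta> ` A) \<and> (\<Sum>i\<le>n. r i * x ^ i) = 0" and "i \<le> n"
  define t where "t i = inv_into A \<Theta> (r i)" for i
  have t: "t i \<in> A \<and> r i = \<Theta> (t i)" if "i \<le> n" for i
    using r that by (auto simp: t_def inv_into_into f_inv_into_f)
  then have "(\<Sum>i\<le>n. \<Theta> (t i) * x ^ i) = (\<Sum>i\<le>n. r i * x ^ i)" by (intro sum.cong) auto
  then have "(\<Sum>i\<le>n. \<Theta> (t i) * x ^ i) = 0" using r by simp
  then have "t i = 0" using Theta_independent[of n t i] t \<open>i \<le> n\<close> by blast
  then show "r i = 0" using t \<open>i \<le> n\<close> Theta_zero by simp
qed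

end

section \<open>Skew-commuting elements\<close>

lemma normal_power:
  fixes z :: "'a::monoid_mult"
  assumes normal: "\<And>u. u \<in> U \<Longrightarrow> \<exists>u'\<in>U. u * z = z * u'" and "u \<in> U"
  shows "\<exists>u'\<in>U. u * z ^ n = z ^ n * u'"
  using assms(2)
proof (induction n arbitrary: u)
  case (Suc n)
  obtain u1 where u1: "u1 \<in> U" "u * z = z * u1" using normal Suc.prems by blast
  obtain u2 where u2: "u2 \<in> U" "u1 * z ^ n = z ^ n * u2" using Suc.IH u1 by blast
  have "u * z ^ Suc n = z * (u1 * z ^ n)" using u1 by (simp flip: mult.assoc)
  then have "u * z ^ Suc n = z ^ Suc n * u2" using u2 by (simp add: mult.assoc)
  then show ?case using u2 by blast
qed auto

context k_algebra
begin

lemma skew_commute_power: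
  assumes "z * y = scale c (y * z)"
  shows "z ^ n * y ^ m = scale (c ^ (n * m)) (y ^ m * z ^ n)"
proof -
  have 1: "z * y ^ m = scale (c ^ m) (y ^ m * z)" for m
  proof (induction m)
    case (Suc m)
    have "z * y ^ Suc m = scale (c ^ m) (y ^ m * (z * y))"
      using Suc by (simp add: scale_mult_left power_Suc2 mult.assoc[symmetric] del: power_Suc)
    then show ?case
      by (simp add: assms scale_mult_right power_Suc2 mult.assoc mult.commute del: power_Suc)
  qed simp
  show ?thesis
  proof (induction n)
    case (Suc n)
    have "z ^ Suc n * y ^ m = scale (c ^ (n * m)) (z * y ^ m * z ^ n)"
      using Suc by (simp add: scale_mult_right mult.assoc)
    then show ?case
      by (simp add: 1 scale_mult_left mult.assoc power_add mult.commute)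
  qed simp
qed

lemma skew_commute_sym:
  assumes "z * y = scale c (y * z)" "c \<noteq> 0"
  shows "y * z = scale (inverse c) (z * y)"
  using assms by simp

text \<open>\<open>z\<close> is not assumed normal in \<open>U\<close>, so the fractions need not
  form an algebra. It is enough that \<open>z\<close> skew-commutes with the generators: the
  denominator of a left factor passes each generator at the cost of a scalar.\<close>

lemma span_subset_fractions_by:
  assumes U: "subalgebra scale U" and z: "z \<in> U"
    and Y: "\<And>y. y \<in> Y \<Longrightarrow> y \<in> fractions_by z U"
      "\<And>y. y \<in> Y \<Longrightarrow> \<exists>c. c \<noteq> 0 \<and> z * y = scale c (y * z)"
  shows "alg_span scale Y \<subseteq> fractions_by z U"
proof (rule alg_span_right_closed)
  show "subspace (fractions_by z U)" by (rule subspace_fractions_by[OF U z])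
  show "1 \<in> fractions_by z U" using subalgebraD(2)[OF U] fractions_by_base by blast
next
  fix v y assume v: "v \<in> fractions_by z U" and y: "y \<in> Y"
  obtain n where n: "v * z ^ n \<in> U" using v by (auto simp: fractions_by_def)
  obtain m where m: "y * z ^ m \<in> U" using Y(1)[OF y] by (auto simp: fractions_by_def)
  obtain c where c: "c \<noteq> 0" "z * y = scale c (y * z)" using Y(2)[OF y] by blast
  have "y * z ^ n = scale (inverse (c ^ n)) (z ^ n * y)"
    using skew_commute_power[OF c(2), of n 1] c(1) by simp
  then have "v * y * z ^ (n + m) = scale (inverse (c ^ n)) ((v * z ^ n) * (y * z ^ m))"
    by (simp add: power_add mult.assoc[symmetric] scale_mult_left scale_mult_right)
      (simp add: mult.assoc scale_mult_left scale_mult_right)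
  moreover have "(v * z ^ n) * (y * z ^ m) \<in> U" using n m subalgebraD(8)[OF U] by blast
  ultimately have "v * y * z ^ (n + m) \<in> U" using subalgebraD(7)[OF U] by simp
  then show "v * y \<in> fractions_by z U"
    unfolding fractions_by_def by blast
qed

text \<open>Normality is the Ore condition here: the denominator of the left factor is carried
  through the numerator of the right one.\<close>

lemma subalgebra_fractions_by:
  assumes U: "subalgebra scale U" and z: "z \<in> U"
    and norm: "\<And>u. u \<in> U \<Longrightarrow> \<exists>u'\<in>U. u * z = z * u'"
  shows "subalgebra scale (fractions_by z U)"
proof -
  note L = subspace_fractions_by[OF U z]
  show ?thesis
  proof (rule subalgebraI)
    show "1 \<in> fractions_by z U" using subalgebraD(2)[OF U] fractions_by_base by blast
    show "v + v' \<in> fractions_by z U" "scale c v \<in> fractions_by z U"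
      if "v \<in> fractions_by z U" "v' \<in> fractions_by z U" for v v' c
      using that subspace_add[OF L] subspace_scale[OF L] by auto
    show "v * v' \<in> fractions_by z U" if v: "v \<in> fractions_by z U" "v' \<in> fractions_by z U" for v v'
    proof -
      obtain n m where nm: "v * z ^ n \<in> U" "v' * z ^ m \<in> U" using v by (auto simp: fractions_by_def)
      obtain u where u: "u \<in> U" "v' * z ^ m * z ^ n = z ^ n * u" using normal_power[OF norm nm(2)] by blast
      have "v * v' * z ^ (m + n) = v * z ^ n * u" using u by (simp add: power_add mult.assoc)
      then have "v * v' * z ^ (m + n) \<in> U" using subalgebraD(8)[OF U nm(1) u(1)] by simp
      then show ?thesis unfolding fractions_by_def by blast
    qed
  qed
qed

lemma skew_normal_span:
  assumes "\<And>y. y \<in> Y \<Longrightarrow> \<exists>c. c \<noteq> 0 \<and> z * y = scale c (y * z)" and "u \<in> alg_span scale Y"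
  shows "\<exists>u'\<in>alg_span scale Y. u * z = z * u'"
  using assms(2)
proof (induction rule: alg_span_induct)
  case (gen y)
  then obtain c where "c \<noteq> 0" "z * y = scale c (y * z)" using assms(1) by blast
  then have "y * z = z * scale (inverse c) y" by (simp add: scale_mult_right)
  then show ?case using gen alg_span_base subalgebraD(7)[OF subalgebra_alg_span] by blast
next
  case one
  then show ?case using subalgebraD(2)[OF subalgebra_alg_span, of Y] by (intro bexI[of _ 1]) auto
next
  case (add a b)
  then obtain a' b' where "a' \<in> alg_span scale Y" "b' \<in> alg_span scale Y" "a * z = z * a'" "b * z = z * b'"
    by blast
  then show ?case
    by (intro bexI[of _ "a' + b'"]) (auto simp: distrib_left distrib_right subalgebraD(4)[OF subalgebra_alg_span])
next
  case (scale c a)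
  then obtain a' where "a' \<in> alg_span scale Y" "a * z = z * a'" by blast
  then show ?case
    by (intro bexI[of _ "scale c a'"])
      (auto simp: scale_mult_left scale_mult_right subalgebraD(7)[OF subalgebra_alg_span])
next
  case (mult a b)
  then obtain a' b' where ab: "a' \<in> alg_span scale Y" "b' \<in> alg_span scale Y" "a * z = z * a'" "b * z = z * b'"
    by blast
  have "a * b * z = z * (a' * b')" by (simp add: ab mult.assoc) (simp add: ab flip: mult.assoc)
  then show ?case using ab subalgebraD(8)[OF subalgebra_alg_span] by blast
qed

end

section \<open>One step of the algorithm\<close>

locale qna = fixes D :: "('k::field, 'a::division_ring) qna_data"
  assumes qna: "quantum_nilpotent_algebra D"
begin

sublocale k_algebra "scl D"
  using qna unfolding quantum_nilpotent_algebra_def by blast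

abbreviation N :: nat where "N \<equiv> ngen D"
abbreviation s :: "'k \<Rightarrow> 'a \<Rightarrow> 'a" where "s \<equiv> scl D"

lemma N_pos: "1 \<le> N"
  using qna unfolding quantum_nilpotent_algebra_def by blast

lemma ore: "i \<in> {2..N} \<Longrightarrow>
    ore_extension s (qna_sub D (i - 1)) (gen D i) (aut D i) (der D i) (qna_sub D i)"
  using qna unfolding quantum_nilpotent_algebra_def by blast

lemma aut_gen: "i \<in> {2..N} \<Longrightarrow> l \<in> {1..<i} \<Longrightarrow> aut D i (gen D l) = s (lam D i l) (gen D l)"
  using qna unfolding quantum_nilpotent_algebra_def by blast

lemma lam_nonzero: "i \<in> {1..N} \<Longrightarrow> l \<in> {1..N} \<Longrightarrow> lam D i l \<noteq> 0"
  using qna unfolding quantum_nilpotent_algebra_def by blast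

lemma lam_inverse: "i \<in> {1..N} \<Longrightarrow> l \<in> {1..N} \<Longrightarrow> lam D i l = inverse (lam D l i)"
  using qna unfolding quantum_nilpotent_algebra_def by blast

lemma lam_self: "i \<in> {1..N} \<Longrightarrow> lam D i i = 1"
  using qna unfolding quantum_nilpotent_algebra_def by blast

lemma qpar: "i \<in> {2..N} \<Longrightarrow> qpar D i \<noteq> 0 \<and> qpar D i \<noteq> 1"
  using qna unfolding quantum_nilpotent_algebra_def by blast

lemma hder: "i \<in> {2..N} \<Longrightarrow>
    higher_skew_derivation s (qna_sub D (i - 1)) (qpar D i) (aut D i) (der D i) (hder D i) \<and>
    locally_nilpotent (qna_sub D (i - 1)) (hder D i) \<and>
    iterative s (qna_sub D (i - 1)) (qpar D i) (hder D i)"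
  using qna unfolding quantum_nilpotent_algebra_def by blast

lemma aut_hder: "i \<in> {2..N} \<Longrightarrow> l \<in> {i + 1..N} \<Longrightarrow> r \<in> qna_sub D (i - 1) \<Longrightarrow>
    aut D l (hder D i n r) = s (lam D l i ^ n) (hder D i n (aut D l r))"
  using qna unfolding quantum_nilpotent_algebra_def by blast

lemma aut_iso: "i \<in> {2..N} \<Longrightarrow> alg_iso s (qna_sub D (i - 1)) (qna_sub D (i - 1)) (aut D i)"
  using ore by (simp add: ore_extension_def)

lemma subalgebra_qna_sub: "subalgebra s (qna_sub D i)"
  by (simp add: qna_sub_def subalgebra_alg_span)

lemma gen_in_qna_sub: "l \<in> {1..i} \<Longrightarrow> gen D l \<in> qna_sub D i"
  by (auto simp: qna_sub_def intro: alg_span_base)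

lemma qna_sub_mono: "i \<le> k \<Longrightarrow> qna_sub D i \<subseteq> qna_sub D k"
  unfolding qna_sub_def by (intro alg_span_mono image_mono) auto

end

text \<open>\<open>x\<close> is the family \<open>X\<^sup>(\<^sup>j\<^sup>+\<^sup>1\<^sup>)\<close>, and \<open>H\<close> the isomorphism of \<open>A\<^sub>j\<close> onto the subalgebra generated by
  \<open>x\<^sub>1, \<dots>, x\<^sub>j\<close>.\<close>

locale dd_stage = qna D for D :: "('k::field, 'a::division_ring) qna_data" +
  fixes j :: nat and x :: "nat \<Rightarrow> 'a" and H :: "'a \<Rightarrow> 'a"
  assumes j: "j \<in> {2..N}"
    and H_hom: "algebra_hom s s (qna_sub D j) H"
    and H_inj: "inj_on H (qna_sub D j)"
    and H_gen: "i \<in> {1..j} \<Longrightarrow> H (gen D i) = x i"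
    and rel: "k \<in> {j<..N} \<Longrightarrow> i \<in> {1..<k} \<Longrightarrow> x k * x i = s (lam D k i) (x i * x k)"
    and indep: "k \<in> {j<..N} \<Longrightarrow> left_independent (alg_span s (x ` {1..<k})) (x k)"
begin

definition A where "A = qna_sub D (j - 1)"

lemma A_subset: "A \<subseteq> qna_sub D j"
  unfolding A_def by (rule qna_sub_mono) simp

lemma gen_in_A: "l \<in> {1..<j} \<Longrightarrow> gen D l \<in> A"
  by (auto simp: A_def intro!: gen_in_qna_sub)

lemma A_eq: "A = alg_span s (gen D ` {1..<j})"
  proof -
  have "{1..j - 1} = {1..<j}" using j by auto
  then show ?thesis by (simp only: A_def qna_sub_def)
qed

lemma H_hom_A: "algebra_hom s s A H"
  using algebra_hom_subset[OF H_hom A_subset] .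

lemma H_inj_A: "inj_on H A"
  using inj_on_subset[OF H_inj A_subset] .

lemma H_image: "H ` A = alg_span s (x ` {1..<j})"
proof -
  have "H ` gen D ` {1..<j} = x ` {1..<j}" using H_gen j by (force simp: image_iff)
  then show ?thesis
    using algebra_hom_image_span[OF H_hom_A[unfolded A_eq] k_algebra_axioms] by (simp only: A_eq)
qed

text \<open>\<open>H\<close> is an injective homomorphism on all of A_j, not merely on A_(j-1), so
  both the commutation rule of X_j and freeness over its powers carry over from the given Ore
  extension.\<close>

sublocale dd: deleting_derivation s A "aut D j" "der D j" "hder D j" "qpar D j" H "x j"
proof
  have der_closed: "der D j a \<in> A" if "a \<in> A" for a
    using ore[OF j] that unfolding ore_extension_def A_def by (elim conjE) (auto simp: image_subset_iff)
  have gen_mult: "gen D j * a = aut D j a * gen D j + der D j a" if "a \<in> A" for a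
    using ore[OF j] that unfolding ore_extension_def A_def by (elim conjE) (erule (1) bspec)
  have ore_indep: "\<forall>i\<le>n. r i = 0" if "\<forall>i\<le>n. r i \<in> A" "(\<Sum>i\<le>n. r i * gen D j ^ i) = 0"
    for n :: nat and r
    using ore[OF j] that unfolding ore_extension_def A_def by (elim conjE) simp
  note hom = algebra_homD[OF H_hom]
  have gj: "gen D j \<in> qna_sub D j" using gen_in_qna_sub j by auto
  have Hgj: "H (gen D j) = x j" using H_gen j by auto
  have S: "subalgebra s (qna_sub D j)" by (rule subalgebra_qna_sub)
  show "subalgebra s A" unfolding A_def by (rule subalgebra_qna_sub)
  show "alg_iso s A A (aut D j)" unfolding A_def by (rule aut_iso[OF j])
  show "qpar D j \<noteq> 0" "qpar D j \<noteq> 1" using qpar[OF j] by auto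
  show "higher_skew_derivation s A (qpar D j) (aut D j) (der D j) (hder D j)"
    "locally_nilpotent A (hder D j)" "iterative s A (qpar D j) (hder D j)"
    using hder[OF j] unfolding A_def by blast+
  show "algebra_hom s s A H" "inj_on H A" by (rule H_hom_A, rule H_inj_A)
  show "x j * H a = H (aut D j a) * x j + H (der D j a)" if a: "a \<in> A" for a
  proof -
    have in_j: "a \<in> qna_sub D j" "aut D j a \<in> qna_sub D j" "der D j a \<in> qna_sub D j"
      using a A_subset bij_betwE[OF alg_iso_hom(2)[OF aut_iso[OF j]]] der_closed unfolding A_def by blast+
    have "gen D j * a = aut D j a * gen D j + der D j a" using a gen_mult by blast
    then have "H (gen D j * a) = H (aut D j a * gen D j + der D j a)" by simp
    then show ?thesis
      using in_j gj subalgebraD(8)[OF S] by (simp add: hom Hgj)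
  qed
  show "left_independent (H ` A) (x j)"
    unfolding left_independent_def
  proof (intro allI impI)
    fix n r i assume r: "(\<forall>i\<le>n. r i \<in> H ` A) \<and> (\<Sum>i\<le>n. r i * x j ^ i) = 0" and "i \<le> n"
    define t where "t i = inv_into A H (r i)" for i
    have t: "t i \<in> A \<and> r i = H (t i)" if "i \<le> n" for i
      using r that by (auto simp: t_def inv_into_into f_inv_into_f)
    then have t': "t i \<in> qna_sub D j" if "i \<le> n" for i using that A_subset by blast
    have "H (\<Sum>i\<le>n. t i * gen D j ^ i) = (\<Sum>i\<le>n. H (t i * gen D j ^ i))"
      by (rule algebra_hom_sum[OF H_hom S]) (use t' gj S in \<open>auto simp: subalgebraD subalgebra_power\<close>)
    also have "\<dots> = (\<Sum>i\<le>n. r i * x j ^ i)"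
    proof (rule sum.cong)
      fix i assume "i \<in> {..n}"
      then show "H (t i * gen D j ^ i) = r i * x j ^ i"
        using t t' gj S by (simp add: hom subalgebra_power algebra_hom_power[OF H_hom S] Hgj)
    qed simp
    finally have "H (\<Sum>i\<le>n. t i * gen D j ^ i) = H 0" using r algebra_hom_zero[OF H_hom S] by simp
    then have "(\<Sum>i\<le>n. t i * gen D j ^ i) = 0"
      by (rule inj_onD[OF H_inj])
        (use t' gj S in \<open>auto intro!: subalgebra_sum simp: subalgebraD subalgebra_power\<close>)
    then have "t i = 0" using ore_indep[of n t] t \<open>i \<le> n\<close> by blast
    then show "r i = 0" using t \<open>i \<le> n\<close> algebra_hom_zero[OF H_hom S] by simp
  qed
qed

abbreviation y where "y \<equiv> dd_step D j x"

lemma y_ge: "j \<le> l \<Longrightarrow> y l = x l"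
  by (simp add: dd_step_def)

text \<open>\<open>H\<close> witnesses the choice in \<open>dd_iso\<close>, and any admissible
  choice agrees with it on \<open>A\<close> because both are homomorphisms with the same values on
  the generators.\<close>

lemma dd_iso_eq: "a \<in> A \<Longrightarrow> dd_iso D j x a = H a"
proof -
  let ?P = "\<lambda>h. alg_iso s A (alg_span s (x ` {1..<j})) h \<and> (\<forall>i\<in>{1..<j}. h (gen D i) = x i)"
  have "?P H"
    using H_gen H_inj_A H_image by (auto intro!: alg_isoI H_hom_A simp: bij_betw_def)
  then have P: "?P (dd_iso D j x)" unfolding dd_iso_def A_def[symmetric] by (rule someI[of ?P])
  assume "a \<in> A"
  then show ?thesis
    unfolding A_eq
  proof (rule algebra_hom_eq_on_span[rotated 3])
    show "algebra_hom s s (alg_span s (gen D ` {1..<j})) (dd_iso D j x)"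
      "algebra_hom s s (alg_span s (gen D ` {1..<j})) H"
      using P alg_iso_hom(1) H_hom_A unfolding A_eq by blast+
  qed (use P H_gen in auto)
qed

lemma y_less:
  assumes l: "l \<in> {1..<j}"
  shows "y l = dd.\<Theta> (gen D l)"
proof -
  have gl: "gen D l \<in> A" using gen_in_A l by blast
  have inj: "inj_on (dd_iso D j x) A" using H_inj_A inj_on_cong[of A "dd_iso D j x" H] dd_iso_eq by blast
  have "inv_into A (dd_iso D j x) (x l) = gen D l"
    using inv_into_f_f[OF inj gl] dd_iso_eq[OF gl] H_gen[of l] l by auto
  then have "y l = Sum_any (\<lambda>n. s (dd.coef n)
      (dd_iso D j x (hder D j n ((dd.\<tau> ^^ n) (gen D l))) * inverse (x j) ^ n))"
    using l unfolding dd_step_def dd_transport_def A_def[symmetric] dd.coef_def dd.\<tau>_def by simp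
  then show ?thesis
    using dd_iso_eq gl dd.d_closed dd.tau_pow_closed by (simp add: dd.\<Theta>_def dd.dterm_def)
qed

lemma Theta_image: "dd.\<Theta> ` A = alg_span s (y ` {1..<j})"
proof -
  have "dd.\<Theta> ` gen D ` {1..<j} = y ` {1..<j}" using y_less by (force simp: image_iff)
  then show ?thesis
    using algebra_hom_image_span[where f = dd.\<Theta> and s' = s and Y = "gen D ` {1..<j}"] dd.Theta_hom k_algebra_axioms
    by (simp only: A_eq[symmetric])
qed

text \<open>For k > j the derivation has already been deleted, so x_k passes each generator up to a
  scalar. By multiplicativity, conjugation by x_k acts as \<sigma>_k on all of H(A_j).\<close>

lemma aut_commutes_H:
  assumes k: "k \<in> {j<..N}" and a: "a \<in> qna_sub D j"
  shows "aut D k a \<in> qna_sub D j \<and> x k * H a = H (aut D k a) * x k"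
proof -
  have k2: "k \<in> {2..N}" using k j by auto
  have sub: "qna_sub D j \<subseteq> qna_sub D (k - 1)" using k by (intro qna_sub_mono) auto
  let ?U = "alg_span s (gen D ` {1..j})"
  note ah = algebra_homD[OF algebra_hom_subset[OF alg_iso_hom(1)[OF aut_iso[OF k2]] sub], unfolded qna_sub_def]
  note S = subalgebraD[OF subalgebra_alg_span[of "gen D ` {1..j}"]]
  note hom = algebra_homD[OF H_hom, unfolded qna_sub_def]
  from a show ?thesis
    unfolding qna_sub_def
  proof (induction rule: alg_span_induct)
    case (gen g)
    then obtain l where l: "l \<in> {1..j}" "g = gen D l" by auto
    then have "aut D k g = s (lam D k l) g" using aut_gen[OF k2, of l] k by auto
    moreover have "g \<in> ?U" using gen alg_span_base by blast
    ultimately show ?case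
      using rel[OF k, of l] l H_gen[of l] k hom(3)[of g] S(7)[of g]
      by (simp add: scale_mult_left)
  next
    case one
    then show ?case using ah(4) hom(4) S(2) by simp
  next
    case (add a b)
    then show ?case using ah(1) hom(1) S(4) by (simp add: distrib_left distrib_right)
  next
    case (scale c a)
    then show ?case using ah(3) hom(3) S(7) by (simp add: scale_mult_left scale_mult_right)
  next
    case (mult a b)
    have "x k * H (a * b) = (x k * H a) * H b" using hom(2)[OF mult.hyps] by (simp only: mult.assoc)
    also have "\<dots> = H (aut D k a) * (x k * H b)" using mult.IH by (simp only: mult.assoc)
    also have "\<dots> = (H (aut D k a) * H (aut D k b)) * x k" using mult.IH by (simp only: mult.assoc)
    also have "\<dots> = H (aut D k (a * b)) * x k" using mult ah(2) hom(2) by simp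
    finally show ?case using mult ah(2) S(8) by simp
  qed
qed

lemma aut_hder_A: "k \<in> {j<..N} \<Longrightarrow> a \<in> A \<Longrightarrow>
    aut D k (hder D j n a) = s (lam D k j ^ n) (hder D j n (aut D k a))"
  using aut_hder[OF j, of k a n] unfolding A_def by simp

lemma tau_gen:
  assumes l: "l \<in> {1..<j}"
  shows "(dd.\<tau> ^^ n) (gen D l) = s (inverse (lam D j l) ^ n) (gen D l)"
proof (induction n)
  case (Suc n)
  have gl: "gen D l \<in> A" using gen_in_A l by blast
  have nz: "lam D j l \<noteq> 0" using l j by (intro lam_nonzero) auto
  have "dd.\<tau> (s (lam D j l) (gen D l)) = gen D l" using dd.tau(3)[OF gl] aut_gen[OF j l] by simp
  then have "s (lam D j l) (dd.\<tau> (gen D l)) = gen D l"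
    using algebra_homD(3)[OF dd.tau_hom gl] by simp
  then have "s (inverse (lam D j l)) (s (lam D j l) (dd.\<tau> (gen D l))) = s (inverse (lam D j l)) (gen D l)"
    by (rule arg_cong)
  then have "dd.\<tau> (gen D l) = s (inverse (lam D j l)) (gen D l)" using nz by simp
  then show ?case using Suc algebra_homD(3)[OF dd.tau_hom gl] by (simp add: mult.commute)
qed simp

text \<open>Checked term by term. Moving x_k past the value of d_(j,n) gives \<lambda>_(k,j)^n, by
  the compatibility of \<sigma>_k with d_(j,n); moving it past x_j^-n gives the inverse of that
  power, and only \<lambda>_(k,l) is left.\<close>

lemma y_rel_less:
  assumes k: "k \<in> {j<..N}" and l: "l \<in> {1..<j}"
  shows "x k * y l = s (lam D k l) (y l * x k)"
proof -
  have gl: "gen D l \<in> A" using gen_in_A l by blast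
  have k2: "k \<in> {2..N}" and l': "l \<in> {1..<k}" using k j l by auto
  let ?q = "lam D k j"
  have q: "?q \<noteq> 0" using k j by (intro lam_nonzero) auto
  have xj: "x k * inverse (x j) ^ n = s (inverse ?q ^ n) (inverse (x j) ^ n * x k)" for n
  proof -
    have "x k * x j ^ n = s (?q ^ n) (x j ^ n * x k)"
      using skew_commute_power[OF rel[OF k, of j], of 1 n] k j by simp
    then have "inverse (x j) ^ n * (x k * x j ^ n) * inverse (x j) ^ n
        = inverse (x j) ^ n * s (?q ^ n) (x j ^ n * x k) * inverse (x j) ^ n" by simp
    moreover have 1: "inverse (x j) ^ n * x j ^ n = 1" "x j ^ n * inverse (x j) ^ n = 1"
      using dd.x_nonzero by (simp_all add: power_inverse)
    have "inverse (x j) ^ n * (x k * x j ^ n) * inverse (x j) ^ n = inverse (x j) ^ n * x k"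
      using 1(2) by (simp add: mult.assoc)
    moreover have "inverse (x j) ^ n * s (?q ^ n) (x j ^ n * x k) * inverse (x j) ^ n
        = s (?q ^ n) (x k * inverse (x j) ^ n)"
      using 1(1) by (simp add: scale_mult_left scale_mult_right flip: mult.assoc)
    ultimately show ?thesis using q by (simp flip: power_mult_distrib)
  qed
  have summand: "x k * dd.dterm n (gen D l) = s (lam D k l) (dd.dterm n (gen D l) * x k)" for n
  proof -
    let ?b = "(dd.\<tau> ^^ n) (gen D l)"
    have b: "?b \<in> A" using dd.tau_pow_closed gl by blast
    then have db: "hder D j n ?b \<in> A" using dd.d_closed by blast
    have "aut D k ?b = s (lam D k l) ?b"
      using algebra_homD(3)[OF alg_iso_hom(1)[OF aut_iso[OF k2]], of "gen D l"]
        gen_in_qna_sub[of l "k - 1"] l' aut_gen[OF k2 l'] tau_gen[OF l]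
      by (auto simp: mult.commute)
    then have "aut D k (hder D j n ?b) = s (?q ^ n * lam D k l) (hder D j n ?b)"
      using aut_hder_A[OF k b, of n] dd.d_scale[OF b] by simp
    then have "x k * H (hder D j n ?b) = s (?q ^ n * lam D k l) (H (hder D j n ?b) * x k)"
      using aut_commutes_H[OF k, of "hder D j n ?b"] db A_subset algebra_homD(3)[OF H_hom_A db]
      by (auto simp: scale_mult_left)
    then have "x k * dd.dterm n (gen D l)
        = s (dd.coef n * (?q ^ n * lam D k l)) (H (hder D j n ?b) * (x k * inverse (x j) ^ n))"
      by (simp add: dd.dterm_def scale_mult_right scale_mult_left flip: mult.assoc)
    also have "\<dots> = s (dd.coef n * (?q ^ n * lam D k l) * inverse ?q ^ n)
        (H (hder D j n ?b) * (inverse (x j) ^ n * x k))"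
      by (simp only: xj scale_mult_right scale_scale)
    also have "dd.coef n * (?q ^ n * lam D k l) * inverse ?q ^ n = lam D k l * dd.coef n"
      using q by (simp add: field_simps)
    finally show ?thesis
      by (simp only: dd.dterm_def scale_mult_left scale_scale mult.assoc)
  qed
  obtain M where "\<forall>n\<ge>M. hder D j n (gen D l) = 0" using dd.d_bound gl by blast
  then have "y l = (\<Sum>n<M. dd.dterm n (gen D l))" using y_less[OF l] dd.Theta_eq_sum[OF gl] by simp
  then show ?thesis by (simp add: sum_distrib_left sum_distrib_right scale_sum_right summand)
qed

lemma y_rel:
  assumes k: "k \<in> {j..N}" and l: "l \<in> {1..<k}"
  shows "y k * y l = s (lam D k l) (y l * y k)"
proof (cases "l < j")
  case False
  then show ?thesis using rel[of k l] k l by (simp add: y_ge)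
next
  case True
  then have l': "l \<in> {1..<j}" using l by auto
  show ?thesis
  proof (cases "k = j")
    case True
    have gl: "gen D l \<in> A" using gen_in_A l' by blast
    show ?thesis
      using dd.x_Theta[OF gl] aut_gen[OF j l'] dd.Theta_scale[OF gl] True
      by (simp add: y_ge y_less[OF l'] scale_mult_left)
  next
    case False
    then show ?thesis using y_rel_less[of k l] k l' by (simp add: y_ge)
  qed
qed

lemma xj_y:
  assumes l: "l \<in> {1..N}"
  shows "\<exists>c. c \<noteq> 0 \<and> x j * y l = s c (y l * x j)"
proof (cases "l \<le> j")
  case True
  show ?thesis
  proof (cases "l = j")
    case True
    then show ?thesis by (intro exI[of _ 1]) (simp add: y_ge)
  next
    case False
    then have "x j * y l = s (lam D j l) (y l * x j)"
      using y_rel[of j l] \<open>l \<le> j\<close> l j by (simp add: y_ge)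
    then show ?thesis using lam_nonzero[of j l] l j by auto
  qed
next
  case False
  then have "x l * x j = s (lam D l j) (x j * x l)" using rel[of l j] l j by simp
  then have "x j * y l = s (inverse (lam D l j)) (y l * x j)"
    using skew_commute_sym lam_nonzero[of l j] l j False by (simp add: y_ge)
  then show ?thesis using lam_nonzero[of l j] l j by (intro exI[of _ "inverse (lam D l j)"]) auto
qed

lemma y_in_fractions_by:
  assumes "l \<in> {1..<k}" "j < k" "k \<le> Suc N"
  shows "y l \<in> fractions_by (x j) (alg_span s (x ` {1..<k}))"
proof (cases "l < j")
  case True
  have "H ` A \<subseteq> alg_span s (x ` {1..<k})"
    unfolding H_image using assms by (intro alg_span_mono) auto
  then show ?thesis
    using dd.Theta_in_fractions_by[of "alg_span s (x ` {1..<k})" "gen D l"] subalgebra_alg_span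
      y_less[of l] True assms j alg_span_base[of "x j" "x ` {1..<k}"] gen_in_A[of l]
    by auto
next
  case False
  then show ?thesis
    using assms fractions_by_base alg_span_base[of "x l" "x ` {1..<k}"] by (auto simp: y_ge)
qed

text \<open>All initial segments beyond \<open>j\<close> are covered, since \<open>y_indep\<close>
  has to clear denominators among the coefficients generated below \<open>k\<close>.\<close>

lemma y_span_subset:
  assumes "j < k" "k \<le> Suc N"
  shows "alg_span s (y ` {1..<k}) \<subseteq> fractions_by (x j) (alg_span s (x ` {1..<k}))"
proof (rule span_subset_fractions_by[OF subalgebra_alg_span])
  show "x j \<in> alg_span s (x ` {1..<k})" using assms j by (intro alg_span_base) auto
  show "v \<in> fractions_by (x j) (alg_span s (x ` {1..<k}))" if "v \<in> y ` {1..<k}" for v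
    using that y_in_fractions_by assms by auto
  show "\<exists>c. c \<noteq> 0 \<and> x j * v = s c (v * x j)" if "v \<in> y ` {1..<k}" for v
    using that xj_y assms by auto
qed

text \<open>In the new algebra x_j skew-commutes with every generator and is therefore normal. So
  here the fractions do form an algebra, and only the old generators have to be placed in
  it.\<close>

lemma x_span_subset:
  "alg_span s (x ` {1..<Suc N}) \<subseteq> fractions_by (x j) (alg_span s (y ` {1..<Suc N}))"
proof (rule alg_span_least)
  let ?U = "alg_span s (y ` {1..<Suc N})"
  have "y j \<in> y ` {1..<Suc N}" using j by auto
  then have xj: "x j \<in> ?U" using y_ge[of j] alg_span_base by simp
  show "subalgebra s (fractions_by (x j) ?U)"
  proof (rule subalgebra_fractions_by[OF subalgebra_alg_span xj])
    show "\<exists>u'\<in>?U. u * x j = x j * u'" if "u \<in> ?U" for u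
      by (rule skew_normal_span[OF _ that]) (use xj_y in auto)
  qed
  have "x l \<in> fractions_by (x j) ?U" if l: "l \<in> {1..<Suc N}" for l
  proof (cases "l < j")
    case True
    have "dd.\<Theta> ` A \<subseteq> ?U" unfolding Theta_image using j by (intro alg_span_mono) auto
    then show ?thesis
      using dd.h_in_fractions_by[OF subalgebra_alg_span xj, of "gen D l"] H_gen[of l] True l
        gen_in_A[of l] by auto
  next
    case False
    then have "x l = y l" by (simp add: y_ge)
    moreover have "y l \<in> ?U" using l by (intro alg_span_base) auto
    ultimately show ?thesis using fractions_by_base by auto
  qed
  then show "x ` {1..<Suc N} \<subseteq> fractions_by (x j) ?U" by auto
qed

text \<open>Freeness for k = j is the leading-term result. For k > j the coefficients have a common
  denominator x_j^M, which passes y_k^i up to a scalar, and the relation becomes one over the old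
  algebra.\<close>

lemma y_indep:
  assumes k: "k \<in> {j..N}"
  shows "left_independent (alg_span s (y ` {1..<k})) (y k)"
proof (cases "k = j")
  case True
  then show ?thesis using dd.Theta_left_independent Theta_image by (simp add: y_ge)
next
  case False
  then have k': "k \<in> {j<..N}" using k by auto
  let ?U = "alg_span s (x ` {1..<k})"
  have xj: "x j \<in> ?U" using k' j by (intro alg_span_base) auto
  show ?thesis
    unfolding left_independent_def
  proof (intro allI impI)
    fix n r i assume r: "(\<forall>i\<le>n. r i \<in> alg_span s (y ` {1..<k})) \<and> (\<Sum>i\<le>n. r i * y k ^ i) = 0"
      and i: "i \<le> n"
    then have "\<forall>i\<le>n. r i \<in> fractions_by (x j) ?U" using y_span_subset[of k] k' by auto
    then have "\<forall>i. \<exists>m. i \<le> n \<longrightarrow> r i * x j ^ m \<in> ?U" by (auto simp: fractions_by_def)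
    then obtain m where m: "\<And>i. i \<le> n \<Longrightarrow> r i * x j ^ m i \<in> ?U" by metis
    define M where "M = Max (m ` {..n})"
    have M: "r i * x j ^ M \<in> ?U" if "i \<le> n" for i
      using that by (intro fractions_by_common[OF subalgebra_alg_span xj m]) (auto simp: M_def)
    let ?c = "lam D k j"
    \<comment> \<open>The scalar is the cost of carrying x_j^M through x_k^i.\<close>
    define t where "t i = s (?c ^ (i * M)) (r i * x j ^ M)" for i
    have "t i = 0"
    proof (rule left_independentD[OF indep[OF k'] _ _ i])
      show "t i \<in> ?U" if "i \<le> n" for i
        using M[OF that] by (simp add: t_def subalgebraD(7)[OF subalgebra_alg_span])
      have "t i * x k ^ i = r i * x k ^ i * x j ^ M" for i
        using skew_commute_power[OF rel[OF k', of j], of i M] k' j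
        by (simp add: t_def scale_mult_left scale_mult_right mult.assoc)
      then have "(\<Sum>i\<le>n. t i * x k ^ i) = (\<Sum>i\<le>n. r i * y k ^ i) * x j ^ M"
        using k' by (simp add: y_ge sum_distrib_right)
      then show "(\<Sum>i\<le>n. t i * x k ^ i) = 0" using r by simp
    qed
    then show "r i = 0"
      using lam_nonzero[of k j] k' j dd.x_nonzero by (auto simp: t_def)
  qed
qed

end

section \<open>Homomorphisms modulo an ideal\<close>

text \<open>A linear lift of an algebra homomorphism into U / J: only products are taken modulo
  \<open>J\<close>. Values remain elements of the ambient ring, so they can be defined through sums
  and coefficients and not through cosets.\<close>

definition hom_modulo ::
    "('k::field \<Rightarrow> 'a::ring_1 \<Rightarrow> 'a) \<Rightarrow> 'a set \<Rightarrow> 'a set \<Rightarrow> 'a set \<Rightarrow> ('a \<Rightarrow> 'a) \<Rightarrow> bool" where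
  "hom_modulo s J R U f \<longleftrightarrow>
     f ` R \<subseteq> U \<and> (\<forall>x\<in>R. \<forall>y\<in>R. f (x + y) = f x + f y) \<and> (\<forall>c. \<forall>x\<in>R. f (s c x) = s c (f x)) \<and>
     f 1 = 1 \<and> (\<forall>x\<in>R. \<forall>y\<in>R. f (x * y) - f x * f y \<in> J)"

context k_algebra
begin

lemma ideal_subspace:
  assumes "ideal J (as_ring U)" "subalgebra scale U"
  shows "subspace J"
proof (rule subspaceI)
  show "0 \<in> J" by (rule ideal_as_ringD(2)[OF assms(1)])
  show "x + y \<in> J" if "x \<in> J" "y \<in> J" for x y using ideal_as_ringD(3)[OF assms(1)] that by blast
  show "scale c x \<in> J" if "x \<in> J" for c x
  proof -
    have "scale c 1 * x \<in> J"
      using ideal_as_ringD(4)[OF assms(1)] subalgebraD(2,7)[OF assms(2)] that by blast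
    then show ?thesis by (simp add: scale_mult_left)
  qed
qed

text \<open>Freeness of R[z] allows a linear extension with \<open>z\<close> sent to
  \<open>zz\<close>; the skew relations make it multiplicative modulo \<open>J\<close>. It is enough
  to test right multiplication by \<open>z\<close> and by the generators in
  \<open>Y\<close>.\<close>

lemma hom_modulo_extend:
  fixes Y z
  defines "R \<equiv> alg_span scale Y"
  assumes U: "subalgebra scale U" and J: "ideal J (as_ring U)"
    and f: "hom_modulo scale J R U f"
    and indep: "left_independent R z"
    and zz: "zz \<in> U"
    and comm: "\<And>y. y \<in> Y \<Longrightarrow> \<exists>c. z * y = scale c (y * z) \<and> zz * f y - scale c (f y * zz) \<in> J"
  shows "\<exists>F. hom_modulo scale J (alg_span scale (insert z Y)) U F \<and> F z = zz \<and> (\<forall>a\<in>R. F a = f a)"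
proof -
  note Rc = subalgebraD[OF subalgebra_alg_span[of Y], folded R_def]
  note Uc = subalgebraD[OF U]
  note Jl = ideal_as_ringD(4)[OF J] and Jr = ideal_as_ringD(5)[OF J]
  note Js = ideal_subspace[OF J U]
  have fU: "f a \<in> U" if "a \<in> R" for a using f that by (auto simp: hom_modulo_def)
  have fadd: "f (a + b) = f a + f b" if "a \<in> R" "b \<in> R" for a b using f that by (auto simp: hom_modulo_def)
  have fscale: "f (scale c a) = scale c (f a)" if "a \<in> R" for c a using f that by (auto simp: hom_modulo_def)
  have f1: "f 1 = 1" using f by (simp add: hom_modulo_def)
  have fmult: "f (a * b) - f a * f b \<in> J" if "a \<in> R" "b \<in> R" for a b using f that by (auto simp: hom_modulo_def)
  have f0: "f 0 = 0" using fadd[of 0 0] Rc(3) by simp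
  define ev where "ev n r = (\<Sum>i\<le>n. r i * z ^ i)" for n :: nat and r
  define evf where "evf n r = (\<Sum>i\<le>n. f (r i) * zz ^ i)" for n :: nat and r
  \<comment> \<open>Coefficients vanish beyond \<open>n\<close>, so two expressions can be compared
    after padding to a common length.\<close>
  define coeffs where "coeffs n r \<longleftrightarrow> (\<forall>i. r i \<in> R) \<and> (\<forall>i>n. r i = 0)" for n :: nat and r
  define F where "F w = (THE v. \<exists>n r. coeffs n r \<and> w = ev n r \<and> v = evf n r)" for w
  define S where "S = {ev n r | n r. coeffs n r}"
  have ev_mono: "ev m r = ev n r" "evf m r = evf n r" "coeffs m r" if "coeffs n r" "n \<le> m" for n m r
    using that f0 unfolding ev_def evf_def coeffs_def
    by (auto intro!: sum.mono_neutral_right simp: not_le[symmetric] simp del: not_le)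
  have F_ev: "F (ev n r) = evf n r" if "coeffs n r" for n r
    unfolding F_def
  proof (rule the_equality)
    show "\<exists>m t. coeffs m t \<and> ev n r = ev m t \<and> evf n r = evf m t" using that by blast
    fix v assume "\<exists>m t. coeffs m t \<and> ev n r = ev m t \<and> v = evf m t"
    then obtain m t where t: "coeffs m t" "ev n r = ev m t" "v = evf m t" by blast
    let ?k = "max n m"
    have "ev ?k r = ev ?k t" using ev_mono(1)[OF that, of ?k] ev_mono(1)[OF t(1), of ?k] t(2) by simp
    then have "(\<Sum>i\<le>?k. (r i - t i) * z ^ i) = 0"
      by (simp add: ev_def left_diff_distrib sum_subtractf)
    then have "r i - t i = 0" if "i \<le> ?k" for i
      using left_independentD[OF indep, of ?k "\<lambda>i. r i - t i" i] that \<open>coeffs n r\<close> t(1) Rc(5)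
      by (simp add: coeffs_def)
    then have "evf ?k r = evf ?k t" by (simp add: evf_def)
    then show "v = evf n r" using ev_mono(2)[OF that, of ?k] ev_mono(2)[OF t(1), of ?k] t(3) by simp
  qed
  have S_cases: thesis if "a \<in> S" "\<And>n r. coeffs n r \<Longrightarrow> a = ev n r \<Longrightarrow> F a = evf n r \<Longrightarrow> thesis"
    for a thesis using that F_ev by (auto simp: S_def)
  have S_I: "ev n r \<in> S" if "coeffs n r" for n r using that by (auto simp: S_def)
  have coeffs_add: "coeffs n (\<lambda>i. r i + t i)" if "coeffs n r" "coeffs n t" for n r t
    using that Rc(4) by (auto simp: coeffs_def)
  have coeffs_scale: "coeffs n (\<lambda>i. scale c (r i))" if "coeffs n r" for n r c
    using that Rc(7) by (auto simp: coeffs_def)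
  have F_add: "a + b \<in> S \<and> F (a + b) = F a + F b" if ab: "a \<in> S" "b \<in> S" for a b
  proof -
    obtain n r where r: "coeffs n r" "a = ev n r" "F a = evf n r" by (rule S_cases[OF ab(1)])
    obtain m t where t: "coeffs m t" "b = ev m t" "F b = evf m t" by (rule S_cases[OF ab(2)])
    let ?k = "max n m"
    note r' = ev_mono[OF r(1), of ?k] and t' = ev_mono[OF t(1), of ?k]
    have "a + b = ev ?k (\<lambda>i. r i + t i)"
      using r(2) r'(1) t(2) t'(1) by (simp add: ev_def distrib_right sum.distrib)
    moreover have "F a + F b = evf ?k (\<lambda>i. r i + t i)"
      using r(1,3) r'(2) t(1,3) t'(2) by (simp add: evf_def coeffs_def fadd distrib_right sum.distrib)
    moreover have "coeffs ?k (\<lambda>i. r i + t i)" using coeffs_add r'(3) t'(3) by simp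
    ultimately show ?thesis by (simp add: F_ev S_I)
  qed
  have F_scale: "scale c a \<in> S \<and> F (scale c a) = scale c (F a)" if a: "a \<in> S" for a c
  proof -
    obtain n r where r: "coeffs n r" "a = ev n r" "F a = evf n r" by (rule S_cases[OF a])
    have "scale c a = ev n (\<lambda>i. scale c (r i))"
      using r(2) by (simp add: ev_def scale_mult_left scale_sum_right)
    moreover have "scale c (F a) = evf n (\<lambda>i. scale c (r i))"
      using r(1,3) by (simp add: evf_def coeffs_def fscale scale_mult_left scale_sum_right)
    ultimately show ?thesis by (simp add: F_ev S_I coeffs_scale[OF r(1)])
  qed
  have F_U: "F a \<in> U" if a: "a \<in> S" for a
  proof -
    obtain n r where r: "coeffs n r" "a = ev n r" "F a = evf n r" by (rule S_cases[OF a])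
    have "f (r i) * zz ^ i \<in> U" for i
      using Uc(8) fU r(1) subalgebra_power[OF U zz] by (auto simp: coeffs_def)
    then have "evf n r \<in> U" unfolding evf_def by (rule subalgebra_sum[OF U])
    then show ?thesis using r(3) by simp
  qed
  have F_R: "a \<in> S \<and> F a = f a" if "a \<in> R" for a
  proof -
    have "coeffs 0 (\<lambda>i. if i = 0 then a else 0)" using that Rc(3) by (auto simp: coeffs_def)
    then show ?thesis using F_ev[of 0] S_I[of 0] by (fastforce simp: ev_def evf_def)
  qed
  have F_1: "1 \<in> S" "F 1 = 1" using F_R[OF Rc(2)] f1 by auto
  have S_subspace: "subspace S"
    using F_add F_scale F_R[OF Rc(3)] by (intro subspaceI) auto
  have F_mult_z: "a * z \<in> S \<and> F (a * z) = F a * zz" if a: "a \<in> S" for a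
  proof -
    obtain n r where r: "coeffs n r" "a = ev n r" "F a = evf n r" by (rule S_cases[OF a])
    define t where "t i = (case i of 0 \<Rightarrow> 0 | Suc i \<Rightarrow> r i)" for i
    have t: "coeffs (Suc n) t" using r(1) Rc(3) by (auto simp: coeffs_def t_def split: nat.split)
    have "ev (Suc n) t = a * z"
      using r(2) by (simp only: ev_def sum.atMost_Suc_shift)
        (simp add: t_def sum_distrib_right power_Suc2 mult.assoc del: power_Suc)
    moreover have "evf (Suc n) t = F a * zz"
      using r(3) by (simp only: evf_def sum.atMost_Suc_shift)
        (simp add: t_def f0 sum_distrib_right power_Suc2 mult.assoc del: power_Suc)
    ultimately show ?thesis using F_ev[OF t] S_I[OF t] by simp
  qed
  have zz_pow: "zz ^ i * f y - scale (c ^ i) (f y * zz ^ i) \<in> J"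
    if "zz * f y - scale c (f y * zz) \<in> J" "y \<in> R" for y c i
  proof (induction i)
    case 0 then show ?case using subspace_0[OF Js] by simp
  next
    case (Suc i)
    have "zz ^ Suc i * f y - scale (c ^ Suc i) (f y * zz ^ Suc i)
      = zz * (zz ^ i * f y - scale (c ^ i) (f y * zz ^ i))
        + scale (c ^ i) ((zz * f y - scale c (f y * zz)) * zz ^ i)"
      by (simp add: algebra_simps scale_mult_left scale_mult_right scale_right_diff_distrib)
    then show ?case
      using Suc that Jl[OF zz] Jr[OF that(1) subalgebra_power[OF U zz]]
      by (simp add: subspace_add[OF Js] subspace_scale[OF Js])
  qed
  have F_mult_y: "a * y \<in> S \<and> F (a * y) - F a * f y \<in> J" if a: "a \<in> S" and y: "y \<in> Y" for a y
  proof -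
    obtain n r where r: "coeffs n r" "a = ev n r" "F a = evf n r" by (rule S_cases[OF a])
    then have rR: "r i \<in> R" for i by (simp add: coeffs_def)
    obtain c where c: "z * y = scale c (y * z)" "zz * f y - scale c (f y * zz) \<in> J" using comm y by blast
    have yR: "y \<in> R" using y alg_span_base by (simp add: R_def)
    define t where "t i = scale (c ^ i) (r i * y)" for i
    have t: "coeffs n t" using r(1) Rc(7,8) yR by (auto simp: coeffs_def t_def)
    have eq: "a * y = ev n t"
      using r(2) skew_commute_power[OF c(1), of _ 1]
      by (simp add: ev_def t_def sum_distrib_right mult.assoc scale_mult_left scale_mult_right)
    have "F (a * y) - F a * f y = (\<Sum>i\<le>n. scale (c ^ i) ((f (r i * y) - f (r i) * f y) * zz ^ i)
        - f (r i) * (zz ^ i * f y - scale (c ^ i) (f y * zz ^ i)))"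
      using F_ev[OF t] eq r(3) rR yR Rc(8)
      by (simp add: evf_def t_def fscale sum_distrib_right sum_subtractf[symmetric] left_diff_distrib
          right_diff_distrib scale_mult_left scale_mult_right scale_right_diff_distrib mult.assoc)
    moreover have "\<dots> \<in> J"
      using Jr[OF fmult[OF rR yR] subalgebra_power[OF U zz]] Jl[OF fU[OF rR] zz_pow[OF c(2) yR]]
      by (intro subspace_sum[OF Js] subspace_diff[OF Js] subspace_scale[OF Js])
    ultimately show ?thesis using S_I[OF t] eq by simp
  qed
  let ?T = "alg_span scale (insert z Y)"
  have T_S: "?T \<subseteq> S"
    by (rule alg_span_right_closed[OF S_subspace F_1(1)]) (use F_mult_z F_mult_y in auto)
  note Tc = subalgebraD[OF subalgebra_alg_span[of "insert z Y"]]
  have S_T: "S \<subseteq> ?T"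
  proof
    fix a assume "a \<in> S"
    then obtain n r where r: "coeffs n r" "a = ev n r" by (rule S_cases)
    have "R \<subseteq> ?T" unfolding R_def by (rule alg_span_mono) auto
    then have "r i \<in> ?T" for i using r(1) by (auto simp: coeffs_def)
    moreover have "z ^ i \<in> ?T" for i by (simp add: subalgebra_power[OF subalgebra_alg_span] alg_span_base)
    ultimately have "r i * z ^ i \<in> ?T" for i by (rule Tc(8))
    then have "ev n r \<in> ?T" unfolding ev_def by (rule subalgebra_sum[OF subalgebra_alg_span])
    then show "a \<in> ?T" using r(2) by simp
  qed
  then have T: "?T = S" using T_S by auto
  have F_z: "F z = zz" using F_mult_z[OF F_1(1)] F_1(2) by simp
  \<comment> \<open>The left factor ranges over all of \<open>S\<close>, as \<open>a * b\<close>
    becomes a left factor in the product case.\<close>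
  have "\<forall>a\<in>S. F (a * b) - F a * F b \<in> J" if "b \<in> ?T" for b
    using that
  proof (induction rule: alg_span_induct)
    case (gen b)
    then show ?case
    proof
      assume "b = z" then show ?thesis using F_mult_z F_z subspace_0[OF Js] by simp
    next
      assume "b \<in> Y" then show ?thesis using F_mult_y F_R alg_span_base by (simp add: R_def)
    qed
  next
    case one
    then show ?case using F_1 subspace_0[OF Js] by simp
  next
    case (add b b')
    show ?case
    proof
      fix a assume a: "a \<in> S"
      then have "a * b \<in> S" "a * b' \<in> S" using add Tc(8) T by auto
      then have "F (a * (b + b')) - F a * F (b + b') = (F (a * b) - F a * F b) + (F (a * b') - F a * F b')"
        using F_add add T by (simp add: distrib_left)
      then show "F (a * (b + b')) - F a * F (b + b') \<in> J"
        using add a subspace_add[OF Js] by simp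
    qed
  next
    case (scale c b)
    show ?case
    proof
      fix a assume a: "a \<in> S"
      then have "a * b \<in> S" using scale Tc(8) T by auto
      then have "F (a * scale c b) - F a * F (scale c b) = scale c (F (a * b) - F a * F b)"
        using F_scale scale T by (simp add: scale_mult_right scale_right_diff_distrib)
      then show "F (a * scale c b) - F a * F (scale c b) \<in> J"
        using scale a subspace_scale[OF Js] by simp
    qed
  next
    case (mult b b')
    show ?case
    proof
      fix a assume a: "a \<in> S"
      have S: "a * b \<in> S" "b \<in> S" "b' \<in> S" using a mult Tc(8) T by auto
      have "F (a * (b * b')) - F a * F (b * b') = (F (a * b * b') - F (a * b) * F b')
          + (F (a * b) - F a * F b) * F b' - F a * (F (b * b') - F b * F b')"
        by (simp add: algebra_simps)
      then show "F (a * (b * b')) - F a * F (b * b') \<in> J"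
        using mult.IH a S Jr[OF _ F_U[OF S(3)]] Jl[OF F_U[OF a]]
        by (simp add: subspace_add[OF Js] subspace_diff[OF Js])
    qed
  qed
  then have "hom_modulo scale J ?T U F"
    unfolding hom_modulo_def T using F_U F_add F_scale F_1(2) by auto
  then show ?thesis using F_z F_R by blast
qed

end

section \<open>Existence of the quotient maps\<close>

context dd_stage
begin

abbreviation "Ax \<equiv> alg_span s (x ` {1..N})"
abbreviation "Ay \<equiv> alg_span s (y ` {1..N})"

text \<open>On the first j - 1 generators H \<circ> \<Theta>^-1 is an exact homomorphism; y_j, ...,
  y_N are then adjoined one at a time by freeness.\<close>

lemma exists_hom_modulo:
  assumes J: "ideal J (as_ring Ax)" and xj: "x j \<in> J" and "j \<le> k" "k \<le> Suc N"
  shows "\<exists>f. hom_modulo s J (alg_span s (y ` {1..<k})) Ax f \<and> (\<forall>i\<in>{1..<k}. f (y i) = x i)"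
  using assms(3,4)
proof (induction k rule: dec_induct)
  case base
  define f where "f = H \<circ> inv_into A dd.\<Theta>"
  have f_Theta: "f (dd.\<Theta> a) = H a" if "a \<in> A" for a
    using that inv_into_f_f[OF dd.Theta_inj] by (simp add: f_def)
  note hom = algebra_homD[OF H_hom_A]
  note Theta_hom = algebra_homD[OF dd.Theta_hom, symmetric]
  have "hom_modulo s J (dd.\<Theta> ` A) Ax f"
    unfolding hom_modulo_def
  proof (intro conjI)
    have "H ` A \<subseteq> Ax" unfolding H_image using j by (intro alg_span_mono) auto
    then show "f ` dd.\<Theta> ` A \<subseteq> Ax" using f_Theta by auto
    show "\<forall>x\<in>dd.\<Theta> ` A. \<forall>y\<in>dd.\<Theta> ` A. f (x + y) = f x + f y"
      by (auto simp: Theta_hom(1) f_Theta hom dd.A_closed)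
    show "\<forall>c. \<forall>x\<in>dd.\<Theta> ` A. f (s c x) = s c (f x)"
      by (auto simp: Theta_hom(3) f_Theta hom dd.A_closed)
    show "f 1 = 1" using f_Theta[of 1] hom(4) Theta_hom(4) dd.A_closed(2) by simp
    show "\<forall>x\<in>dd.\<Theta> ` A. \<forall>y\<in>dd.\<Theta> ` A. f (x * y) - f x * f y \<in> J"
      using ideal_as_ringD(2)[OF J] by (auto simp: Theta_hom(2) f_Theta hom dd.A_closed)
  qed
  moreover have "f (y i) = x i" if "i \<in> {1..<j}" for i
    using f_Theta gen_in_A y_less H_gen that by auto
  ultimately show ?case unfolding Theta_image by blast
next
  case (step k)
  then obtain f where f: "hom_modulo s J (alg_span s (y ` {1..<k})) Ax f" "\<forall>i\<in>{1..<k}. f (y i) = x i"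
    by auto
  have k: "k \<in> {j..N}" using step by auto
  have xAx: "x i \<in> Ax" if "i \<in> {1..N}" for i using that by (intro alg_span_base) auto
  have "\<exists>F. hom_modulo s J (alg_span s (insert (y k) (y ` {1..<k}))) Ax F \<and> F (y k) = x k
      \<and> (\<forall>a\<in>alg_span s (y ` {1..<k}). F a = f a)"
  proof (rule hom_modulo_extend[OF subalgebra_alg_span J f(1) y_indep[OF k]])
    show "x k \<in> Ax" using k j by (intro xAx) auto
    fix v assume "v \<in> y ` {1..<k}"
    then obtain i where i: "i \<in> {1..<k}" "v = y i" by auto
    have "x k * x i - s (lam D k i) (x i * x k) \<in> J"
    \<comment> \<open>Only for k = j can the old generators fail to skew-commute; there both
      products lie in \<open>J\<close> because x_j does.\<close>
    proof (cases "k = j")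
      case True
      then show ?thesis
        using xj i k ideal_as_ringD(4)[OF J xAx xj, of i] ideal_as_ringD(5)[OF J xj xAx, of i] j
          ideal_subspace[OF J subalgebra_alg_span]
        by (auto intro!: subspace_diff subspace_scale)
    next
      case False
      then have "x k * x i = s (lam D k i) (x i * x k)" using rel[of k i] k i by auto
      then show ?thesis using ideal_as_ringD(2)[OF J] by simp
    qed
    then show "\<exists>c. y k * v = s c (v * y k) \<and> x k * f v - s c (f v * x k) \<in> J"
      using y_rel[OF k i(1)] f(2) i by auto
  qed
  then obtain F where F: "hom_modulo s J (alg_span s (insert (y k) (y ` {1..<k}))) Ax F" "F (y k) = x k"
      "\<forall>a\<in>alg_span s (y ` {1..<k}). F a = f a" by blast
  have "{1..<Suc k} = insert k {1..<k}" using k j by auto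
  then have "y ` {1..<Suc k} = insert (y k) (y ` {1..<k})" by simp
  moreover have "F (y i) = x i" if "i \<in> {1..<Suc k}" for i
    using that F(2,3) f(2) alg_span_base[of "y i" "y ` {1..<k}"] by (cases "i = k") auto
  ultimately show ?case using F(1) by metis
qed

lemma exists_quotient_map:
  assumes J: "ideal J (as_ring Ax)" and xj: "x j \<in> J"
  shows "\<exists>g. g \<in> ring_hom (as_ring Ay) (as_ring Ax Quot J) \<and>
      (\<forall>c. g (s c 1) = J +>\<^bsub>as_ring Ax\<^esub> s c 1) \<and>
      (\<forall>i\<in>{1..N}. g (y i) = J +>\<^bsub>as_ring Ax\<^esub> x i)"
proof -
  obtain f where f: "hom_modulo s J Ay Ax f" "\<forall>i\<in>{1..N}. f (y i) = x i"
    using exists_hom_modulo[OF J xj, of "Suc N"] j by (auto simp: atLeastLessThanSuc_atLeastAtMost)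
  let ?g = "\<lambda>a. J +>\<^bsub>as_ring Ax\<^esub> f a"
  note c = ideal.rcos_ring_hom[OF J]
  note Ay = subalgebraD[OF subalgebra_alg_span[of "y ` {1..N}"]]
  have fAx: "f a \<in> Ax" if "a \<in> Ay" for a using f(1) that by (auto simp: hom_modulo_def)
  have eq: "J +>\<^bsub>as_ring Ax\<^esub> a = J +>\<^bsub>as_ring Ax\<^esub> b" if "a - b \<in> J" for a b
  proof -
    have "b - a \<in> J" using subspace_neg[OF ideal_subspace[OF J subalgebra_alg_span] that] by simp
    then have "i + a \<in> (\<lambda>i. i + b) ` J" "i + b \<in> (\<lambda>i. i + a) ` J" if "i \<in> J" for i
      using that \<open>a - b \<in> J\<close> ideal_as_ringD(3)[OF J]
      by (auto intro: image_eqI[of _ _ "i + (a - b)"] image_eqI[of _ _ "i + (b - a)"])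
    then show ?thesis unfolding coset_as_ring by blast
  qed
  have "?g \<in> ring_hom (as_ring Ay) (as_ring Ax Quot J)"
  proof (rule ring_hom_memI)
    fix a b assume "a \<in> carrier (as_ring Ay)" "b \<in> carrier (as_ring Ay)"
    then have ab: "a \<in> Ay" "b \<in> Ay" by auto
    show "?g a \<in> carrier (as_ring Ax Quot J)"
      using ring_hom_closed[OF c] fAx ab by simp
    show "?g (a \<oplus>\<^bsub>as_ring Ay\<^esub> b) = ?g a \<oplus>\<^bsub>as_ring Ax Quot J\<^esub> ?g b"
      using ring_hom_add[OF c, of "f a" "f b"] fAx ab f(1) by (simp add: hom_modulo_def)
    have "J +>\<^bsub>as_ring Ax\<^esub> f (a * b) = J +>\<^bsub>as_ring Ax\<^esub> (f a * f b)"
      using f(1) ab by (intro eq) (simp add: hom_modulo_def)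
    then show "?g (a \<otimes>\<^bsub>as_ring Ay\<^esub> b) = ?g a \<otimes>\<^bsub>as_ring Ax Quot J\<^esub> ?g b"
      using ring_hom_mult[OF c, of "f a" "f b"] fAx ab by simp
  next
    show "?g \<one>\<^bsub>as_ring Ay\<^esub> = \<one>\<^bsub>as_ring Ax Quot J\<^esub>"
      using ring_hom_one[OF c] f(1) by (simp add: hom_modulo_def)
  qed
  moreover have "f (s c 1) = s c 1" for c
    using f(1) Ay(2) by (simp add: hom_modulo_def)
  ultimately show ?thesis using f(2) by (intro exI[of _ ?g]) auto
qed

end

section \<open>All stages of the algorithm\<close>

context qna
begin

text \<open>The invariant of the downward induction for X^(j): the derivations from index
  \<open>j\<close> on are gone, those below it are kept inside A_(j-1). Stage \<open>j\<close>
  starts from \<open>presented (Suc j)\<close>; for j = N + 1 the last two clauses are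
  empty.\<close>

definition presented :: "nat \<Rightarrow> (nat \<Rightarrow> 'a) \<Rightarrow> bool" where
  "presented j x \<longleftrightarrow>
     (\<exists>H. algebra_hom s s (qna_sub D (j - 1)) H \<and> inj_on H (qna_sub D (j - 1)) \<and>
          (\<forall>i\<in>{1..<j}. H (gen D i) = x i)) \<and>
     (\<forall>k\<in>{j..N}. \<forall>i\<in>{1..<k}. x k * x i = s (lam D k i) (x i * x k)) \<and>
     (\<forall>k\<in>{j..N}. left_independent (alg_span s (x ` {1..<k})) (x k))"

lemma presented_stage:
  assumes "presented (Suc j) x" "j \<in> {2..N}"
  shows "\<exists>H. dd_stage D j x H"
proof -
  obtain H where "algebra_hom s s (qna_sub D j) H" "inj_on H (qna_sub D j)"
      "\<forall>i\<in>{1..<Suc j}. H (gen D i) = x i"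
    using assms by (auto simp: presented_def)
  then have "dd_stage D j x H"
    using assms by unfold_locales (auto simp: presented_def)
  then show ?thesis by blast
qed

lemma stage_presented:
  assumes "dd_stage D j x H"
  shows "presented j (dd_step D j x)"
proof -
  interpret dd_stage D j x H by fact
  show ?thesis
    unfolding presented_def A_def[symmetric]
    using dd.Theta_hom dd.Theta_inj y_less y_rel y_indep
    by (intro conjI exI[of _ dd.\<Theta>]) auto
qed

lemma presented_dd_gen:
  assumes "2 \<le> j" "j \<le> Suc N"
  shows "presented j (dd_gen D j)"
  using assms(2,1)
proof (induction rule: inc_induct)
  case base
  have "algebra_hom s s (qna_sub D N) id" by (auto simp: algebra_hom_def)
  moreover have "dd_gen D (Suc N) = gen D" by (subst dd_gen.simps) simp
  ultimately show ?case unfolding presented_def by (auto intro!: exI[of _ id])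
next
  case (step j)
  then obtain H where "dd_stage D j (dd_gen D (Suc j)) H" using presented_stage by force
  then have "presented j (dd_step D j (dd_gen D (Suc j)))" by (rule stage_presented)
  then show ?case using step dd_gen.simps[of D j] by simp
qed

lemma dd_stage_dd_gen:
  assumes "j \<in> {2..N}"
  shows "\<exists>H. dd_stage D j (dd_gen D (Suc j)) H"
  using presented_stage presented_dd_gen assms by auto

lemma dd_gen_step: "j \<le> N \<Longrightarrow> dd_gen D j = dd_step D j (dd_gen D (Suc j))"
  by (subst dd_gen.simps) simp

lemma dd_gen_last: "dd_gen D (Suc N) = gen D"
  by (subst dd_gen.simps) simp

lemma dd_alg_last: "dd_alg D (Suc N) = qna_alg D"
  by (simp add: dd_alg_def dd_gen_last qna_alg_def qna_sub_def)

lemma subalgebra_dd_alg: "subalgebra s (dd_alg D j)"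
  by (simp add: dd_alg_def subalgebra_alg_span)

lemma dd_gen_in_dd_alg: "i \<in> {1..N} \<Longrightarrow> dd_gen D j i \<in> dd_alg D j"
  by (auto simp: dd_alg_def intro: alg_span_base)

lemma ring_dd_alg: "ring (as_ring (dd_alg D j))"
  using ring_as_ring subalgebra_dd_alg k_algebra_axioms by blast

lemma dd_gen_ge: "2 \<le> j \<Longrightarrow> j \<le> l \<Longrightarrow> j \<le> N \<Longrightarrow> dd_gen D j l = dd_gen D (Suc j) l"
  by (simp add: dd_gen_step dd_step_def)

lemma dd_gen_nonzero:
  assumes "j \<in> {2..N}"
  shows "dd_gen D (Suc j) j \<noteq> 0"
proof -
  obtain H where "dd_stage D j (dd_gen D (Suc j)) H" using dd_stage_dd_gen[OF assms] by blast
  then interpret dd_stage D j "dd_gen D (Suc j)" H .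
  show ?thesis by (rule dd.x_nonzero)
qed

lemma dd_alg_fractions:
  assumes "j \<in> {2..N}"
  shows "dd_alg D j \<subseteq> fractions_by (dd_gen D (Suc j) j) (dd_alg D (Suc j))"
    and "dd_alg D (Suc j) \<subseteq> fractions_by (dd_gen D (Suc j) j) (dd_alg D j)"
proof -
  obtain H where "dd_stage D j (dd_gen D (Suc j)) H" using dd_stage_dd_gen[OF assms] by blast
  then interpret dd_stage D j "dd_gen D (Suc j)" H .
  have "y = dd_gen D j" using assms by (simp add: dd_gen_step)
  then show "dd_alg D j \<subseteq> fractions_by (dd_gen D (Suc j) j) (dd_alg D (Suc j))"
    "dd_alg D (Suc j) \<subseteq> fractions_by (dd_gen D (Suc j) j) (dd_alg D j)"
    using y_span_subset[of "Suc N"] x_span_subset assms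
    by (auto simp: dd_alg_def atLeastLessThanSuc_atLeastAtMost)
qed

lemma dd_alg_normal:
  assumes "j \<in> {2..N}" "u \<in> dd_alg D j"
  shows "\<exists>u'\<in>dd_alg D j. u * dd_gen D (Suc j) j = dd_gen D (Suc j) j * u'"
proof -
  obtain H where "dd_stage D j (dd_gen D (Suc j)) H" using dd_stage_dd_gen[OF assms(1)] by blast
  then interpret dd_stage D j "dd_gen D (Suc j)" H .
  have "y = dd_gen D j" using assms by (simp add: dd_gen_step)
  then show ?thesis
    using skew_normal_span[of "dd_gen D j ` {1..N}" "dd_gen D (Suc j) j" u] xj_y assms(2)
    unfolding dd_alg_def by fastforce
qed

lemma dd_ideal_props:
  assumes "j \<in> {2..N}"
  shows "ideal (dd_ideal D j) (as_ring (dd_alg D (Suc j)))" "dd_gen D (Suc j) j \<in> dd_ideal D j"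
  using ring.genideal_ideal[OF ring_dd_alg, of "{dd_gen D (Suc j) j}" "Suc j"]
    ring.genideal_self'[OF ring_dd_alg, of "dd_gen D (Suc j) j" "Suc j"]
    dd_gen_in_dd_alg[of j "Suc j"] assms
  by (auto simp: dd_ideal_def)

lemma dd_g:
  assumes "j \<in> {2..N}"
  shows "dd_g D j \<in> ring_hom (as_ring (dd_alg D j)) (as_ring (dd_alg D (Suc j)) Quot dd_ideal D j)"
    and "dd_g D j (s c 1) = dd_ideal D j +>\<^bsub>as_ring (dd_alg D (Suc j))\<^esub> s c 1"
    and "i \<in> {1..N} \<Longrightarrow> dd_g D j (dd_gen D j i) =
           dd_ideal D j +>\<^bsub>as_ring (dd_alg D (Suc j))\<^esub> dd_gen D (Suc j) i"
proof -
  let ?P = "\<lambda>g. g \<in> ring_hom (as_ring (dd_alg D j)) (as_ring (dd_alg D (Suc j)) Quot dd_ideal D j) \<and>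
        (\<forall>c. g (s c 1) = dd_ideal D j +>\<^bsub>as_ring (dd_alg D (Suc j))\<^esub> s c 1) \<and>
        (\<forall>i\<in>{1..N}. g (dd_gen D j i) =
           dd_ideal D j +>\<^bsub>as_ring (dd_alg D (Suc j))\<^esub> dd_gen D (Suc j) i)"
  obtain H where "dd_stage D j (dd_gen D (Suc j)) H" using dd_stage_dd_gen[OF assms] by blast
  then interpret dd_stage D j "dd_gen D (Suc j)" H .
  have "y = dd_gen D j" using assms by (simp add: dd_gen_step)
  then have "\<exists>g. ?P g"
    using exists_quotient_map[of "dd_ideal D j"] dd_ideal_props[OF assms] by (simp add: dd_alg_def)
  then have "?P (dd_g D j)" unfolding dd_g_def by (rule someI_ex)
  then show "dd_g D j \<in> ring_hom (as_ring (dd_alg D j)) (as_ring (dd_alg D (Suc j)) Quot dd_ideal D j)"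
    "dd_g D j (s c 1) = dd_ideal D j +>\<^bsub>as_ring (dd_alg D (Suc j))\<^esub> s c 1"
    "i \<in> {1..N} \<Longrightarrow> dd_g D j (dd_gen D j i) =
       dd_ideal D j +>\<^bsub>as_ring (dd_alg D (Suc j))\<^esub> dd_gen D (Suc j) i"
    by blast+
qed

lemma dd_gen_skew_commute:
  assumes "i \<in> {1..N}" "k \<in> {1..N}"
  shows "dd_gen D 2 i * dd_gen D 2 k = s (lam D i k) (dd_gen D 2 k * dd_gen D 2 i)"
proof -
  have rel: "dd_gen D 2 i * dd_gen D 2 k = s (lam D i k) (dd_gen D 2 k * dd_gen D 2 i)"
    if "i \<in> {1..N}" "k \<in> {1..<i}" for i k
    using presented_dd_gen[of 2] that N_pos by (auto simp: presented_def)
  consider "k < i" | "k = i" | "i < k" by linarith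
  then show ?thesis
  proof cases
    case 3
    then have "dd_gen D 2 k * dd_gen D 2 i = s (lam D k i) (dd_gen D 2 i * dd_gen D 2 k)"
      using rel assms by simp
    from skew_commute_sym[OF this] show ?thesis
      using lam_nonzero assms lam_inverse[of i k] by simp
  qed (use assms rel lam_self in auto)
qed

end

section \<open>Transporting homomorphisms along one step\<close>

context k_algebra
begin

text \<open>The universal property of a localisation, in the form needed to pass from the old
  algebra \<open>U\<close> to the new one \<open>U'\<close>. Normality of \<open>x\<close> is asked
  of \<open>U'\<close> because that is where it holds.\<close>

lemma extend_hom_fractions:
  fixes sB :: "'k \<Rightarrow> 'b::division_ring \<Rightarrow> 'b"
  assumes sB: "k_algebra sB" and U: "subalgebra scale U" and U': "subalgebra scale U'"
    and sub: "U' \<subseteq> fractions_by x U"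
    and normal: "\<And>u. u \<in> U' \<Longrightarrow> \<exists>u'\<in>U'. u * x = x * u'"
    and e: "algebra_hom scale sB U e" and x: "x \<in> U" and ex: "e x \<noteq> 0"
  shows "\<exists>e'. algebra_hom scale sB U' e' \<and>
    (\<forall>a\<in>U'. \<forall>n. a * x ^ n \<in> U \<longrightarrow> e' a = e (a * x ^ n) * inverse (e x) ^ n)"
proof -
  interpret B: k_algebra sB by fact
  note Uc = subalgebraD[OF U] and U'c = subalgebraD[OF U']
  note hom = algebra_homD[OF e]
  let ?u = "e x"
  define e' where "e' a = (let n = SOME n. a * x ^ n \<in> U in e (a * x ^ n) * inverse ?u ^ n)" for a
  have xU: "x ^ n \<in> U" for n by (rule subalgebra_power[OF U x])
  have uinv: "?u ^ n * inverse ?u ^ n = 1" "inverse ?u ^ n * ?u ^ n = 1" for n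
    using ex by (simp_all add: power_inverse)
  have shift: "e (a * x ^ (n + k)) * inverse ?u ^ (n + k) = e (a * x ^ n) * inverse ?u ^ n"
    if "a * x ^ n \<in> U" for a n k
  proof -
    have "e (a * x ^ (n + k)) = e (a * x ^ n) * ?u ^ k"
      using hom(2)[OF that xU[of k]] by (simp add: power_add mult.assoc algebra_hom_power[OF e U x])
    then have "e (a * x ^ (n + k)) * inverse ?u ^ (k + n)
        = e (a * x ^ n) * (?u ^ k * inverse ?u ^ k) * inverse ?u ^ n"
      by (simp only: power_add mult.assoc)
    then show ?thesis by (simp add: uinv add.commute)
  qed
  have e'_eq: "e' a = e (a * x ^ n) * inverse ?u ^ n" if "a * x ^ n \<in> U" for a n
  proof -
    define m where "m = (SOME n. a * x ^ n \<in> U)"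
    have "a * x ^ m \<in> U" unfolding m_def using that by (rule someI)
    then show ?thesis
      using shift[of a m n] shift[of a n m] that by (simp add: e'_def Let_def add.commute flip: m_def)
  qed
  have in_U: "\<exists>n. a * x ^ n \<in> U" if "a \<in> U'" for a using that sub by (auto simp: fractions_by_def)
  have "algebra_hom scale sB U' e'"
    unfolding algebra_hom_def
  proof (intro conjI ballI allI)
    fix a b assume a: "a \<in> U'" and b: "b \<in> U'"
    obtain n where n: "a * x ^ n \<in> U" using in_U a by blast
    obtain m where m: "b * x ^ m \<in> U" using in_U b by blast
    have nm: "a * x ^ max n m \<in> U" "b * x ^ max n m \<in> U"
      using fractions_by_common[OF U x] n m by auto
    then have "(a + b) * x ^ max n m \<in> U" using Uc(4) by (simp add: distrib_right)
    from e'_eq[OF this] show "e' (a + b) = e' a + e' b"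
      using e'_eq[OF nm(1)] e'_eq[OF nm(2)] hom(1)[OF nm] by (simp add: distrib_right)
    \<comment> \<open>The denominator of \<open>a\<close> is carried through \<open>b\<close>; the
      resulting \<open>b1\<close> needs a denominator of its own.\<close>
    obtain b1 where b1: "b1 \<in> U'" "b * x ^ n = x ^ n * b1" using normal_power[OF normal b] by blast
    obtain k where k: "b1 * x ^ k \<in> U" using in_U b1 by blast
    have "b * x ^ (n + k) = x ^ n * (b1 * x ^ k)" using b1 by (simp add: power_add flip: mult.assoc)
    moreover have "x ^ n * (b1 * x ^ k) \<in> U" using Uc(8) xU k by blast
    ultimately have "e' b = ?u ^ n * e (b1 * x ^ k) * inverse ?u ^ (k + n)"
      using e'_eq[of b "n + k"] hom(2)[OF xU k, of n]
      by (simp add: algebra_hom_power[OF e U x] add.commute)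
    then have "inverse ?u ^ n * e' b = (inverse ?u ^ n * ?u ^ n) * (e (b1 * x ^ k) * inverse ?u ^ (k + n))"
      by (simp only: mult.assoc)
    then have eb: "inverse ?u ^ n * e' b = e (b1 * x ^ k) * inverse ?u ^ (k + n)"
      by (simp add: uinv)
    have ab: "a * b * x ^ (n + k) = (a * x ^ n) * (b1 * x ^ k)"
      using b1(2) by (simp add: power_add mult.assoc) (simp add: b1(2) flip: mult.assoc)
    then have "a * b * x ^ (n + k) \<in> U" using Uc(8) n k by simp
    from e'_eq[OF this] have "e' (a * b) = e (a * x ^ n) * e (b1 * x ^ k) * inverse ?u ^ (k + n)"
      using hom(2)[OF n k] ab by (simp add: add.commute)
    then show "e' (a * b) = e' a * e' b"
      using e'_eq[OF n] eb by (simp add: mult.assoc)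
  next
    fix c a assume a: "a \<in> U'"
    obtain n where n: "a * x ^ n \<in> U" using in_U a by blast
    then have "scale c a * x ^ n \<in> U" using Uc(7) by (simp add: scale_mult_left)
    from e'_eq[OF this] show "e' (scale c a) = sB c (e' a)"
      using e'_eq[OF n] hom(3)[OF n] by (simp add: scale_mult_left B.scale_mult_left)
  next
    show "e' 1 = 1" using e'_eq[of 1 0] Uc(2) hom(4) by simp
  qed
  then show ?thesis using e'_eq by blast
qed

text \<open>\<open>e\<close> factors through U / J and is composed with \<open>g\<close>. The
  conclusion speaks of every representative of the coset, to match the way \<open>dd_emb\<close> is
  phrased.\<close>

lemma hom_through_quotient:
  fixes sB :: "'k \<Rightarrow> 'b::ring_1 \<Rightarrow> 'b"
  assumes sB: "k_algebra sB" and U: "subalgebra scale U" and U': "subalgebra scale U'"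
    and J: "ideal J (as_ring U)" and e: "algebra_hom scale sB U e"
    and eJ: "\<And>a. a \<in> J \<Longrightarrow> e a = 0"
    and g: "g \<in> ring_hom (as_ring U') (as_ring U Quot J)"
    and g_scalar: "\<And>c. g (scale c 1) = J +>\<^bsub>as_ring U\<^esub> scale c 1"
  shows "\<exists>e'. algebra_hom scale sB U' e' \<and>
    (\<forall>a\<in>U'. g a \<noteq> {} \<and> (\<forall>b\<in>g a. b \<in> U \<and> g a = J +>\<^bsub>as_ring U\<^esub> b \<and> e' a = e b))"
proof -
  interpret B: k_algebra sB by fact
  note Uc = subalgebraD[OF U] and U'c = subalgebraD[OF U']
  note hom = algebra_homD[OF e]
  note c = ideal.rcos_ring_hom[OF J]
  note Js = ideal_subspace[OF J U]
  have J0: "0 \<in> J" and JU: "J \<subseteq> U" using ideal_as_ringD(1,2)[OF J] by auto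
  define e' where "e' a = e (SOME b. b \<in> g a)" for a
  have g_coset: "\<exists>b\<in>U. g a = J +>\<^bsub>as_ring U\<^esub> b" if "a \<in> U'" for a
    using ring_hom_closed[OF g] that
    by (auto simp: FactRing_def A_RCOSETS_def' a_r_coset_def')
  have main: "g a \<noteq> {} \<and> (\<forall>b\<in>g a. b \<in> U \<and> g a = J +>\<^bsub>as_ring U\<^esub> b \<and> e' a = e b)" if a: "a \<in> U'" for a
  proof -
    obtain b0 where b0: "b0 \<in> U" "g a = J +>\<^bsub>as_ring U\<^esub> b0" using g_coset a by blast
    have b0_in: "b0 \<in> g a" using b0 J0 by (force simp: coset_as_ring)
    have *: "b \<in> U \<and> J +>\<^bsub>as_ring U\<^esub> b0 = J +>\<^bsub>as_ring U\<^esub> b \<and> e b = e b0" if b: "b \<in> g a" for b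
    proof -
      obtain i where i: "i \<in> J" "b = i + b0" using b b0 by (auto simp: coset_as_ring)
      have "k + b0 \<in> (\<lambda>i. i + b) ` J" "k + b \<in> (\<lambda>i. i + b0) ` J" if "k \<in> J" for k
        using that i subspace_add[OF Js] subspace_diff[OF Js]
        by (auto intro: image_eqI[of _ _ "k - i"] image_eqI[of _ _ "k + i"] simp: add.assoc)
      then have "J +>\<^bsub>as_ring U\<^esub> b0 = J +>\<^bsub>as_ring U\<^esub> b" unfolding coset_as_ring by blast
      moreover have "b \<in> U" using i b0 JU Uc(4) by auto
      moreover have "e b = e b0" using i b0 hom(1)[of i b0] JU eJ by auto
      ultimately show ?thesis by simp
    qed
    have "(SOME b. b \<in> g a) \<in> g a" using b0_in by (rule someI)
    then have "e' a = e b0" using * by (simp add: e'_def)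
    show ?thesis
    proof (intro conjI ballI)
      show "g a \<noteq> {}" using b0_in by blast
      fix b assume "b \<in> g a"
      then show "b \<in> U" "g a = J +>\<^bsub>as_ring U\<^esub> b" "e' a = e b"
        using *[of b] b0(2) \<open>e' a = e b0\<close> by simp_all
    qed
  qed
  have e'_eq: "e' a = e b" if "a \<in> U'" "b \<in> U" "g a = J +>\<^bsub>as_ring U\<^esub> b" for a b
  proof -
    have "b \<in> g a" using that(3) J0 by (force simp: coset_as_ring)
    then show ?thesis using main[OF that(1)] by blast
  qed
  \<comment> \<open>\<open>g\<close> is a ring homomorphism with known values on scalars; writing k
    a as (k 1) a reduces linearity to multiplicativity.\<close>
  have scale_one: "scale k 1 * a = scale k a" for k a by (simp add: scale_mult_left)
  have "algebra_hom scale sB U' e'"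
    unfolding algebra_hom_def
  proof (intro conjI ballI allI)
    fix a a' assume a: "a \<in> U'" and a': "a' \<in> U'"
    obtain b where b: "b \<in> U" "g a = J +>\<^bsub>as_ring U\<^esub> b" using g_coset a by blast
    obtain b' where b': "b' \<in> U" "g a' = J +>\<^bsub>as_ring U\<^esub> b'" using g_coset a' by blast
    have "g (a + a') = J +>\<^bsub>as_ring U\<^esub> (b + b')"
      using ring_hom_add[OF g, of a a'] a a' ring_hom_add[OF c, of b b'] b b' by simp
    then show "e' (a + a') = e' a + e' a'"
      using e'_eq[OF a b] e'_eq[OF a' b'] e'_eq[of "a + a'" "b + b'"] hom(1) a a' b b' Uc(4) U'c(4) by simp
    have "g (a * a') = J +>\<^bsub>as_ring U\<^esub> (b * b')"
      using ring_hom_mult[OF g, of a a'] a a' ring_hom_mult[OF c, of b b'] b b' by simp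
    then show "e' (a * a') = e' a * e' a'"
      using e'_eq[OF a b] e'_eq[OF a' b'] e'_eq[of "a * a'" "b * b'"] hom(2) a a' b b' Uc(8) U'c(8) by simp
  next
    fix k a assume a: "a \<in> U'"
    obtain b where b: "b \<in> U" "g a = J +>\<^bsub>as_ring U\<^esub> b" using g_coset a by blast
    have k: "scale k 1 \<in> U" "scale k 1 \<in> U'" using Uc(2,7) U'c(2,7) by auto
    have "g (scale k 1 * a) = J +>\<^bsub>as_ring U\<^esub> (scale k 1 * b)"
      using ring_hom_mult[OF g, of "scale k 1" a] a ring_hom_mult[OF c, of "scale k 1" b] b k
      by (simp add: g_scalar)
    then show "e' (scale k a) = sB k (e' a)"
      unfolding scale_one
      using e'_eq[OF a b] e'_eq[of "scale k a" "scale k b"] hom(3) a b Uc(7) U'c(7) by simp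
  next
    have "g 1 = J +>\<^bsub>as_ring U\<^esub> 1" using g_scalar[of 1] by simp
    then show "e' 1 = 1" using e'_eq[of 1 1] Uc(2) U'c(2) hom(4) by simp
  qed
  then show ?thesis using main by blast
qed

lemma ideal_kernel:
  assumes e: "algebra_hom scale s' U e" and U: "subalgebra scale U"
  shows "ideal {a \<in> U. e a = 0} (as_ring U)"
proof (rule idealI)
  note Uc = subalgebraD[OF U] and hom = algebra_homD[OF e]
  show "ring (as_ring U)" by (rule ring_as_ring[OF U k_algebra_axioms])
  then interpret R: ring "as_ring U" .
  show "subgroup {a \<in> U. e a = 0} (add_monoid (as_ring U))"
  proof (rule R.add.subgroupI)
    fix a assume a: "a \<in> {a \<in> U. e a = 0}"
    have "\<ominus>\<^bsub>as_ring U\<^esub> a = - a"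
      by (rule R.minus_equality) (use a Uc in auto)
    then show "\<ominus>\<^bsub>as_ring U\<^esub> a \<in> {a \<in> U. e a = 0}"
      using a Uc(6) algebra_hom_uminus[OF e U] by simp
  qed (use Uc hom algebra_hom_zero[OF e U] in auto)
  show "x \<otimes>\<^bsub>as_ring U\<^esub> a \<in> {a \<in> U. e a = 0}" "a \<otimes>\<^bsub>as_ring U\<^esub> x \<in> {a \<in> U. e a = 0}"
    if "a \<in> {a \<in> U. e a = 0}" "x \<in> carrier (as_ring U)" for a x
    using that Uc(8) hom(2) by auto
qed

end

section \<open>The quotients inside the division ring of fractions\<close>

locale qna_quotient = qna D for D :: "('k::field, 'a::division_ring) qna_data" +
  fixes P :: "'a set" and \<iota> :: "'a set \<Rightarrow> 'b::division_ring" and sB :: "'k \<Rightarrow> 'b \<Rightarrow> 'b"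
  assumes P_ideal: "ideal P (as_ring (qna_alg D))"
    and iota_hom: "\<iota> \<in> ring_hom (as_ring (qna_alg D) Quot P) ring_of_type_algebra"
    and iota_inj: "inj_on \<iota> (carrier (as_ring (qna_alg D) Quot P))"
    and sB: "k_algebra sB"
    and iota_scale: "a \<in> qna_alg D \<Longrightarrow> \<iota> (P +>\<^bsub>as_ring (qna_alg D)\<^esub> scl D c a) =
                 sB c (\<iota> (P +>\<^bsub>as_ring (qna_alg D)\<^esub> a))"
begin

sublocale B: k_algebra sB by (rule sB)

text \<open>The composite of A^(j) -> B^(j) with the embedding into Frac(B). Working with
  representatives keeps cosets out of most later arguments.\<close>

definition E :: "nat \<Rightarrow> 'a \<Rightarrow> 'b" where
  "E j a = dd_emb D P \<iota> j (dd_class D P j a)"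

abbreviation "prm \<equiv> dd_prime D P"

lemma dd_class_eq: "dd_class D P j a = (\<lambda>p. p + a) ` prm j"
  by (simp add: dd_class_def coset_as_ring)

text \<open>The kernel being exactly P_j says that the map induced on B^(j) is injective; it is also
  what makes the embedding one stage further down well defined.\<close>

definition embeds :: "nat \<Rightarrow> bool" where
  "embeds j \<longleftrightarrow> algebra_hom s sB (dd_alg D j) (E j) \<and> prm j = {a \<in> dd_alg D j. E j a = 0}"

lemma embeds_last: "embeds (Suc N)"
proof -
  have emb: "dd_emb D P \<iota> (Suc N) = \<iota>" and prm: "prm (Suc N) = P"
    by (subst dd_emb.simps dd_prime.simps, simp)+
  note alg = dd_alg_last
  have E: "E (Suc N) a = \<iota> (P +>\<^bsub>as_ring (qna_alg D)\<^esub> a)" for a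
    by (simp add: E_def emb dd_class_def alg prm)
  note c = ideal.rcos_ring_hom[OF P_ideal]
  note h = ring_hom_trans[OF c iota_hom, unfolded comp_def]
  have "algebra_hom s sB (qna_alg D) (E (Suc N))"
    unfolding algebra_hom_def E
    using ring_hom_add[OF h] ring_hom_mult[OF h] ring_hom_one[OF h] iota_scale by simp
  moreover have "P = {a \<in> qna_alg D. E (Suc N) a = 0}"
  proof -
    have P_subspace: "subspace P"
      using ideal_subspace[OF P_ideal] subalgebra_dd_alg[of "Suc N"] alg by simp
    have P0: "P +>\<^bsub>as_ring (qna_alg D)\<^esub> 0 = P" by (simp add: coset_as_ring)
    have z: "E (Suc N) 0 = 0"
      using algebra_hom_zero[OF calculation] subalgebra_dd_alg[of "Suc N"] alg by simp
    have carr: "P +>\<^bsub>as_ring (qna_alg D)\<^esub> a \<in> carrier (as_ring (qna_alg D) Quot P)" if "a \<in> qna_alg D" for a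
      using ring_hom_closed[OF c] that by simp
    have zero_in: "0 \<in> qna_alg D" using subalgebraD(3)[OF subalgebra_dd_alg[of "Suc N"]] alg by simp
    have "a \<in> P \<longleftrightarrow> a \<in> qna_alg D \<and> E (Suc N) a = 0" for a
    proof (cases "a \<in> qna_alg D")
      case True
      have "E (Suc N) a = 0 \<longleftrightarrow> P +>\<^bsub>as_ring (qna_alg D)\<^esub> a = P"
        using inj_on_eq_iff[OF iota_inj carr[OF True] carr[OF zero_in]] z by (simp add: E P0)
      also have "\<dots> \<longleftrightarrow> a \<in> P"
      proof
        assume "P +>\<^bsub>as_ring (qna_alg D)\<^esub> a = P"
        then show "a \<in> P" using ideal_as_ringD(2)[OF P_ideal] by (force simp: coset_as_ring)
      next
        assume "a \<in> P"
        then show "P +>\<^bsub>as_ring (qna_alg D)\<^esub> a = P"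
          using subspace_add[OF P_subspace] subspace_diff[OF P_subspace]
          by (force simp: coset_as_ring image_iff intro: bexI[of _ "_ - a"])
      qed
      finally show ?thesis using True by simp
    next
      case False
      then show ?thesis using ideal_as_ringD(1)[OF P_ideal] by auto
    qed
    then show ?thesis by blast
  qed
  ultimately show ?thesis by (simp add: embeds_def alg prm)
qed

lemma prm_step: "j \<le> N \<Longrightarrow> prm j = dd_psi D j (prm (Suc j))"
  by (subst dd_prime.simps) simp

context
  fixes j
  assumes j: "j \<in> {2..N}" and emb: "embeds (Suc j)"
begin

abbreviation "xj \<equiv> dd_gen D (Suc j) j"
abbreviation "E_next \<equiv> E (Suc j)"

lemma e_hom: "algebra_hom s sB (dd_alg D (Suc j)) E_next"
  and prm_Suc: "prm (Suc j) = {a \<in> dd_alg D (Suc j). E_next a = 0}"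
  using emb by (auto simp: embeds_def)

lemma xj_in: "xj \<in> dd_alg D (Suc j)"
  using dd_gen_in_dd_alg j by auto

text \<open>Covers both branches of \<open>dd_emb\<close>, with \<open>Q\<close> standing for the
  description of the value in that branch. Since \<open>e'\<close> vanishes on P_j, all
  representatives of a class yield the same value and the description is definite.\<close>

lemma E_by_class:
  assumes e': "algebra_hom s sB (dd_alg D j) e'"
    and ker: "prm j = {a \<in> dd_alg D j. e' a = 0}" and a: "a \<in> dd_alg D j"
    and val: "\<And>C v. dd_emb D P \<iota> j C = (THE v. \<exists>a\<in>C. Q a v)"
    and Q: "\<And>a. a \<in> dd_alg D j \<Longrightarrow> Q a (e' a)"
    and Q_unique: "\<And>a v. a \<in> dd_alg D j \<Longrightarrow> Q a v \<Longrightarrow> v = e' a"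
  shows "E j a = e' a"
  unfolding E_def val dd_class_eq
proof (rule the_equality)
  have "0 \<in> prm j" using ker algebra_hom_zero[OF e' subalgebra_dd_alg] subalgebraD(3)[OF subalgebra_dd_alg] by simp
  then have "a \<in> (\<lambda>p. p + a) ` prm j" by force
  then show "\<exists>a'\<in>(\<lambda>p. p + a) ` prm j. Q a' (e' a)"
    using Q[OF a] by blast
  fix v assume "\<exists>a'\<in>(\<lambda>p. p + a) ` prm j. Q a' v"
  then obtain p where p: "p \<in> prm j" "Q (p + a) v" by blast
  then have "v = e' (p + a)"
    using Q_unique ker a subalgebraD(4)[OF subalgebra_dd_alg] by auto
  then show "v = e' a" using p(1) ker a algebra_homD(1)[OF e'] by auto
qed

text \<open>The image of x_j is invertible in Frac(B). So once x_j^n clears the denominator of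
  \<open>a\<close>, its image vanishes exactly when a x_j^n lies in P_(j+1), and this is how P_j is
  defined here.\<close>

lemma embeds_step_localise:
  assumes x: "xj \<notin> prm (Suc j)"
  shows "embeds j \<and> (\<forall>a\<in>dd_alg D j. \<forall>n. a * xj ^ n \<in> dd_alg D (Suc j) \<longrightarrow>
    E j a = E_next (a * xj ^ n) * inverse (E_next xj) ^ n)"
proof -
  let ?u = "E_next xj"
  have u: "?u \<noteq> 0" using x xj_in prm_Suc by auto
  have x0: "xj \<noteq> 0" by (rule dd_gen_nonzero[OF j])
  have xinv: "inverse xj ^ n * xj ^ n = 1" "xj ^ n * inverse xj ^ n = 1" for n
    using x0 by (simp_all add: power_inverse)
  obtain e' where e': "algebra_hom s sB (dd_alg D j) e'"
    and e'_eq: "\<And>a n. a \<in> dd_alg D j \<Longrightarrow> a * xj ^ n \<in> dd_alg D (Suc j) \<Longrightarrow> e' a = E_next (a * xj ^ n) * inverse ?u ^ n"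
    using extend_hom_fractions[OF sB subalgebra_dd_alg subalgebra_dd_alg dd_alg_fractions(1)[OF j]
        dd_alg_normal[OF j] e_hom xj_in u] by blast
  have psi: "prm j = {p * inverse xj ^ n | p n. p \<in> prm (Suc j)} \<inter> dd_alg D j"
    using j x by (simp add: prm_step dd_psi_def)
  have ker: "prm j = {a \<in> dd_alg D j. e' a = 0}"
  proof (rule subset_antisym; rule subsetI)
    fix a assume "a \<in> prm j"
    then obtain p n where p: "a = p * inverse xj ^ n" "p \<in> prm (Suc j)" and a: "a \<in> dd_alg D j"
      using psi by auto
    then have "a * xj ^ n = p" by (simp add: mult.assoc xinv)
    then show "a \<in> {a \<in> dd_alg D j. e' a = 0}"
      using e'_eq[OF a, of n] p(2) prm_Suc a by simp
  next
    fix a assume "a \<in> {a \<in> dd_alg D j. e' a = 0}"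
    then have a: "a \<in> dd_alg D j" "e' a = 0" by auto
    then obtain n where n: "a * xj ^ n \<in> dd_alg D (Suc j)"
      using dd_alg_fractions(1)[OF j] by (auto simp: fractions_by_def)
    then have "E_next (a * xj ^ n) = 0" using e'_eq[OF a(1) n] a(2) u by simp
    then have "a * xj ^ n \<in> prm (Suc j)" using prm_Suc n by simp
    moreover have "a = (a * xj ^ n) * inverse xj ^ n" by (simp add: mult.assoc xinv)
    ultimately show "a \<in> prm j" using psi a by blast
  qed
  have "E j a = e' a" if "a \<in> dd_alg D j" for a
  proof (rule E_by_class[OF e' ker that])
    show "dd_emb D P \<iota> j C = (THE v. \<exists>a\<in>C. \<exists>b\<in>dd_alg D (Suc j). \<exists>n.
        a = b * inverse xj ^ n \<and> v = E_next b * inverse ?u ^ n)" for C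
      using j x by (subst dd_emb.simps) (simp add: E_def)
  next
    fix a assume a: "a \<in> dd_alg D j"
    then obtain n where n: "a * xj ^ n \<in> dd_alg D (Suc j)"
      using dd_alg_fractions(1)[OF j] by (auto simp: fractions_by_def)
    have "a = (a * xj ^ n) * inverse xj ^ n" by (simp add: mult.assoc xinv)
    then show "\<exists>b\<in>dd_alg D (Suc j). \<exists>n. a = b * inverse xj ^ n \<and> e' a = E_next b * inverse ?u ^ n"
      using n e'_eq[OF a n] by blast
  next
    fix a v assume a: "a \<in> dd_alg D j"
      and "\<exists>b\<in>dd_alg D (Suc j). \<exists>n. a = b * inverse xj ^ n \<and> v = E_next b * inverse ?u ^ n"
    then obtain b n where b: "b \<in> dd_alg D (Suc j)" "a = b * inverse xj ^ n" "v = E_next b * inverse ?u ^ n"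
      by blast
    then have "a * xj ^ n = b" by (simp add: mult.assoc xinv)
    then show "v = e' a" using e'_eq[OF a, of n] b by simp
  qed
  moreover from this have "algebra_hom s sB (dd_alg D j) (E j)"
    using e' subalgebraD[OF subalgebra_dd_alg[of j]] by (simp add: algebra_hom_def)
  ultimately show ?thesis using ker e'_eq by (auto simp: embeds_def)
qed

text \<open>The ideal generated by x_j lies in the kernel P_(j+1), so the embedding of B^(j+1)
  factors through the target of g_j. In this case generators of equal index have equal images for
  every index.\<close>

lemma embeds_step_quotient:
  assumes x: "xj \<in> prm (Suc j)"
  shows "embeds j \<and> (\<forall>i\<in>{1..N}. E j (dd_gen D j i) = E_next (dd_gen D (Suc j) i))"
proof -
  let ?J = "dd_ideal D j"
  note J = dd_ideal_props[OF j]
  have prm_ideal: "ideal (prm (Suc j)) (as_ring (dd_alg D (Suc j)))"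
    unfolding prm_Suc by (rule ideal_kernel[OF e_hom subalgebra_dd_alg])
  have J_sub: "?J \<subseteq> prm (Suc j)"
    unfolding dd_ideal_def by (rule ring.genideal_minimal[OF ring_dd_alg prm_ideal]) (use x in auto)
  have eJ: "E_next a = 0" if "a \<in> ?J" for a using that J_sub prm_Suc by auto
  obtain e' where e': "algebra_hom s sB (dd_alg D j) e'"
    and g_ne: "\<And>a. a \<in> dd_alg D j \<Longrightarrow> dd_g D j a \<noteq> {}"
    and e'_eq: "\<And>a b. a \<in> dd_alg D j \<Longrightarrow> b \<in> dd_g D j a \<Longrightarrow>
      b \<in> dd_alg D (Suc j) \<and> dd_g D j a = ?J +>\<^bsub>as_ring (dd_alg D (Suc j))\<^esub> b \<and> e' a = E_next b"
    using hom_through_quotient[OF sB subalgebra_dd_alg subalgebra_dd_alg J(1) e_hom eJ dd_g(1,2)[OF j]] by blast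
  have coset_self: "b \<in> ?J +>\<^bsub>as_ring (dd_alg D (Suc j))\<^esub> b" for b
    using ideal_as_ringD(2)[OF J(1)] by (force simp: coset_as_ring)
  have psi: "prm j = {a \<in> dd_alg D j. dd_g D j a \<in>
      (\<lambda>p. ?J +>\<^bsub>as_ring (dd_alg D (Suc j))\<^esub> p) ` prm (Suc j)}"
    using j x by (simp add: prm_step dd_psi_def)
  have ker: "prm j = {a \<in> dd_alg D j. e' a = 0}"
  proof (rule subset_antisym; rule subsetI)
    fix a assume "a \<in> prm j"
    then obtain p where p: "p \<in> prm (Suc j)" "dd_g D j a = ?J +>\<^bsub>as_ring (dd_alg D (Suc j))\<^esub> p"
      and a: "a \<in> dd_alg D j"
      using psi by auto
    then have "p \<in> dd_g D j a" using coset_self by simp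
    then show "a \<in> {a \<in> dd_alg D j. e' a = 0}" using e'_eq[OF a] p(1) prm_Suc a by auto
  next
    fix a assume "a \<in> {a \<in> dd_alg D j. e' a = 0}"
    then have a: "a \<in> dd_alg D j" "e' a = 0" by auto
    then obtain b where b: "b \<in> dd_g D j a" using g_ne by blast
    then have "b \<in> prm (Suc j)" using e'_eq[OF a(1) b] a(2) prm_Suc by auto
    then show "a \<in> prm j" using psi e'_eq[OF a(1) b] a by auto
  qed
  have E: "E j a = e' a" if "a \<in> dd_alg D j" for a
  proof (rule E_by_class[OF e' ker that])
    show "dd_emb D P \<iota> j C = (THE v. \<exists>a\<in>C. \<exists>b\<in>dd_g D j a. v = E_next b)" for C
      using j x by (subst dd_emb.simps) (simp add: E_def)
    show "\<exists>b\<in>dd_g D j a. e' a = E_next b" if "a \<in> dd_alg D j" for a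
      using g_ne[OF that] e'_eq[OF that] by blast
    show "v = e' a" if "a \<in> dd_alg D j" "\<exists>b\<in>dd_g D j a. v = E_next b" for a v
      using that e'_eq by auto
  qed
  then have "algebra_hom s sB (dd_alg D j) (E j)"
    using e' subalgebraD[OF subalgebra_dd_alg[of j]] by (simp add: algebra_hom_def)
  moreover have "E j (dd_gen D j i) = E_next (dd_gen D (Suc j) i)" if "i \<in> {1..N}" for i
    using E e'_eq[of "dd_gen D j i" "dd_gen D (Suc j) i"] dd_gen_in_dd_alg[OF that] coset_self
      dd_g(3)[OF j that] by simp
  ultimately show ?thesis using ker E by (auto simp: embeds_def)
qed

lemma embeds_step: "embeds j"
  using embeds_step_localise embeds_step_quotient by blast

lemma E_gen_step:
  assumes "l \<in> {j..N}"
  shows "E j (dd_gen D j l) = E_next (dd_gen D (Suc j) l)"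
proof (cases "xj \<in> prm (Suc j)")
  case True
  then show ?thesis using embeds_step_quotient assms j by auto
next
  case False
  have eq: "dd_gen D j l = dd_gen D (Suc j) l" using dd_gen_ge[of j l] assms j by auto
  have "dd_gen D j l \<in> dd_alg D j" "dd_gen D j l * xj ^ 0 \<in> dd_alg D (Suc j)"
    using dd_gen_in_dd_alg[of l j] dd_gen_in_dd_alg[of l "Suc j"] assms j by (simp_all flip: eq)
  then have "E j (dd_gen D j l) = E_next (dd_gen D j l * xj ^ 0) * inverse (E_next xj) ^ 0"
    using embeds_step_localise[OF False] by blast
  then show ?thesis by (simp add: eq)
qed

end

lemma embeds: "2 \<le> j \<Longrightarrow> j \<le> Suc N \<Longrightarrow> embeds j"
proof (rotate_tac 1, induction rule: inc_induct)
  case base show ?case by (rule embeds_last)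
next
  case (step n) then show ?case using embeds_step[of n] by simp
qed

lemma E_hom: "2 \<le> j \<Longrightarrow> j \<le> Suc N \<Longrightarrow> algebra_hom s sB (dd_alg D j) (E j)"
  using embeds by (simp add: embeds_def)

lemma dd_B_eq: "dd_B D P \<iota> j = E j ` dd_alg D j"
proof -
  have "carrier (dd_quot D P j) = dd_class D P j ` dd_alg D j"
    by (auto simp: dd_quot_def FactRing_def A_RCOSETS_def' dd_class_def a_r_coset_def')
  then show ?thesis by (simp add: dd_B_def E_def image_image)
qed

lemma dd_B_span:
  assumes "2 \<le> j" "j \<le> Suc N"
  shows "dd_B D P \<iota> j = alg_span sB ((\<lambda>i. E j (dd_gen D j i)) ` {1..N})"
  unfolding dd_B_eq dd_alg_def
  using algebra_hom_image_span[OF E_hom[OF assms, unfolded dd_alg_def] sB] by (simp add: image_image)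

lemma subalgebra_dd_B: "2 \<le> j \<Longrightarrow> j \<le> Suc N \<Longrightarrow> subalgebra sB (dd_B D P \<iota> j)"
  using dd_B_span B.subalgebra_alg_span by simp

lemma dd_t_eq: "dd_t D P \<iota> i = E 2 (dd_gen D 2 i)"
  by (simp add: dd_t_def E_def)

text \<open>The range stops at k = j + 1 because X_j is unchanged by the steps with index at most
  \<open>j\<close>; a step with a larger index may alter it.\<close>

lemma E_gen:
  assumes "j \<in> {1..N}" "2 \<le> k" "k \<le> Suc j"
  shows "E k (dd_gen D k j) = dd_t D P \<iota> j"
  using assms(2,3)
proof (induction k rule: dec_induct)
  case base then show ?case by (simp add: dd_t_eq)
next
  case (step k)
  then have "k \<in> {2..N}" "j \<in> {k..N}" using assms by auto
  then show ?case using E_gen_step[of k j] embeds[of "Suc k"] step by simp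
qed

lemma dd_t_in_dd_B:
  assumes "j \<in> {1..N}" "2 \<le> k" "k \<le> Suc j"
  shows "dd_t D P \<iota> j \<in> dd_B D P \<iota> k"
  unfolding dd_B_eq E_gen[OF assms, symmetric] using dd_gen_in_dd_alg[OF assms(1), of k] by (rule imageI)

text \<open>For t = 0 the two algebras are generated by the same elements. Otherwise the fractions
  found before passing to the quotients are mapped into Frac(B), one inclusion at a time.\<close>

lemma dd_B_step:
  assumes j: "j \<in> {2..N}"
  defines "t \<equiv> dd_t D P \<iota> j"
  shows "t = 0 \<Longrightarrow> dd_B D P \<iota> j = dd_B D P \<iota> (Suc j)"
    and "t \<noteq> 0 \<Longrightarrow> dd_B D P \<iota> (Suc j) \<subseteq> fractions_by t (dd_B D P \<iota> j)"
    and "t \<noteq> 0 \<Longrightarrow> dd_B D P \<iota> j \<subseteq> fractions_by t (dd_B D P \<iota> (Suc j))"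
proof -
  let ?x = "dd_gen D (Suc j) j"
  have emb: "embeds (Suc j)" using embeds j by simp
  have t: "E (Suc j) ?x = t" using E_gen[of j "Suc j"] j by (simp add: t_def)
  have x: "?x \<in> dd_alg D (Suc j)" using dd_gen_in_dd_alg j by auto
  have prm: "?x \<in> prm (Suc j) \<longleftrightarrow> t = 0" using emb x t by (simp add: embeds_def)
  show "dd_B D P \<iota> j = dd_B D P \<iota> (Suc j)" if "t = 0"
  proof -
    have "\<forall>i\<in>{1..N}. E j (dd_gen D j i) = E (Suc j) (dd_gen D (Suc j) i)"
      using embeds_step_quotient[OF j emb] prm that by blast
    then have "(\<lambda>i. E j (dd_gen D j i)) ` {1..N} = (\<lambda>i. E (Suc j) (dd_gen D (Suc j) i)) ` {1..N}"
      by (intro image_cong) auto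
    then show ?thesis using dd_B_span[of j] dd_B_span[of "Suc j"] j by simp
  qed
  assume "t \<noteq> 0"
  then have "?x \<notin> prm (Suc j)" using prm by simp
  from embeds_step_localise[OF j emb this] t
  have E: "\<And>a n. a \<in> dd_alg D j \<Longrightarrow> a * ?x ^ n \<in> dd_alg D (Suc j) \<Longrightarrow>
      E j a = E (Suc j) (a * ?x ^ n) * inverse t ^ n" by blast
  have tinv: "inverse t ^ n * t ^ n = 1" for n using \<open>t \<noteq> 0\<close> by (simp add: power_inverse)
  show "dd_B D P \<iota> j \<subseteq> fractions_by t (dd_B D P \<iota> (Suc j))"
  proof
    fix c assume "c \<in> dd_B D P \<iota> j"
    then obtain a where a: "a \<in> dd_alg D j" "c = E j a" by (auto simp: dd_B_eq)
    then obtain n where n: "a * ?x ^ n \<in> dd_alg D (Suc j)"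
      using dd_alg_fractions(1)[OF j] by (auto simp: fractions_by_def)
    then have "c * t ^ n = E (Suc j) (a * ?x ^ n)" using E[OF a(1) n] a(2) by (simp add: mult.assoc tinv)
    then have "c * t ^ n \<in> dd_B D P \<iota> (Suc j)" using n by (simp add: dd_B_eq)
    then show "c \<in> fractions_by t (dd_B D P \<iota> (Suc j))" unfolding fractions_by_def by blast
  qed
  show "dd_B D P \<iota> (Suc j) \<subseteq> fractions_by t (dd_B D P \<iota> j)"
  proof
    fix c assume "c \<in> dd_B D P \<iota> (Suc j)"
    then obtain b where b: "b \<in> dd_alg D (Suc j)" "c = E (Suc j) b" by (auto simp: dd_B_eq)
    then obtain n where n: "b * ?x ^ n \<in> dd_alg D j"
      using dd_alg_fractions(2)[OF j] by (auto simp: fractions_by_def)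
    have xn: "?x ^ n \<in> dd_alg D (Suc j)" by (rule subalgebra_power[OF subalgebra_dd_alg x])
    have hom: "algebra_hom s sB (dd_alg D (Suc j)) (E (Suc j))" using E_hom j by simp
    have "b * ?x ^ n \<in> dd_alg D (Suc j)" using subalgebraD(8)[OF subalgebra_dd_alg b(1) xn] .
    \<comment> \<open>Exponent 0: on elements common to both stages the two embeddings
      agree.\<close>
    then have "E j (b * ?x ^ n) = E (Suc j) (b * ?x ^ n)" using E[OF n, of 0] by simp
    also have "\<dots> = c * t ^ n"
      using algebra_homD(2)[OF hom b(1) xn] b(2) algebra_hom_power[OF hom subalgebra_dd_alg x] t by simp
    finally have "c * t ^ n \<in> dd_B D P \<iota> j" using n by (auto simp: dd_B_eq intro: image_eqI[OF sym])
    then show "c \<in> fractions_by t (dd_B D P \<iota> j)" unfolding fractions_by_def by blast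
  qed
qed

lemma dd_t_skew_commute:
  assumes "i \<in> {1..N}" "k \<in> {1..N}"
  shows "dd_t D P \<iota> i * dd_t D P \<iota> k = sB (lam D i k) (dd_t D P \<iota> k * dd_t D P \<iota> i)"
proof -
  have hom: "algebra_hom s sB (dd_alg D 2) (E 2)" using E_hom N_pos by simp
  have g: "dd_gen D 2 i \<in> dd_alg D 2" "dd_gen D 2 k \<in> dd_alg D 2" using dd_gen_in_dd_alg assms by auto
  then have "dd_gen D 2 k * dd_gen D 2 i \<in> dd_alg D 2" using subalgebraD(8)[OF subalgebra_dd_alg] by blast
  then show ?thesis
    unfolding dd_t_eq
    using algebra_homD(2)[OF hom g] algebra_homD(2)[OF hom g(2,1)] dd_gen_skew_commute[OF assms]
      algebra_homD(3)[OF hom] by metis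
qed

lemma dd_t_zero:
  assumes "P \<in> CSpec_part D w" "i \<in> w" "w \<subseteq> {1..N}"
  shows "dd_t D P \<iota> i = 0"
proof -
  have "prm 2 \<inter> dd_gen D 2 ` {1..N} = dd_gen D 2 ` w"
    using assms(1) by (simp add: CSpec_part_def CSpec'_part_def)
  then have "dd_gen D 2 i \<in> prm 2" using assms(2) by blast
  then show ?thesis using embeds[of 2] N_pos by (simp add: dd_t_eq embeds_def)
qed

end

section \<open>Extending a representation to a localisation\<close>

text \<open>\<open>C\<close> will be B' and \<open>S\<close> will be \<Sigma>. Skew commutation
  inside \<open>S\<close> supplies common denominators, and \<open>S_norm\<close> is the Ore
  condition.\<close>

locale localised_representation = B: k_algebra sB + V: vector_space sV
  for sB :: "'k::field \<Rightarrow> 'b::division_ring \<Rightarrow> 'b" and sV :: "'k \<Rightarrow> 'v::ab_group_add \<Rightarrow> 'v" +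
  fixes C S :: "'b set" and \<phi> :: "'b \<Rightarrow> 'v \<Rightarrow> 'v" and \<xi> :: "'b \<Rightarrow> 'k" and L :: "'b \<Rightarrow> nat"
  assumes C: "subalgebra sB C" and S_C: "S \<subseteq> C" and S_one: "1 \<in> S"
    and S_mult: "e \<in> S \<Longrightarrow> f \<in> S \<Longrightarrow> e * f \<in> S"
    and S_comm: "e \<in> S \<Longrightarrow> f \<in> S \<Longrightarrow> \<exists>\<mu>. e * f = sB \<mu> (f * e)"
    and S_norm: "e \<in> S \<Longrightarrow> c \<in> C \<Longrightarrow> \<exists>c'\<in>C. c * e = e * c'"
    and rep: "representation sB sV C \<phi>"
    and nontrivial: "\<exists>v::'v. v \<noteq> 0"
    and root: "e \<in> S \<Longrightarrow> \<xi> e \<noteq> 0 \<and> L e > 1 \<and> \<phi> e ^^ L e = sV (\<xi> e)"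
begin

lemmas C_closed = B.subalgebraD[OF C]

lemma phi:
  shows "a \<in> C \<Longrightarrow> \<phi> a (u + v) = \<phi> a u + \<phi> a v" and "a \<in> C \<Longrightarrow> \<phi> a (sV c v) = sV c (\<phi> a v)"
    and "\<phi> 1 v = v" and "a \<in> C \<Longrightarrow> b \<in> C \<Longrightarrow> \<phi> (a * b) v = \<phi> a (\<phi> b v)"
    and "a \<in> C \<Longrightarrow> b \<in> C \<Longrightarrow> \<phi> (a + b) v = \<phi> a v + \<phi> b v"
    and "a \<in> C \<Longrightarrow> \<phi> (sB c a) v = sV c (\<phi> a v)"
  using rep by (auto simp: representation_def Vector_Spaces.linear_iff)

text \<open>If 0 were in \<open>S\<close>, it would act as zero although one of its powers acts as a
  nonzero scalar on a nonzero space.\<close>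

lemma S_nonzero:
  assumes "e \<in> S"
  shows "e \<noteq> 0"
proof
  assume "e = 0"
  obtain v :: 'v where "v \<noteq> 0" using nontrivial by blast
  have "\<phi> 0 u = 0" for u using phi(6)[OF C_closed(3), of 0 u] by simp
  moreover obtain l where "L e = Suc l" using root[OF assms] by (cases "L e") auto
  ultimately have "(\<phi> e ^^ L e) v = 0" using \<open>e = 0\<close> by simp
  then show False using root[OF assms] \<open>v \<noteq> 0\<close> by simp
qed

definition phi_inv :: "'b \<Rightarrow> 'v \<Rightarrow> 'v" where
  "phi_inv e v = sV (inverse (\<xi> e)) ((\<phi> e ^^ (L e - 1)) v)"

lemma phi_phi_inv:
  assumes "e \<in> S"
  shows "\<phi> e (phi_inv e v) = v" "phi_inv e (\<phi> e v) = v"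
proof -
  obtain l where l: "L e = Suc l" using root[OF assms] by (cases "L e") auto
  have "(\<phi> e ^^ Suc l) v = sV (\<xi> e) v" using root[OF assms] l by simp
  then show "\<phi> e (phi_inv e v) = v" "phi_inv e (\<phi> e v) = v"
    using phi(2)[of e] assms S_C root[OF assms] by (auto simp: phi_inv_def l funpow_swap1)
qed

definition loc :: "'b set" where
  "loc = {b. \<exists>e\<in>S. b * e \<in> C}"

definition \<Phi> :: "'b \<Rightarrow> 'v \<Rightarrow> 'v" where
  "\<Phi> b = (let e = (SOME e. e \<in> S \<and> b * e \<in> C) in (\<lambda>v. \<phi> (b * e) (phi_inv e v)))"

lemma Phi_independent:
  assumes e: "e \<in> S" "b * e \<in> C" and f: "f \<in> S" "b * f \<in> C"
  shows "\<phi> (b * e) (phi_inv e v) = \<phi> (b * f) (phi_inv f v)"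
proof -
  obtain \<mu> where \<mu>: "e * f = sB \<mu> (f * e)" using S_comm e f by blast
  have ef: "e \<in> C" "f \<in> C" using e f S_C by auto
  \<comment> \<open>\<open>u\<close> is the vector with v = \<phi>(e f) u, found by inverting
    \<open>e\<close> and then \<open>f\<close>; both sides become the action of b e f on it.\<close>
  define u where "u = phi_inv f (phi_inv e v)"
  have e_u: "phi_inv e v = \<phi> f u" using phi_phi_inv[OF f(1)] by (simp add: u_def)
  have "v = \<phi> (e * f) u" using phi_phi_inv[OF e(1)] by (simp add: phi(4)[OF ef] flip: e_u)
  also have "\<dots> = \<phi> f (sV \<mu> (\<phi> e u))"
    using ef C_closed(8) by (simp add: \<mu> phi(2,4,6))
  finally have "phi_inv f v = sV \<mu> (\<phi> e u)" using phi_phi_inv[OF f(1)] by simp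
  then have "\<phi> (b * f) (phi_inv f v) = sV \<mu> (\<phi> (b * f * e) u)"
    using ef f by (simp add: phi(2,4))
  also have "\<dots> = \<phi> (sB \<mu> (b * f * e)) u" using C_closed(8)[OF f(2) ef(1)] by (simp add: phi(6))
  also have "sB \<mu> (b * f * e) = b * e * f" using \<mu> by (simp add: mult.assoc B.scale_mult_right)
  finally show ?thesis using e ef by (simp add: e_u phi(4))
qed

lemma Phi_eq:
  assumes e: "e \<in> S" "b * e \<in> C"
  shows "\<Phi> b v = \<phi> (b * e) (phi_inv e v)"
proof -
  define f where "f = (SOME e. e \<in> S \<and> b * e \<in> C)"
  have "f \<in> S \<and> b * f \<in> C" unfolding f_def by (rule someI) (use e in blast)
  then show ?thesis using Phi_independent[OF e, of f v] by (simp add: \<Phi>_def Let_def flip: f_def)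
qed

lemma Phi_phi: "e \<in> S \<Longrightarrow> b * e \<in> C \<Longrightarrow> \<Phi> b (\<phi> e v) = \<phi> (b * e) v"
  by (simp add: Phi_eq phi_phi_inv)

lemma Phi_C: "c \<in> C \<Longrightarrow> \<Phi> c = \<phi> c"
  using Phi_phi[OF S_one, of c] by (auto simp: phi(3))

lemma C_loc: "C \<subseteq> loc"
  using S_one by (force simp: loc_def)

lemma loc_common:
  assumes "a \<in> loc" "b \<in> loc"
  obtains e where "e \<in> S" "a * e \<in> C" "b * e \<in> C"
proof -
  obtain e f where e: "e \<in> S" "a * e \<in> C" and f: "f \<in> S" "b * f \<in> C"
    using assms by (auto simp: loc_def)
  obtain \<mu> where \<mu>: "e * f = sB \<mu> (f * e)" using S_comm e f by blast
  have "a * (e * f) \<in> C" using C_closed(8)[OF e(2), of f] f S_C by (auto simp: mult.assoc)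
  moreover have "b * (e * f) = sB \<mu> (b * f * e)" by (simp add: \<mu> B.scale_mult_right mult.assoc)
  moreover have "b * f * e \<in> C" using C_closed(8)[OF f(2), of e] e S_C by auto
  ultimately show thesis using that[of "e * f"] S_mult e f C_closed(7) by auto
qed

text \<open>\<open>\<phi> e\<close> is onto, so identities may be tested on vectors
  \<open>\<phi> e v\<close>, where \<open>Phi_phi\<close> removes the inverse.\<close>

lemma Phi_ext:
  assumes "e \<in> S" "\<And>v. f (\<phi> e v) = g (\<phi> e v)"
  shows "f = g"
proof
  fix v show "f v = g v" using assms(2)[of "phi_inv e v"] phi_phi_inv[OF assms(1)] by simp
qed

lemma Phi_add:
  assumes "a \<in> loc" "b \<in> loc"
  shows "\<Phi> (a + b) = (\<lambda>v. \<Phi> a v + \<Phi> b v)"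
proof -
  obtain e where e: "e \<in> S" "a * e \<in> C" "b * e \<in> C" by (rule loc_common[OF assms])
  then have "(a + b) * e \<in> C" using C_closed(4) by (simp add: distrib_right)
  then show ?thesis
    by (intro Phi_ext[OF e(1)]) (simp add: Phi_phi e phi(5)[OF e(2,3)] distrib_right)
qed

lemma Phi_scale:
  assumes "a \<in> loc"
  shows "\<Phi> (sB c a) = (\<lambda>v. sV c (\<Phi> a v))"
proof -
  obtain e where e: "e \<in> S" "a * e \<in> C" using assms by (auto simp: loc_def)
  then have "sB c a * e \<in> C" using C_closed(7) by (simp add: B.scale_mult_left)
  then show ?thesis
    by (intro Phi_ext[OF e(1)]) (simp add: Phi_phi e phi(6)[OF e(2)] B.scale_mult_left)
qed

lemma Phi_mult:
  assumes "a \<in> loc" "b \<in> loc"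
  shows "\<Phi> (a * b) = \<Phi> a \<circ> \<Phi> b"
proof -
  obtain e f where e: "e \<in> S" "a * e \<in> C" and f: "f \<in> S" "b * f \<in> C"
    using assms by (auto simp: loc_def)
  have ef: "e \<in> C" "f \<in> C" using e f S_C by auto
  \<comment> \<open>Normality moves \<open>e\<close> through \<open>b * f\<close>, so
    \<open>f * e\<close> is a denominator for \<open>a * b\<close> and for \<open>b\<close>
    alike.\<close>
  obtain c where c: "c \<in> C" "b * f * e = e * c" using S_norm[OF e(1) f(2)] by blast
  have "a * b * (f * e) = a * (b * f * e)" by (simp only: mult.assoc)
  then have ab: "a * b * (f * e) = a * e * c" unfolding c(2) by (simp only: mult.assoc)
  then have "a * b * (f * e) \<in> C" using C_closed(8) e c by simp
  then have "\<Phi> (a * b) (\<phi> (f * e) v) = \<phi> (a * e) (\<phi> c v)" for v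
    using Phi_phi[OF S_mult[OF f(1) e(1)], of "a * b"] by (simp add: ab phi(4)[OF e(2) c(1)])
  moreover have "\<Phi> b (\<phi> (f * e) v) = \<phi> e (\<phi> c v)" for v
  proof -
    have "\<Phi> b (\<phi> (f * e) v) = \<phi> (b * f * e) v" by (simp add: phi(4) ef f Phi_phi)
    then show ?thesis by (simp add: c(2) phi(4)[OF ef(1) c(1)])
  qed
  ultimately show ?thesis
    by (intro Phi_ext[OF S_mult[OF f(1) e(1)]]) (simp add: Phi_phi e)
qed

lemma Phi_linear:
  assumes "a \<in> loc"
  shows "Vector_Spaces.linear sV sV (\<Phi> a)"
proof -
  obtain e where e: "e \<in> S" "a * e \<in> C" using assms by (auto simp: loc_def)
  have eC: "e \<in> C" using e S_C by auto
  have "\<Phi> a (u + v) = \<Phi> a u + \<Phi> a v" for u v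
    using Phi_phi[OF e, of "phi_inv e u + phi_inv e v"]
    by (simp add: phi(1)[OF eC] phi(1)[OF e(2)] phi_phi_inv[OF e(1)] flip: Phi_eq[OF e])
  moreover have "\<Phi> a (sV c v) = sV c (\<Phi> a v)" for c v
    using Phi_phi[OF e, of "sV c (phi_inv e v)"]
    by (simp add: phi(2)[OF eC] phi(2)[OF e(2)] phi_phi_inv[OF e(1)] flip: Phi_eq[OF e])
  ultimately show ?thesis using V.vector_space_axioms by (simp add: Vector_Spaces.linear_iff)
qed

lemma representation_Phi:
  assumes "R \<subseteq> loc"
  shows "representation sB sV R \<Phi>"
  unfolding representation_def
proof (intro conjI ballI allI)
  show "vector_space sV" by (rule V.vector_space_axioms)
  show "\<Phi> 1 = id" using Phi_C[OF C_closed(2)] by (auto simp: phi(3))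
  fix a b c assume a: "a \<in> R" and b: "b \<in> R"
  show "\<Phi> (a * b) = \<Phi> a \<circ> \<Phi> b" "\<Phi> (a + b) = (\<lambda>v. \<Phi> a v + \<Phi> b v)"
    using a b assms by (auto intro!: Phi_mult Phi_add)
next
  fix a c assume "a \<in> R"
  then have "a \<in> loc" using assms by blast
  then show "Vector_Spaces.linear sV sV (\<Phi> a)" "\<Phi> (sB c a) = (\<lambda>v. sV c (\<Phi> a v))"
    by (rule Phi_linear, rule Phi_scale)
qed

text \<open>\<open>\<phi> t\<close> is a root of a scalar, so an invariant subspace is also invariant under its inverse.\<close>

lemma invariant_under_fractions:
  assumes W: "V.subspace W" and R: "R \<subseteq> loc" "\<And>a. a \<in> R \<Longrightarrow> \<Phi> a ` W \<subseteq> W"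
    and t: "t \<in> S" "t \<in> R" and c: "c \<in> loc" "c \<in> fractions_by t R"
  shows "\<Phi> c ` W \<subseteq> W"
proof -
  have tC: "t \<in> C" using t S_C by auto
  have phi_W: "\<phi> t v \<in> W" if "v \<in> W" for v using R(2)[OF t(2)] that by (auto simp: Phi_C[OF tC])
  have "(\<phi> t ^^ k) v \<in> W" if "v \<in> W" for v k
    using that by (induction k) (auto simp: phi_W)
  then have inv_W: "phi_inv t v \<in> W" if "v \<in> W" for v
    using that V.subspace_scale[OF W] by (simp add: phi_inv_def)
  have inv_pow_W: "(phi_inv t ^^ n) v \<in> W" if "v \<in> W" for v n
    using that by (induction n) (auto simp: inv_W)
  have tn: "t ^ n \<in> C" for n by (rule B.subalgebra_power[OF C tC])
  have pow_inv: "\<phi> (t ^ n) ((phi_inv t ^^ n) v) = v" for n v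
  proof (induction n)
    case (Suc n)
    then show ?case
      using phi(4)[OF tn[of n] tC] phi_phi_inv(1)[OF t(1)] by (simp add: power_Suc2 del: power_Suc)
  qed (simp add: phi(3))
  obtain n where n: "c * t ^ n \<in> R" using c(2) by (auto simp: fractions_by_def)
  \<comment> \<open>Multiplying by t^n brings \<open>c\<close> into \<open>R\<close>; the
    compensating inverse powers already preserve \<open>W\<close>.\<close>
  have "\<Phi> c v = \<Phi> (c * t ^ n) ((phi_inv t ^^ n) v)" for v
    using Phi_mult[OF c(1) subsetD[OF C_loc tn], of n] by (simp add: Phi_C[OF tn] pow_inv)
  then show ?thesis using R(2)[OF n] inv_pow_W by auto
qed

end

section \<open>The multiplicative set generated by the images of the generators\<close>

lemma mult_closure_base: "x \<in> Y \<Longrightarrow> x \<in> mult_closure Y"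
  by (simp add: mult_closure_def hull_inc)

lemma mult_closure_closed:
  "1 \<in> mult_closure Y" "x \<in> mult_closure Y \<Longrightarrow> y \<in> mult_closure Y \<Longrightarrow> x * y \<in> mult_closure Y"
  unfolding mult_closure_def hull_def by auto

lemma mult_closure_induct [consumes 1, case_names base one mult]:
  assumes "x \<in> mult_closure Y" "\<And>y. y \<in> Y \<Longrightarrow> Q y" "Q 1" "\<And>x y. Q x \<Longrightarrow> Q y \<Longrightarrow> Q (x * y)"
  shows "Q x"
  using assms(1) unfolding mult_closure_def
  by (rule hull_induct) (use assms(2-4) in auto)

lemma (in k_algebra) skew_commute_mult:
  assumes "x * z = scale b (z * x)" "y * z = scale c (z * y)"
  shows "x * y * z = scale (b * c) (z * (x * y))"
proof -
  have "x * y * z = scale c ((x * z) * y)" by (simp add: assms(2) mult.assoc scale_mult_right)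
  also have "\<dots> = scale (b * c) (z * (x * y))"
    by (simp add: assms(1) scale_mult_left mult.assoc mult.commute)
  finally show ?thesis .
qed

lemma (in k_algebra) skew_commute_mult_right:
  assumes "z * x = scale b (x * z)" "z * y = scale c (y * z)"
  shows "z * (x * y) = scale (b * c) (x * y * z)"
proof -
  have "z * (x * y) = scale b (x * (z * y))"
    by (simp add: assms(1) scale_mult_left flip: mult.assoc)
  also have "\<dots> = scale (b * c) (x * y * z)"
    by (simp add: assms(2) scale_mult_right mult.assoc)
  finally show ?thesis .
qed

context qna_quotient
begin

abbreviation "T \<equiv> dd_t D P \<iota>"
abbreviation "Sig w \<equiv> ore_Sigma D w P \<iota>"

lemma dd_B_2: "dd_B D P \<iota> 2 = alg_span sB (T ` {1..N})"
  using dd_B_span[of 2] N_pos by (simp add: dd_t_eq)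

text \<open>The scalar is recorded as nonzero because \<open>skew_normal_span\<close> inverts it to
  show that elements of \<Sigma> are normal in B'.\<close>

lemma Sigma_skew_commute:
  assumes "e \<in> Sig w" "k \<in> {1..N}"
  shows "\<exists>\<mu>. \<mu> \<noteq> 0 \<and> e * T k = sB \<mu> (T k * e)"
  using assms(1) unfolding ore_Sigma_def
proof (induction rule: mult_closure_induct)
  case (base y)
  then show ?case using dd_t_skew_commute lam_nonzero assms(2) by blast
next
  case one
  show ?case by (intro exI[of _ 1]) simp
next
  case (mult x y)
  then show ?case using B.skew_commute_mult by (metis mult_eq_0_iff)
qed

lemma Sigma_commute:
  assumes "e \<in> Sig w" "f \<in> Sig w"
  shows "\<exists>\<mu>. e * f = sB \<mu> (f * e)"
  using assms(2) unfolding ore_Sigma_def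
proof (induction rule: mult_closure_induct)
  case (base y)
  then show ?case using Sigma_skew_commute[OF assms(1)] by blast
next
  case one
  show ?case by (intro exI[of _ 1]) simp
next
  case (mult x y)
  then show ?case using B.skew_commute_mult_right by metis
qed

lemma Sigma_subset: "Sig w \<subseteq> dd_B D P \<iota> 2"
proof
  note S = B.subalgebraD[OF B.subalgebra_alg_span]
  fix e assume "e \<in> Sig w"
  then show "e \<in> dd_B D P \<iota> 2"
    unfolding ore_Sigma_def dd_B_2
    by (induction rule: mult_closure_induct) (auto intro: B.alg_span_base S)
qed

lemma Gamma_subset_Sigma: "ore_Gamma D w P \<iota> \<subseteq> Sig w"
proof -
  have "ore_chain D w P \<iota> k \<subseteq> Sig w" for k by (induction k) auto
  then show ?thesis by (simp add: ore_Gamma_def)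
qed

end

theorem proposition5p1:
  fixes D :: "('k::field, 'a::division_ring) qna_data"
    and q :: 'k and m :: "nat \<Rightarrow> nat \<Rightarrow> int"
    and w :: "nat set" and P :: "'a set"
    and \<iota> :: "'a set \<Rightarrow> 'b::division_ring"
    and sB :: "'k \<Rightarrow> 'b \<Rightarrow> 'b"
    and sV :: "'k \<Rightarrow> 'v::ab_group_add \<Rightarrow> 'v"
    and \<phi>' :: "'b \<Rightarrow> 'v \<Rightarrow> 'v"
    and \<xi> :: "'b \<Rightarrow> 'k" and L :: "'b \<Rightarrow> nat"
  assumes qna: "quantum_nilpotent_algebra D"
    and fracA: "division_ring_of_fractions (as_ring (qna_alg D)) (\<lambda>x. x)"
    and q: "q \<noteq> 0" "q \<noteq> 1"
    and skew: "\<forall>i\<in>{1..ngen D}. \<forall>j\<in>{1..ngen D}. m i j = - m j i"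
    and lam: "\<forall>i\<in>{1..ngen D}. \<forall>j\<in>{1..ngen D}. lam D i j = q powi m i j"
    and w: "w \<in> Wset D"
    and P: "P \<in> CSpec_part D w"
    and fracB: "division_ring_of_fractions (as_ring (qna_alg D) Quot P) \<iota>"
    and algB: "k_algebra sB"
    and linB: "\<forall>c. \<forall>a\<in>qna_alg D. \<iota> (P +>\<^bsub>as_ring (qna_alg D)\<^esub> scl D c a) =
                 sB c (\<iota> (P +>\<^bsub>as_ring (qna_alg D)\<^esub> a))"
    and irr: "irreducible_representation sB sV (dd_B D P \<iota> 2) \<phi>'"
    and root: "\<forall>e\<in>ore_Sigma D w P \<iota>. \<xi> e \<noteq> 0 \<and> L e > 1 \<and> \<phi>' e ^^ L e = sV (\<xi> e)"
  shows "(\<forall>b\<in>dd_B D P \<iota> (ngen D + 1). \<exists>b'\<in>dd_B D P \<iota> 2. \<exists>e\<in>ore_Sigma D w P \<iota>.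
            b = b' * inverse e) \<and>
         (\<exists>\<phi>. (\<forall>b\<in>dd_B D P \<iota> (ngen D + 1). \<forall>b'\<in>dd_B D P \<iota> 2. \<forall>e\<in>ore_Sigma D w P \<iota>.
                 b = b' * inverse e \<longrightarrow>
                 \<phi> b = (\<lambda>v. sV (inverse (\<xi> e)) (\<phi>' b' ((\<phi>' e ^^ (L e - 1)) v)))) \<and>
              irreducible_representation sB sV (dd_B D P \<iota> (ngen D + 1)) \<phi> \<and>
              (\<forall>g\<in>ore_Gamma D w P \<iota>. \<exists>\<xi>' l'. \<xi>' \<noteq> 0 \<and> l' > 1 \<and> \<phi> g ^^ l' = sV \<xi>'))"
proof -
  interpret qna_quotient D P \<iota> sB
  proof (intro qna_quotient.intro qna.intro qna_quotient_axioms.intro)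
    show "quantum_nilpotent_algebra D" by (rule qna)
    show "ideal P (as_ring (qna_alg D))" using P by (simp add: CSpec_part_def CSpec_def)
    show "\<iota> \<in> ring_hom (as_ring (qna_alg D) Quot P) ring_of_type_algebra"
      "inj_on \<iota> (carrier (as_ring (qna_alg D) Quot P))"
      using fracB by (auto simp: division_ring_of_fractions_def)
    show "k_algebra sB" by (rule algB)
    show "\<iota> (P +>\<^bsub>as_ring (qna_alg D)\<^esub> scl D c a) = sB c (\<iota> (P +>\<^bsub>as_ring (qna_alg D)\<^esub> a))"
      if "a \<in> qna_alg D" for a c using linB that by blast
  qed
  have two: "2 \<le> Suc N" using N_pos by simp
  have rep: "Defs.representation sB sV (dd_B D P \<iota> 2) \<phi>'" and nontrivial: "\<exists>v::'v. v \<noteq> 0"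
    and simple: "\<And>W. module.subspace sV W \<Longrightarrow> (\<And>a. a \<in> dd_B D P \<iota> 2 \<Longrightarrow> \<phi>' a ` W \<subseteq> W) \<Longrightarrow> W = {0} \<or> W = UNIV"
    using irr unfolding irreducible_representation_def by blast+
  interpret R: localised_representation sB sV "dd_B D P \<iota> 2" "Sig w" \<phi>' \<xi> L
  proof (intro localised_representation.intro localised_representation_axioms.intro)
    show "k_algebra sB" by (rule algB)
    show "vector_space sV" using rep by (simp add: Defs.representation_def)
    show "subalgebra sB (dd_B D P \<iota> 2)" using subalgebra_dd_B two by simp
    show "Sig w \<subseteq> dd_B D P \<iota> 2" by (rule Sigma_subset)
    show "1 \<in> Sig w" by (simp add: ore_Sigma_def mult_closure_closed)
    show "e * f \<in> Sig w" if "e \<in> Sig w" "f \<in> Sig w" for e f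
      using that by (simp add: ore_Sigma_def mult_closure_closed)
    show "\<exists>\<mu>. e * f = sB \<mu> (f * e)" if "e \<in> Sig w" "f \<in> Sig w" for e f
      using Sigma_commute that .
    show "\<exists>c'\<in>dd_B D P \<iota> 2. c * e = e * c'" if "e \<in> Sig w" "c \<in> dd_B D P \<iota> 2" for e c
      using that(2) unfolding dd_B_2
      by (rule B.skew_normal_span[rotated]) (use Sigma_skew_commute[OF that(1)] in blast)
    show "Defs.representation sB sV (dd_B D P \<iota> 2) \<phi>'" "\<exists>v::'v. v \<noteq> 0" by (rule rep, rule nontrivial)
    show "\<xi> e \<noteq> 0 \<and> 1 < L e \<and> \<phi>' e ^^ L e = sV (\<xi> e)" if "e \<in> Sig w" for e using root that by blast
  qed
  have w_sub: "w \<subseteq> {1..N}" using w by (simp add: Wset_def)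
  \<comment> \<open>So a nonzero t_j is always an allowed denominator.\<close>
  have T_cases: "T j = 0 \<or> T j \<in> Sig w" if "j \<in> {1..N}" for j
    using that dd_t_zero[OF P _ w_sub] mult_closure_base[of "T j" "T ` ({1..N} - w)"]
    by (cases "j \<in> w") (auto simp: ore_Sigma_def)
  \<comment> \<open>Upward induction from B' to B: a denominator t_j^n acquired at stage
    \<open>j\<close> is absorbed into the element of \<Sigma> supplied by the previous
    stage.\<close>
  have in_loc: "dd_B D P \<iota> j \<subseteq> R.loc" if "2 \<le> j" "j \<le> Suc N" for j
    using that
  proof (induction j rule: dec_induct)
    case base show ?case by (rule R.C_loc)
  next
    case (step j)
    then have j: "j \<in> {2..N}" and IH: "dd_B D P \<iota> j \<subseteq> R.loc" by auto
    show ?case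
    proof (cases "T j = 0")
      case True
      then show ?thesis using dd_B_step(1)[OF j] IH by simp
    next
      case False
      then have T: "T j \<in> Sig w" using T_cases[of j] j by auto
      show ?thesis
      proof
        fix c assume "c \<in> dd_B D P \<iota> (Suc j)"
        then obtain n where "c * T j ^ n \<in> R.loc"
          using dd_B_step(2)[OF j False] IH by (auto simp: fractions_by_def)
        then obtain e where e: "e \<in> Sig w" "c * T j ^ n * e \<in> dd_B D P \<iota> 2" by (auto simp: R.loc_def)
        have "T j ^ n \<in> Sig w" by (induction n) (auto simp: R.S_one R.S_mult T)
        then have "T j ^ n * e \<in> Sig w" using R.S_mult e by blast
        then show "c \<in> R.loc" using e(2) by (auto simp: R.loc_def mult.assoc)
      qed
    qed
  qed
  \<comment> \<open>This runs in the opposite direction, from B down to B', since irreducibility is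
    known for B'.\<close>
  have invariant: "\<forall>a\<in>dd_B D P \<iota> j. R.\<Phi> a ` W \<subseteq> W"
    if W: "R.V.subspace W" "\<And>a. a \<in> dd_B D P \<iota> (Suc N) \<Longrightarrow> R.\<Phi> a ` W \<subseteq> W"
      and j: "2 \<le> j" "j \<le> Suc N" for W j
    using j(2,1)
  proof (induction j rule: inc_induct)
    case base
    show ?case using W(2) by blast
  next
    case (step j)
    then have j: "j \<in> {2..N}" and IH: "\<And>a. a \<in> dd_B D P \<iota> (Suc j) \<Longrightarrow> R.\<Phi> a ` W \<subseteq> W" by auto
    show ?case
    proof (cases "T j = 0")
      case True
      then show ?thesis using dd_B_step(1)[OF j] IH by simp
    next
      case False
      then have T: "T j \<in> Sig w" using T_cases[of j] j by auto
      \<comment> \<open>t_j already lies in B^(j+1), so \<phi>'(t_j) preserves \<open>W\<close> by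
        the induction hypothesis before its inverse is considered.\<close>
      have T': "T j \<in> dd_B D P \<iota> (Suc j)" using dd_t_in_dd_B[of j "Suc j"] j by simp
      have loc: "dd_B D P \<iota> j \<subseteq> R.loc" "dd_B D P \<iota> (Suc j) \<subseteq> R.loc"
        using in_loc[of j] in_loc[of "Suc j"] j by auto
      show ?thesis
      proof
        fix a assume a: "a \<in> dd_B D P \<iota> j"
        show "R.\<Phi> a ` W \<subseteq> W"
          by (rule R.invariant_under_fractions[OF W(1) loc(2) IH T T'])
            (use a loc(1) dd_B_step(3)[OF j False] in auto)
      qed
    qed
  qed
  have irreducible: "irreducible_representation sB sV (dd_B D P \<iota> (Suc N)) R.\<Phi>"
    unfolding irreducible_representation_def
  proof (intro conjI allI impI)
    show "Defs.representation sB sV (dd_B D P \<iota> (Suc N)) R.\<Phi>"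
      by (rule R.representation_Phi[OF in_loc[OF two order_refl]])
    show "\<exists>v::'v. v \<noteq> 0" by (rule nontrivial)
    fix W assume W: "R.V.subspace W \<and> (\<forall>a\<in>dd_B D P \<iota> (Suc N). R.\<Phi> a ` W \<subseteq> W)"
    then have "\<forall>a\<in>dd_B D P \<iota> 2. R.\<Phi> a ` W \<subseteq> W" using invariant[of W 2] two by simp
    then show "W = {0} \<or> W = UNIV" using simple[of W] W by (simp add: R.Phi_C)
  qed
  have fraction: "b * e = b'" if "b = b' * inverse e" "e \<in> Sig w" for b b' e
    using that R.S_nonzero by (simp add: mult.assoc)
  \<comment> \<open>Every way of writing \<open>b\<close> as such a fraction gives the same
    operator, so the prescribed formula is well defined.\<close>
  have formula: "R.\<Phi> b = (\<lambda>v. sV (inverse (\<xi> e)) (\<phi>' b' ((\<phi>' e ^^ (L e - 1)) v)))"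
    if "b' \<in> dd_B D P \<iota> 2" "e \<in> Sig w" "b = b' * inverse e" for b b' e
  proof
    fix v
    have "R.\<Phi> b v = \<phi>' b' (R.phi_inv e v)"
      using R.Phi_eq[of e b v] fraction[OF that(3,2)] that by simp
    then show "R.\<Phi> b v = sV (inverse (\<xi> e)) (\<phi>' b' ((\<phi>' e ^^ (L e - 1)) v))"
      by (simp add: R.phi_inv_def R.phi(2)[OF that(1)])
  qed
  have part1: "\<exists>b'\<in>dd_B D P \<iota> 2. \<exists>e\<in>Sig w. b = b' * inverse e"
    if b: "b \<in> dd_B D P \<iota> (Suc N)" for b
  proof -
    obtain e where e: "e \<in> Sig w" "b * e \<in> dd_B D P \<iota> 2"
      using subsetD[OF in_loc[OF two order_refl] b] by (auto simp: R.loc_def)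
    then have "b = b * e * inverse e" using R.S_nonzero by (simp add: mult.assoc)
    then show ?thesis using e by blast
  qed
  have roots: "\<exists>\<xi>' l'. \<xi>' \<noteq> 0 \<and> l' > 1 \<and> R.\<Phi> g ^^ l' = sV \<xi>'" if "g \<in> ore_Gamma D w P \<iota>" for g
  proof -
    have "g \<in> Sig w" using that Gamma_subset_Sigma by blast
    then have "R.\<Phi> g = \<phi>' g" using Sigma_subset R.Phi_C by blast
    then show ?thesis using root \<open>g \<in> Sig w\<close> by auto
  qed
  show ?thesis
    unfolding Suc_eq_plus1[symmetric]
    using part1 formula irreducible roots by (intro conjI exI[of _ R.\<Phi>]) blast+
qed

end
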